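(* Assume that $q$ is not a root of unity. Let $(\boldsymbol r,\boldsymbol c)\in\boldsymbol{RC}$. If $\widetilde P$ is an $\widetilde H$-prime of $B_{\boldsymbol r,\boldsymbol c}$, then there exists a unique $(H\times H)$-prime $Q$ of $R^+_{\boldsymbol r}\otimes R^-_{\boldsymbol c}$ such that $Q\cap B_{\boldsymbol r,\boldsymbol c}=\widetilde P$.
   Context: Let $k$ be an arbitrary field, $n$ a positive integer, $q\in k^\times$. All tensor products are over $k$, and $\langle\cdots\rangle$ denotes the two-sided ideal generated by the given elements. $A=\mathcal O_q(M_n(k))$ is the $k$-algebra with generators $X_{ij}$ ($1\le i,j\le n$) and relations $X_{ij}X_{lj}=qX_{lj}X_{ij}$ ($i<l$); $X_{ij}X_{im}=qX_{im}X_{ij}$ ($j<m$); $X_{ij}X_{lm}=X_{lm}X_{ij}$ ($i<l$, $j>m$); $X_{ij}X_{lm}-X_{lm}X_{ij}=(q-q^{-1})X_{im}X_{lj}$ ($i<l$, $j<m$). $\boldsymbol{RC}$ is the set of pairs $(\boldsymbol r,\boldsymbol c)$ of strictly increasing sequences $\boldsymbol r=(r_1,\dots,r_t)$, $\boldsymbol c=(c_1,\dots,c_t)$ in $\{1,\dots,n\}$ of the same length $t$ ($0\le t\le n$). Set $R^+_{\boldsymbol r,0}=A/\langle X_{ij}\mid j>t\text{ or }i<r_j\rangle$ and $R^-_{\boldsymbol c,0}=A/\langle X_{ij}\mid i>t\text{ or }j<c_i\rangle$, with $Y_{ij}$, $Z_{ij}$ the images of $X_{ij}$ in $R^+_{\boldsymbol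 r,0}$, $R^-_{\boldsymbol c,0}$ respectively. These are noetherian domains in which the $Y_{r_ss}$, respectively the $Z_{sc_s}$ ($s\le t$), are regular normal elements; set $R^+_{\boldsymbol r}=R^+_{\boldsymbol r,0}[Y_{r_11}^{-1},\dots,Y_{r_tt}^{-1}]$ and $R^-_{\boldsymbol c}=R^-_{\boldsymbol c,0}[Z_{1c_1}^{-1},\dots,Z_{tc_t}^{-1}]$. $B_{\boldsymbol r,\boldsymbol c}$ is the $k$-subalgebra of $R^+_{\boldsymbol r}\otimes R^-_{\boldsymbol c}$ generated by $\{Y_{il}\otimes Z_{lj}\mid l\le t,\ i\ge r_l,\ j\ge c_l\}\cup\{Y_{r_ll}^{-1}\otimes Z_{lc_l}^{-1}\mid l\le t\}$. The group $H=(k^\times)^n\times(k^\times)^n$ acts on $A$ by $(\alpha_1,\dots,\alpha_n,\beta_1,\dots,\beta_n).X_{ij}=\alpha_i\beta_jX_{ij}$, hence on $R^+_{\boldsymbol r}$ and $R^-_{\boldsymbol c}$; $H\times H$ acts on $R^+_{\boldsymbol r}\otimes R^-_{\boldsymbol c}$ factorwise and preserves $B_{\boldsymbol r,\boldsymbol c}$. $\widetilde H$ is the subgroup $\bigl((k^\times)^n\times\{1\}^n\bigr)\times\bigl(\{1\}^n\times(k^\times)^n\bigr)$ of $H\times H$. For a group $G$ acting on an algebra by automorphisms, a $G$-prime is a proper $G$-invariant ideal $P$ such that whenever a product of two $G$-invariant ideals is contained in $P$, one of them is contained in $P$. *)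

theory Defs
  imports "HOL-Algebra.QuotRing" "HOL-Algebra.Module" "HOL-Algebra.Ideal_Product" "HOL-Algebra.Subrings"
begin

text \<open>
  The field \<open>k\<close> is a type \<open>'k::field\<close>. A (noncommutative, unital) \<open>k\<close>-algebra is a
  ring in the sense of HOL-Algebra together with a scalar multiplication; the record
  \<^type>\<open>module\<close> provides exactly these fields.
\<close>

definition monoid_alg :: "('m, 'b) monoid_scheme \<Rightarrow> ('k::field, 'm \<Rightarrow> 'k) module" where
  "monoid_alg M =
    \<lparr>carrier = {f. finite {m. f m \<noteq> 0} \<and> {m. f m \<noteq> 0} \<subseteq> carrier M},
     mult = (\<lambda>f g w. \<Sum>(u, v) \<in> {(u, v). f u \<noteq> 0 \<and> g v \<noteq> 0 \<and> u \<otimes>\<^bsub>M\<^esub> v = w}. f u * g v),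
     one = (\<lambda>w. if w = \<one>\<^bsub>M\<^esub> then 1 else 0),
     zero = (\<lambda>w. 0),
     add = (\<lambda>f g w. f w + g w),
     smult = (\<lambda>c f w. c * f w)\<rparr>"

definition basis_vec :: "'m \<Rightarrow> 'm \<Rightarrow> 'k::field" where
  "basis_vec m = (\<lambda>w. if w = m then 1 else 0)"

definition free_monoid :: "'x set \<Rightarrow> 'x list monoid" where
  "free_monoid X = \<lparr>carrier = lists X, mult = (@), one = []\<rparr>"

definition free_alg :: "'x set \<Rightarrow> ('k::field, 'x list \<Rightarrow> 'k) module" where
  "free_alg X = monoid_alg (free_monoid X)"

definition free_gen :: "'x \<Rightarrow> 'x list \<Rightarrow> 'k::field" where
  "free_gen x = basis_vec [x]"

definition quot_alg :: "('k::field, 'a) module \<Rightarrow> 'a set \<Rightarrow> ('k, 'a set) module" where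
  "quot_alg A I =
    \<lparr>carrier = carrier (A Quot I), mult = mult (A Quot I), one = one (A Quot I),
     zero = zero (A Quot I), add = add (A Quot I),
     smult = (\<lambda>c U. \<Union>u\<in>U. I +>\<^bsub>A\<^esub> (c \<odot>\<^bsub>A\<^esub> u))\<rparr>"

definition alg_aut :: "('k::field, 'a) module \<Rightarrow> ('a \<Rightarrow> 'a) set" where
  "alg_aut A = {\<phi>. \<phi> \<in> extensional (carrier A) \<and> \<phi> \<in> ring_hom A A \<and>
     (\<forall>c. \<forall>a\<in>carrier A. \<phi> (c \<odot>\<^bsub>A\<^esub> a) = c \<odot>\<^bsub>A\<^esub> \<phi> a) \<and>
     bij_betw \<phi> (carrier A) (carrier A)}"

definition subalg_gen :: "('k::field, 'a) module \<Rightarrow> 'a set \<Rightarrow> 'a set" where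
  "subalg_gen A S = \<Inter>{V. subring V A \<and> (\<forall>c. \<forall>v\<in>V. c \<odot>\<^bsub>A\<^esub> v \<in> V) \<and> S \<subseteq> V}"

text \<open>
  The monoid algebra of the multiplicative monoid of \<open>R \<times> S\<close> is the free vector space on
  \<open>R \<times> S\<close> with the product \<open>(a, b) (a', b') = (a a', b b')\<close>. The linear span of
  the bilinearity relations is already an ideal of it, so the quotient below is the usual
  \<open>R \<otimes>\<^sub>k S\<close>.
\<close>

definition bilin_rels ::
    "('k::field, 'a) module \<Rightarrow> ('k, 'b) module \<Rightarrow> ('a \<times> 'b \<Rightarrow> 'k) set" where
  "bilin_rels R S = (let F = (monoid_alg (R \<times>\<times> S) :: ('k, 'a \<times> 'b \<Rightarrow> 'k) module) in
     {basis_vec (a \<oplus>\<^bsub>R\<^esub> a', b) \<ominus>\<^bsub>F\<^esub> (basis_vec (a, b) \<oplus>\<^bsub>F\<^esub> basis_vec (a', b)) | a a' b.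
        a \<in> carrier R \<and> a' \<in> carrier R \<and> b \<in> carrier S} \<union>
     {basis_vec (a, b \<oplus>\<^bsub>S\<^esub> b') \<ominus>\<^bsub>F\<^esub> (basis_vec (a, b) \<oplus>\<^bsub>F\<^esub> basis_vec (a, b')) | a b b'.
        a \<in> carrier R \<and> b \<in> carrier S \<and> b' \<in> carrier S} \<union>
     {basis_vec (c \<odot>\<^bsub>R\<^esub> a, b) \<ominus>\<^bsub>F\<^esub> c \<odot>\<^bsub>F\<^esub> basis_vec (a, b) | c a b.
        a \<in> carrier R \<and> b \<in> carrier S} \<union>
     {basis_vec (a, c \<odot>\<^bsub>S\<^esub> b) \<ominus>\<^bsub>F\<^esub> c \<odot>\<^bsub>F\<^esub> basis_vec (a, b) | c a b.
        a \<in> carrier R \<and> b \<in> carrier S})"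

definition tensor_ideal ::
    "('k::field, 'a) module \<Rightarrow> ('k, 'b) module \<Rightarrow> ('a \<times> 'b \<Rightarrow> 'k) set" where
  "tensor_ideal R S = Idl\<^bsub>monoid_alg (R \<times>\<times> S)\<^esub> (bilin_rels R S)"

definition tensor_alg ::
    "('k::field, 'a) module \<Rightarrow> ('k, 'b) module \<Rightarrow> ('k, ('a \<times> 'b \<Rightarrow> 'k) set) module" where
  "tensor_alg R S = quot_alg (monoid_alg (R \<times>\<times> S)) (tensor_ideal R S)"

definition pure_tensor ::
    "('k::field, 'a) module \<Rightarrow> ('k, 'b) module \<Rightarrow> 'a \<Rightarrow> 'b \<Rightarrow> ('a \<times> 'b \<Rightarrow> 'k) set" where
  "pure_tensor R S a b = tensor_ideal R S +>\<^bsub>monoid_alg (R \<times>\<times> S)\<^esub> basis_vec (a, b)"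

text \<open>
  \<open>R[s\<^sup>-\<^sup>1 | s \<in> S]\<close> is given by its universal property: it is the algebra generated
  by a copy \<open>Inl ` R\<close> of \<open>R\<close> and by elements \<open>Inr s\<close>, subject to the relations
  saying that \<open>Inl\<close> is an algebra homomorphism and that \<open>Inr s\<close> is a two-sided inverse of
  \<open>Inl s\<close>. If \<open>S\<close> consists of regular normal elements, the multiplicative set generated
  by \<open>S\<close> is an Ore set and this is the ring of fractions with respect to it.
\<close>

definition loc_gens :: "'a set \<Rightarrow> 'a set \<Rightarrow> ('a + 'a) set" where
  "loc_gens C S = Inl ` C \<union> Inr ` S"

definition loc_rels :: "('k::field, 'a) module \<Rightarrow> 'a set \<Rightarrow> (('a + 'a) list \<Rightarrow> 'k) set" where
  "loc_rels R S = (let F = (free_alg (loc_gens (carrier R) S) :: ('k, ('a + 'a) list \<Rightarrow> 'k) module)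
   in
     {free_gen (Inl (a \<oplus>\<^bsub>R\<^esub> b)) \<ominus>\<^bsub>F\<^esub> (free_gen (Inl a) \<oplus>\<^bsub>F\<^esub> free_gen (Inl b)) | a b.
        a \<in> carrier R \<and> b \<in> carrier R} \<union>
     {free_gen (Inl (a \<otimes>\<^bsub>R\<^esub> b)) \<ominus>\<^bsub>F\<^esub> free_gen (Inl a) \<otimes>\<^bsub>F\<^esub> free_gen (Inl b) | a b.
        a \<in> carrier R \<and> b \<in> carrier R} \<union>
     {free_gen (Inl (c \<odot>\<^bsub>R\<^esub> a)) \<ominus>\<^bsub>F\<^esub> c \<odot>\<^bsub>F\<^esub> free_gen (Inl a) | c a. a \<in> carrier R} \<union>
     {free_gen (Inl \<one>\<^bsub>R\<^esub>) \<ominus>\<^bsub>F\<^esub> \<one>\<^bsub>F\<^esub>} \<union>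
     {free_gen (Inl s) \<otimes>\<^bsub>F\<^esub> free_gen (Inr s) \<ominus>\<^bsub>F\<^esub> \<one>\<^bsub>F\<^esub> | s. s \<in> S} \<union>
     {free_gen (Inr s) \<otimes>\<^bsub>F\<^esub> free_gen (Inl s) \<ominus>\<^bsub>F\<^esub> \<one>\<^bsub>F\<^esub> | s. s \<in> S})"

definition loc_ideal :: "('k::field, 'a) module \<Rightarrow> 'a set \<Rightarrow> (('a + 'a) list \<Rightarrow> 'k) set" where
  "loc_ideal R S = Idl\<^bsub>free_alg (loc_gens (carrier R) S)\<^esub> (loc_rels R S)"

definition loc_alg ::
    "('k::field, 'a) module \<Rightarrow> 'a set \<Rightarrow> ('k, (('a + 'a) list \<Rightarrow> 'k) set) module" where
  "loc_alg R S = quot_alg (free_alg (loc_gens (carrier R) S)) (loc_ideal R S)"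

definition loc_map ::
    "('k::field, 'a) module \<Rightarrow> 'a set \<Rightarrow> 'a \<Rightarrow> (('a + 'a) list \<Rightarrow> 'k) set" where
  "loc_map R S a = loc_ideal R S +>\<^bsub>free_alg (loc_gens (carrier R) S)\<^esub> free_gen (Inl a)"

text \<open>
  The automorphism of \<open>B\<close> induced by a map \<open>f : A \<rightarrow> A\<close> along \<open>\<pi> : A \<rightarrow> B\<close>. It is used only
  when \<open>\<pi>\<close> is a quotient map followed by a localization map, so it is unique.
\<close>

definition induced_aut ::
    "('k::field, 'a) module \<Rightarrow> ('k, 'b) module \<Rightarrow> ('a \<Rightarrow> 'b) \<Rightarrow> ('a \<Rightarrow> 'a) \<Rightarrow> 'b \<Rightarrow> 'b" where
  "induced_aut A B \<pi> f = (THE \<phi>. \<phi> \<in> alg_aut B \<and> (\<forall>a\<in>carrier A. \<phi> (\<pi> a) = \<pi> (f a)))"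

definition tensor_aut ::
    "('k::field, 'a) module \<Rightarrow> ('k, 'b) module \<Rightarrow> ('a \<Rightarrow> 'a) \<Rightarrow> ('b \<Rightarrow> 'b)
      \<Rightarrow> ('a \<times> 'b \<Rightarrow> 'k) set \<Rightarrow> ('a \<times> 'b \<Rightarrow> 'k) set" where
  "tensor_aut R S f g = (THE \<phi>. \<phi> \<in> alg_aut (tensor_alg R S) \<and>
     (\<forall>a\<in>carrier R. \<forall>b\<in>carrier S. \<phi> (pure_tensor R S a b) = pure_tensor R S (f a) (g b)))"

definition invariant_ideal ::
    "('g, 'c) monoid_scheme \<Rightarrow> ('g \<Rightarrow> 'a \<Rightarrow> 'a) \<Rightarrow> ('a, 'b) ring_scheme \<Rightarrow> 'a set \<Rightarrow> bool" where
  "invariant_ideal G act R I \<longleftrightarrow> ideal I R \<and> (\<forall>g\<in>carrier G. \<forall>x\<in>I. act g x \<in> I)"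

definition G_prime ::
    "('g, 'c) monoid_scheme \<Rightarrow> ('g \<Rightarrow> 'a \<Rightarrow> 'a) \<Rightarrow> ('a, 'b) ring_scheme \<Rightarrow> 'a set \<Rightarrow> bool" where
  "G_prime G act R P \<longleftrightarrow>
     invariant_ideal G act R P \<and> P \<noteq> carrier R \<and>
     (\<forall>I J. invariant_ideal G act R I \<longrightarrow> invariant_ideal G act R J \<longrightarrow>
        I \<cdot>\<^bsub>R\<^esub> J \<subseteq> P \<longrightarrow> I \<subseteq> P \<or> J \<subseteq> P)"

definition mat_idx :: "nat \<Rightarrow> (nat \<times> nat) set" where
  "mat_idx n = {1..n} \<times> {1..n}"

definition qmat_rels :: "nat \<Rightarrow> 'k::field \<Rightarrow> ((nat \<times> nat) list \<Rightarrow> 'k) set" where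
  "qmat_rels n q = (let F = (free_alg (mat_idx n) :: ('k, (nat \<times> nat) list \<Rightarrow> 'k) module);
       x = (\<lambda>i j. free_gen (i, j)) in
     {x i j \<otimes>\<^bsub>F\<^esub> x l j \<ominus>\<^bsub>F\<^esub> q \<odot>\<^bsub>F\<^esub> (x l j \<otimes>\<^bsub>F\<^esub> x i j) | i j l.
        {i, j, l} \<subseteq> {1..n} \<and> i < l} \<union>
     {x i j \<otimes>\<^bsub>F\<^esub> x i m \<ominus>\<^bsub>F\<^esub> q \<odot>\<^bsub>F\<^esub> (x i m \<otimes>\<^bsub>F\<^esub> x i j) | i j m.
        {i, j, m} \<subseteq> {1..n} \<and> j < m} \<union>
     {x i j \<otimes>\<^bsub>F\<^esub> x l m \<ominus>\<^bsub>F\<^esub> x l m \<otimes>\<^bsub>F\<^esub> x i j | i j l m.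
        {i, j, l, m} \<subseteq> {1..n} \<and> i < l \<and> j > m} \<union>
     {(x i j \<otimes>\<^bsub>F\<^esub> x l m \<ominus>\<^bsub>F\<^esub> x l m \<otimes>\<^bsub>F\<^esub> x i j)
        \<ominus>\<^bsub>F\<^esub> (q - inverse q) \<odot>\<^bsub>F\<^esub> (x i m \<otimes>\<^bsub>F\<^esub> x l j) | i j l m.
        {i, j, l, m} \<subseteq> {1..n} \<and> i < l \<and> j < m})"

definition qmat_ideal :: "nat \<Rightarrow> 'k::field \<Rightarrow> ((nat \<times> nat) list \<Rightarrow> 'k) set" where
  "qmat_ideal n q = Idl\<^bsub>free_alg (mat_idx n)\<^esub> (qmat_rels n q)"

definition qmat :: "nat \<Rightarrow> 'k::field \<Rightarrow> ('k, ((nat \<times> nat) list \<Rightarrow> 'k) set) module" where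
  "qmat n q = quot_alg (free_alg (mat_idx n)) (qmat_ideal n q)"

definition qX :: "nat \<Rightarrow> 'k::field \<Rightarrow> nat \<Rightarrow> nat \<Rightarrow> ((nat \<times> nat) list \<Rightarrow> 'k) set" where
  "qX n q i j = qmat_ideal n q +>\<^bsub>free_alg (mat_idx n)\<^esub> free_gen (i, j)"

definition RC :: "nat \<Rightarrow> (nat list \<times> nat list) set" where
  "RC n = {(r, c). sorted_wrt (<) r \<and> sorted_wrt (<) c \<and>
             set r \<subseteq> {1..n} \<and> set c \<subseteq> {1..n} \<and> length r = length c}"

text \<open>Entries of sequences are counted from 1.\<close>

definition entry :: "nat list \<Rightarrow> nat \<Rightarrow> nat" where
  "entry r j = r ! (j - 1)"

type_synonym 'k qm = "((nat \<times> nat) list \<Rightarrow> 'k) set"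
type_synonym 'k qm_loc = "(('k qm set + 'k qm set) list \<Rightarrow> 'k) set"

definition Rplus0_ideal :: "nat \<Rightarrow> 'k::field \<Rightarrow> nat list \<Rightarrow> 'k qm set" where
  "Rplus0_ideal n q r = Idl\<^bsub>qmat n q\<^esub>
     {qX n q i j | i j. (i, j) \<in> mat_idx n \<and> (j > length r \<or> i < entry r j)}"

definition Rplus0 :: "nat \<Rightarrow> 'k::field \<Rightarrow> nat list \<Rightarrow> ('k, 'k qm set) module" where
  "Rplus0 n q r = quot_alg (qmat n q) (Rplus0_ideal n q r)"

definition Rminus0_ideal :: "nat \<Rightarrow> 'k::field \<Rightarrow> nat list \<Rightarrow> 'k qm set" where
  "Rminus0_ideal n q c = Idl\<^bsub>qmat n q\<^esub>
     {qX n q i j | i j. (i, j) \<in> mat_idx n \<and> (i > length c \<or> j < entry c i)}"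

definition Rminus0 :: "nat \<Rightarrow> 'k::field \<Rightarrow> nat list \<Rightarrow> ('k, 'k qm set) module" where
  "Rminus0 n q c = quot_alg (qmat n q) (Rminus0_ideal n q c)"

definition Y0 :: "nat \<Rightarrow> 'k::field \<Rightarrow> nat list \<Rightarrow> nat \<Rightarrow> nat \<Rightarrow> 'k qm set" where
  "Y0 n q r i j = Rplus0_ideal n q r +>\<^bsub>qmat n q\<^esub> qX n q i j"

definition Z0 :: "nat \<Rightarrow> 'k::field \<Rightarrow> nat list \<Rightarrow> nat \<Rightarrow> nat \<Rightarrow> 'k qm set" where
  "Z0 n q c i j = Rminus0_ideal n q c +>\<^bsub>qmat n q\<^esub> qX n q i j"

definition Ydiag :: "nat \<Rightarrow> 'k::field \<Rightarrow> nat list \<Rightarrow> 'k qm set set" where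
  "Ydiag n q r = {Y0 n q r (entry r s) s | s. s \<in> {1..length r}}"

definition Zdiag :: "nat \<Rightarrow> 'k::field \<Rightarrow> nat list \<Rightarrow> 'k qm set set" where
  "Zdiag n q c = {Z0 n q c s (entry c s) | s. s \<in> {1..length c}}"

definition Rplus :: "nat \<Rightarrow> 'k::field \<Rightarrow> nat list \<Rightarrow> ('k, 'k qm_loc) module" where
  "Rplus n q r = loc_alg (Rplus0 n q r) (Ydiag n q r)"

definition Rminus :: "nat \<Rightarrow> 'k::field \<Rightarrow> nat list \<Rightarrow> ('k, 'k qm_loc) module" where
  "Rminus n q c = loc_alg (Rminus0 n q c) (Zdiag n q c)"

definition to_Rplus :: "nat \<Rightarrow> 'k::field \<Rightarrow> nat list \<Rightarrow> 'k qm \<Rightarrow> 'k qm_loc" where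
  "to_Rplus n q r a =
     loc_map (Rplus0 n q r) (Ydiag n q r) (Rplus0_ideal n q r +>\<^bsub>qmat n q\<^esub> a)"

definition to_Rminus :: "nat \<Rightarrow> 'k::field \<Rightarrow> nat list \<Rightarrow> 'k qm \<Rightarrow> 'k qm_loc" where
  "to_Rminus n q c a =
     loc_map (Rminus0 n q c) (Zdiag n q c) (Rminus0_ideal n q c +>\<^bsub>qmat n q\<^esub> a)"

abbreviation Yel :: "nat \<Rightarrow> 'k::field \<Rightarrow> nat list \<Rightarrow> nat \<Rightarrow> nat \<Rightarrow> 'k qm_loc" where
  "Yel n q r i j \<equiv> to_Rplus n q r (qX n q i j)"

abbreviation Zel :: "nat \<Rightarrow> 'k::field \<Rightarrow> nat list \<Rightarrow> nat \<Rightarrow> nat \<Rightarrow> 'k qm_loc" where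
  "Zel n q c i j \<equiv> to_Rminus n q c (qX n q i j)"

type_synonym 'k qm_tensor = "('k qm_loc \<times> 'k qm_loc \<Rightarrow> 'k) set"

definition RR :: "nat \<Rightarrow> 'k::field \<Rightarrow> nat list \<Rightarrow> nat list \<Rightarrow> ('k, 'k qm_tensor) module" where
  "RR n q r c = tensor_alg (Rplus n q r) (Rminus n q c)"

definition B_gens :: "nat \<Rightarrow> 'k::field \<Rightarrow> nat list \<Rightarrow> nat list \<Rightarrow> 'k qm_tensor set" where
  "B_gens n q r c =
     {pure_tensor (Rplus n q r) (Rminus n q c) (Yel n q r i l) (Zel n q c l j) | i j l.
        l \<in> {1..length r} \<and> i \<in> {entry r l..n} \<and> j \<in> {entry c l..n}} \<union>
     {pure_tensor (Rplus n q r) (Rminus n q c)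
        (inv\<^bsub>Rplus n q r\<^esub> (Yel n q r (entry r l) l))
        (inv\<^bsub>Rminus n q c\<^esub> (Zel n q c l (entry c l))) | l.
        l \<in> {1..length r}}"

definition B_alg :: "nat \<Rightarrow> 'k::field \<Rightarrow> nat list \<Rightarrow> nat list \<Rightarrow> ('k, 'k qm_tensor) module" where
  "B_alg n q r c = (RR n q r c)\<lparr>carrier := subalg_gen (RR n q r c) (B_gens n q r c)\<rparr>"

definition torus :: "nat \<Rightarrow> (nat \<Rightarrow> 'k::field) monoid" where
  "torus n = \<lparr>carrier = {1..n} \<rightarrow>\<^sub>E (UNIV - {0}),
              mult = (\<lambda>\<alpha> \<beta>. \<lambda>i\<in>{1..n}. \<alpha> i * \<beta> i),
              one = (\<lambda>i\<in>{1..n}. 1)\<rparr>"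

type_synonym 'k hgrp = "(nat \<Rightarrow> 'k) \<times> (nat \<Rightarrow> 'k)"

definition H :: "nat \<Rightarrow> 'k::field hgrp monoid" where
  "H n = torus n \<times>\<times> torus n"

definition Htilde :: "nat \<Rightarrow> ('k::field hgrp \<times> 'k hgrp) monoid" where
  "Htilde n = (H n \<times>\<times> H n)\<lparr>carrier :=
     (carrier (torus n) \<times> {\<one>\<^bsub>torus n\<^esub>}) \<times> ({\<one>\<^bsub>torus n\<^esub>} \<times> carrier (torus n))\<rparr>"

definition act_A :: "nat \<Rightarrow> 'k::field \<Rightarrow> 'k hgrp \<Rightarrow> 'k qm \<Rightarrow> 'k qm" where
  "act_A n q = (\<lambda>(\<alpha>, \<beta>). THE \<phi>. \<phi> \<in> alg_aut (qmat n q) \<and>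
     (\<forall>(i, j)\<in>mat_idx n. \<phi> (qX n q i j) = (\<alpha> i * \<beta> j) \<odot>\<^bsub>qmat n q\<^esub> qX n q i j))"

definition act_plus :: "nat \<Rightarrow> 'k::field \<Rightarrow> nat list \<Rightarrow> 'k hgrp \<Rightarrow> 'k qm_loc \<Rightarrow> 'k qm_loc" where
  "act_plus n q r h = induced_aut (qmat n q) (Rplus n q r) (to_Rplus n q r) (act_A n q h)"

definition act_minus :: "nat \<Rightarrow> 'k::field \<Rightarrow> nat list \<Rightarrow> 'k hgrp \<Rightarrow> 'k qm_loc \<Rightarrow> 'k qm_loc" where
  "act_minus n q c h = induced_aut (qmat n q) (Rminus n q c) (to_Rminus n q c) (act_A n q h)"

definition act_RR ::
    "nat \<Rightarrow> 'k::field \<Rightarrow> nat list \<Rightarrow> nat list \<Rightarrow> 'k hgrp \<times> 'k hgrp \<Rightarrow> 'k qm_tensor \<Rightarrow> 'k qm_tensor"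
  where
  "act_RR n q r c = (\<lambda>(g, h).
     tensor_aut (Rplus n q r) (Rminus n q c) (act_plus n q r g) (act_minus n q c h))"

end

theory Submission
  imports Defs
begin

text \<open>
  Write \<open>R = R\<^sup>+ \<otimes> R\<^sup>-\<close>, \<open>y\<^sub>l = Y\<^bsub>r_l l\<^esub> \<otimes> 1\<close> and \<open>z\<^sub>l = 1 \<otimes> Z\<^bsub>l c_l\<^esub>\<close>. The elements \<open>y\<^sub>l, z\<^sub>l\<close>
  commute with the generators up to powers of \<open>q\<close>, and conjugation by them is the action of an
  element of \<open>H \<times> H\<close>. Every element of \<open>R\<close> is a sum of terms \<open>b z\<^sup>d\<close> with \<open>b \<in> B\<close> and an integer
  vector \<open>d\<close>, and the subtorus of \<open>H \<times> H\<close> that scales column \<open>l\<close> of \<open>Y\<close> and row \<open>l\<close> of \<open>Z\<close> inversely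
  fixes \<open>B\<close> and acts on \<open>z\<^sup>d\<close> through \<open>d\<close>. Since \<open>q\<close> is not a root of unity, its weights separate
  the summands, so every \<open>(H \<times> H)\<close>-invariant ideal \<open>J\<close> of \<open>R\<close> is \<open>\<Sum> (J \<inter> B) z\<^sup>d\<close>.

  Conversely let \<open>I\<close> be an \<open>H~\<close>-invariant ideal of \<open>B\<close>. It is invariant under conjugation by the unit
  \<open>y\<^sub>l z\<^sub>l\<close> of \<open>B\<close>, which up to \<open>H~\<close> multiplies an element of degree \<open>d\<close> in the inner indices by
  \<open>q\<close> to the power \<open>2 d\<^sub>l\<close>. Separating weights again, \<open>I\<close> is homogeneous in these degrees, hence invariant
  under all of \<open>H \<times> H\<close> and under conjugation by \<open>z\<^sub>l\<close>, so that \<open>\<Sum> I z\<^sup>d\<close> is an invariant ideal of \<open>R\<close>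
  contracting to \<open>I\<close>. The two maps are mutually inverse, and contraction is compatible with products
  of ideals; hence they match the primes.
\<close>

section \<open>Algebras over a field\<close>

text \<open>A generator Y_il (x) Z_lj of B has two outer indices i, j and an inner index l. On B the
  group H x H acts by one scalar for each of the three, while the smaller group only reaches the
  outer ones; conjugation by z_l also scales an inner index. So the point is to recover the inner
  scaling from invariance under the smaller group. Conjugation by the unit y_l z_l does it: one
  factor q comes from column l of Y and one from row l of Z, which explains the exponent 2, and the
  rest of its effect lies on outer indices. All algebras are given by generators and relations, and
  no basis of B or R is at hand. Sums are treated as spans of eigenvectors, and directness comes
  from distinct eigenvalues. Normality of the diagonal entries is computed from the relations: the
  correction term vanishes because one of its factors has been killed. The actions are definite
  descriptions, so each must be shown to exist and to be unique before its values can be used. The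
  core argument takes place in an abstract algebra; quantum matrices enter only when its axioms are
  checked.\<close>

locale kalg = ring A for A :: "('k::field, 'a) module" (structure) +
  assumes smult_closed [simp, intro]: "a \<in> carrier A \<Longrightarrow> s \<odot> a \<in> carrier A"
    and smult_add_left: "a \<in> carrier A \<Longrightarrow> (s + s') \<odot> a = s \<odot> a \<oplus> s' \<odot> a"
    and smult_add_right: "a \<in> carrier A \<Longrightarrow> b \<in> carrier A \<Longrightarrow> s \<odot> (a \<oplus> b) = s \<odot> a \<oplus> s \<odot> b"
    and smult_smult: "a \<in> carrier A \<Longrightarrow> s \<odot> (s' \<odot> a) = (s * s') \<odot> a"
    and smult_one [simp]: "a \<in> carrier A \<Longrightarrow> 1 \<odot> a = a"
    and smult_mult_left: "a \<in> carrier A \<Longrightarrow> b \<in> carrier A \<Longrightarrow> (s \<odot> a) \<otimes> b = s \<odot> (a \<otimes> b)"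
    and smult_mult_right: "a \<in> carrier A \<Longrightarrow> b \<in> carrier A \<Longrightarrow> a \<otimes> (s \<odot> b) = s \<odot> (a \<otimes> b)"
begin

lemma smult_zero_right [simp]: "s \<odot> \<zero> = \<zero>"
proof -
  have "s \<odot> \<zero> \<oplus> s \<odot> \<zero> = s \<odot> \<zero> \<oplus> \<zero>"
    using smult_add_right[of \<zero> \<zero> s] by simp
  then show ?thesis by simp
qed

lemma smult_zero_left [simp]:
  assumes "a \<in> carrier A" shows "0 \<odot> a = \<zero>"
proof -
  have "0 \<odot> a \<oplus> 0 \<odot> a = 0 \<odot> a \<oplus> \<zero>"
    using smult_add_left[of a 0 0] assms by simp
  then show ?thesis using assms by simp
qed

lemma minus_eq_smult:
  assumes "a \<in> carrier A" shows "\<ominus> a = (-1) \<odot> a"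
proof -
  have "a \<oplus> (-1) \<odot> a = \<zero>"
    using smult_add_left[of a 1 "-1"] assms by simp
  then show ?thesis using assms
    by (metis a_comm minus_equality smult_closed)
qed

lemma smult_minus:
  assumes "a \<in> carrier A" "b \<in> carrier A"
  shows "s \<odot> (a \<ominus> b) = s \<odot> a \<ominus> s \<odot> b"
  using assms by (simp add: minus_eq minus_eq_smult smult_add_right smult_smult mult.commute)

lemma smult_finsum:
  assumes "finite W" "\<And>w. w \<in> W \<Longrightarrow> x w \<in> carrier A"
  shows "s \<odot> (\<Oplus>w\<in>W. x w) = (\<Oplus>w\<in>W. s \<odot> x w)"
  using assms
proof (induction W rule: finite_induct)
  case (insert w W)
  then show ?case by (simp add: smult_add_right finsum_closed Pi_iff)
qed simp

text \<open>Scaling by \<open>s\<close> is multiplication by \<open>s \<odot> \<one>\<close>. Hence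
  ring ideals, which is what \<open>invariant_ideal\<close> speaks of, are subspaces, and
  eigenvector arguments apply to them.\<close>

lemma ideal_smult_closed:
  assumes "ideal I A" "x \<in> I" shows "s \<odot> x \<in> I"
proof -
  have x: "x \<in> carrier A" using assms ideal.Icarr by fast
  have "(s \<odot> \<one>) \<otimes> x \<in> I" using assms by (intro ideal.I_l_closed) auto
  then show ?thesis using x by (simp add: smult_mult_left)
qed

lemma inv_unique_mult:
  assumes "u \<in> carrier A" "v \<in> carrier A" "u \<otimes> v = \<one>" "v \<otimes> u = \<one>"
  shows "inv u = v"
  using inv_unique'[OF assms] by simp

end

section \<open>Subalgebras and generation\<close>

definition subalg :: "('k::field, 'a) module \<Rightarrow> 'a set \<Rightarrow> bool" where
  "subalg A V \<longleftrightarrow> subring V A \<and> (\<forall>s. \<forall>v\<in>V. s \<odot>\<^bsub>A\<^esub> v \<in> V)"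

lemma subalgD:
  assumes "subalg A V"
  shows "V \<subseteq> carrier A" "\<one>\<^bsub>A\<^esub> \<in> V" "\<zero>\<^bsub>A\<^esub> \<in> V"
    and "x \<in> V \<Longrightarrow> y \<in> V \<Longrightarrow> x \<oplus>\<^bsub>A\<^esub> y \<in> V"
    and "x \<in> V \<Longrightarrow> y \<in> V \<Longrightarrow> x \<otimes>\<^bsub>A\<^esub> y \<in> V"
    and "x \<in> V \<Longrightarrow> s \<odot>\<^bsub>A\<^esub> x \<in> V"
    and "x \<in> V \<Longrightarrow> \<ominus>\<^bsub>A\<^esub> x \<in> V"
  using assms subringE[of V A] unfolding subalg_def by auto

lemma (in kalg) subalgI:
  assumes "V \<subseteq> carrier A" "\<one> \<in> V"
    and add: "\<And>x y. x \<in> V \<Longrightarrow> y \<in> V \<Longrightarrow> x \<oplus> y \<in> V"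
    and mult: "\<And>x y. x \<in> V \<Longrightarrow> y \<in> V \<Longrightarrow> x \<otimes> y \<in> V"
    and smult: "\<And>s x. x \<in> V \<Longrightarrow> s \<odot> x \<in> V"
  shows "subalg A V"
  unfolding subalg_def
proof (intro conjI subringI)
  show "\<ominus> h \<in> V" if "h \<in> V" for h
    using smult[OF that, of "-1"] that assms(1) minus_eq_smult by auto
qed (use assms in auto)

lemma (in kalg) subalg_carrier: "subalg A (carrier A)"
  by (rule subalgI) auto

lemma subalg_gen_eq: "subalg_gen A S = \<Inter>{V. subalg A V \<and> S \<subseteq> V}"
  unfolding subalg_gen_def subalg_def by (simp add: conj_assoc)

lemma subalg_gen_least: "subalg A V \<Longrightarrow> S \<subseteq> V \<Longrightarrow> subalg_gen A S \<subseteq> V"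
  unfolding subalg_gen_eq by auto

lemma subalg_gen_incl: "S \<subseteq> subalg_gen A S"
  unfolding subalg_gen_eq by auto

context kalg
begin

text \<open>The hypothesis puts \<open>carrier A\<close> into the family that is intersected; for
  other \<open>S\<close> that family is empty and its intersection is the whole type.\<close>

lemma subalg_gen_subalg:
  assumes "S \<subseteq> carrier A" shows "subalg A (subalg_gen A S)"
proof (rule subalgI)
  show "subalg_gen A S \<subseteq> carrier A"
    using assms subalg_carrier by (rule subalg_gen_least[rotated])
qed (auto simp: subalg_gen_eq dest: subalgD)

lemma subalg_gen_mono:
  assumes "S \<subseteq> subalg_gen A T" "T \<subseteq> carrier A" shows "subalg_gen A S \<subseteq> subalg_gen A T"
  using assms subalg_gen_subalg subalg_gen_least by metis

end

lemma (in kalg) subalg_kalg: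
  assumes "subalg A V" shows "kalg (A\<lparr>carrier := V\<rparr>)"
proof -
  note VD = subalgD[OF assms]
  have "ring (A\<lparr>carrier := V\<rparr>)"
    using assms subring_is_ring unfolding subalg_def by blast
  moreover have "v \<in> carrier A" if "v \<in> V" for v using VD(1) that by auto
  ultimately show ?thesis
    using VD(6) smult_add_left smult_add_right smult_smult smult_mult_left smult_mult_right
    by (intro kalg.intro kalg_axioms.intro) simp_all
qed

section \<open>Algebra homomorphisms and automorphisms\<close>

definition alg_hom :: "('k::field, 'a) module \<Rightarrow> ('k, 'b) module \<Rightarrow> ('a \<Rightarrow> 'b) \<Rightarrow> bool" where
  "alg_hom A C \<phi> \<longleftrightarrow> \<phi> \<in> ring_hom A C \<and>
     (\<forall>s. \<forall>a\<in>carrier A. \<phi> (s \<odot>\<^bsub>A\<^esub> a) = s \<odot>\<^bsub>C\<^esub> \<phi> a)"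

lemma alg_homD:
  assumes "alg_hom A C \<phi>"
  shows "a \<in> carrier A \<Longrightarrow> \<phi> a \<in> carrier C"
    and "a \<in> carrier A \<Longrightarrow> b \<in> carrier A \<Longrightarrow> \<phi> (a \<oplus>\<^bsub>A\<^esub> b) = \<phi> a \<oplus>\<^bsub>C\<^esub> \<phi> b"
    and "a \<in> carrier A \<Longrightarrow> b \<in> carrier A \<Longrightarrow> \<phi> (a \<otimes>\<^bsub>A\<^esub> b) = \<phi> a \<otimes>\<^bsub>C\<^esub> \<phi> b"
    and "a \<in> carrier A \<Longrightarrow> \<phi> (s \<odot>\<^bsub>A\<^esub> a) = s \<odot>\<^bsub>C\<^esub> \<phi> a"
    and "\<phi> \<one>\<^bsub>A\<^esub> = \<one>\<^bsub>C\<^esub>"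
  using assms unfolding alg_hom_def ring_hom_def by auto

lemma alg_homI:
  assumes "\<And>a. a \<in> carrier A \<Longrightarrow> \<phi> a \<in> carrier C"
    and "\<And>a b. a \<in> carrier A \<Longrightarrow> b \<in> carrier A \<Longrightarrow> \<phi> (a \<oplus>\<^bsub>A\<^esub> b) = \<phi> a \<oplus>\<^bsub>C\<^esub> \<phi> b"
    and "\<And>a b. a \<in> carrier A \<Longrightarrow> b \<in> carrier A \<Longrightarrow> \<phi> (a \<otimes>\<^bsub>A\<^esub> b) = \<phi> a \<otimes>\<^bsub>C\<^esub> \<phi> b"
    and "\<And>s a. a \<in> carrier A \<Longrightarrow> \<phi> (s \<odot>\<^bsub>A\<^esub> a) = s \<odot>\<^bsub>C\<^esub> \<phi> a"
    and "\<phi> \<one>\<^bsub>A\<^esub> = \<one>\<^bsub>C\<^esub>"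
  shows "alg_hom A C \<phi>"
  using assms unfolding alg_hom_def ring_hom_def by auto

lemma alg_hom_comp:
  assumes "alg_hom A C \<phi>" "alg_hom C D \<psi>"
  shows "alg_hom A D (\<lambda>x. \<psi> (\<phi> x))"
  using alg_homD[OF assms(1)] alg_homD[OF assms(2)] by (intro alg_homI) auto

lemma alg_hom_id: "alg_hom A A (\<lambda>x. x)"
  by (rule alg_homI) auto

lemma alg_hom_cong:
  assumes "kalg A" "\<And>a. a \<in> carrier A \<Longrightarrow> \<phi> a = \<psi> a" "alg_hom A C \<phi>"
  shows "alg_hom A C \<psi>"
proof -
  interpret kalg A by fact
  show ?thesis
    using alg_homD[OF assms(3)] assms(2)
    by (intro alg_homI) (metis assms(2) add.m_closed m_closed smult_closed one_closed)+
qed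

locale kalg_hom = dom: kalg A + cod: kalg C for A :: "('k::field, 'a) module" (structure)
    and C :: "('k, 'b) module" (structure) and \<phi> +
  assumes hom: "alg_hom A C \<phi>"
begin

lemmas hom_closed [simp] = alg_homD(1)[OF hom]
lemmas hom_add = alg_homD(2)[OF hom]
lemmas hom_mult = alg_homD(3)[OF hom]
lemmas hom_smult = alg_homD(4)[OF hom]
lemmas hom_one [simp] = alg_homD(5)[OF hom]

lemma hom_zero [simp]: "\<phi> \<zero>\<^bsub>A\<^esub> = \<zero>\<^bsub>C\<^esub>"
  using hom_smult[of "\<zero>\<^bsub>A\<^esub>" 0] by simp

lemma hom_minus: "a \<in> carrier A \<Longrightarrow> b \<in> carrier A \<Longrightarrow> \<phi> (a \<ominus>\<^bsub>A\<^esub> b) = \<phi> a \<ominus>\<^bsub>C\<^esub> \<phi> b"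
  by (simp add: dom.minus_eq cod.minus_eq dom.minus_eq_smult cod.minus_eq_smult hom_add hom_smult)

lemma hom_finsum:
  assumes "finite W" "\<And>w. w \<in> W \<Longrightarrow> x w \<in> carrier A"
  shows "\<phi> (\<Oplus>\<^bsub>A\<^esub>w\<in>W. x w) = (\<Oplus>\<^bsub>C\<^esub>w\<in>W. \<phi> (x w))"
  using assms
proof (induction W rule: finite_induct)
  case (insert w W)
  then show ?case by (simp add: hom_add Pi_iff)
qed simp

lemma kernel_ideal: "ideal {a \<in> carrier A. \<phi> a = \<zero>\<^bsub>C\<^esub>} A"
  by (rule idealI[OF dom.ring_axioms], rule dom.add.subgroupI)
    (auto simp: hom_add hom_mult hom_smult dom.minus_eq_smult simp flip: a_inv_def)

text \<open>The kernel is an ideal, so it suffices that the generators of the ideal are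
  killed.\<close>

lemma hom_Idl_zero:
  assumes "S \<subseteq> carrier A" "\<And>s. s \<in> S \<Longrightarrow> \<phi> s = \<zero>\<^bsub>C\<^esub>" "x \<in> Idl\<^bsub>A\<^esub> S"
  shows "\<phi> x = \<zero>\<^bsub>C\<^esub>"
  using dom.genideal_minimal[OF kernel_ideal, of S] assms by auto

lemma equalizer_subalg:
  assumes "alg_hom A C \<psi>"
  shows "subalg A {a \<in> carrier A. \<phi> a = \<psi> a}"
  using alg_homD[OF assms] by (intro dom.subalgI) (auto simp: hom_add hom_mult hom_smult)

lemma vimage_subalg:
  assumes "subalg C V"
  shows "subalg A {a \<in> carrier A. \<phi> a \<in> V}"
  using subalgD[OF assms] by (intro dom.subalgI) (auto simp: hom_add hom_mult hom_smult)

lemma hom_image_gen: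
  assumes "S \<subseteq> carrier A" "x \<in> subalg_gen A S"
  shows "\<phi> x \<in> subalg_gen C (\<phi> ` S)"
proof -
  have "subalg_gen A S \<subseteq> {a \<in> carrier A. \<phi> a \<in> subalg_gen C (\<phi> ` S)}"
    using assms(1) subalg_gen_incl[of "\<phi> ` S" C]
    by (intro subalg_gen_least vimage_subalg cod.subalg_gen_subalg) auto
  then show ?thesis using assms by auto
qed

end

text \<open>The set on which two homomorphisms agree is a subalgebra. Later comparisons of actions
  and conjugations are made on generators through this fact.\<close>

lemma alg_hom_eq_on_gen:
  assumes "kalg A" "kalg C" "alg_hom A C \<phi>" "alg_hom A C \<psi>"
    and "S \<subseteq> carrier A" "\<And>s. s \<in> S \<Longrightarrow> \<phi> s = \<psi> s" "x \<in> subalg_gen A S"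
  shows "\<phi> x = \<psi> x"
proof -
  interpret kalg_hom A C \<phi> using assms by (simp add: kalg_hom_def kalg_hom_axioms_def)
  show ?thesis using subalg_gen_least[OF equalizer_subalg[OF assms(4)], of S] assms by auto
qed

text \<open>\<open>\<phi> v\<close> is a left inverse and \<open>\<psi> v\<close> a right inverse of
  the common value of \<open>u\<close>, so they coincide. A homomorphism out of a localization is
  thus determined before the adjoined inverses are looked at.\<close>

lemma alg_hom_inverse_unique:
  assumes "kalg A" "kalg C" "alg_hom A C \<phi>" "alg_hom A C \<psi>"
    and "u \<in> carrier A" "v \<in> carrier A" "u \<otimes>\<^bsub>A\<^esub> v = \<one>\<^bsub>A\<^esub>" "v \<otimes>\<^bsub>A\<^esub> u = \<one>\<^bsub>A\<^esub>" "\<phi> u = \<psi> u"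
  shows "\<phi> v = \<psi> v"
proof -
  interpret C: kalg C by fact
  note f = alg_homD[OF assms(3)] note g = alg_homD[OF assms(4)]
  have "\<phi> v \<otimes>\<^bsub>C\<^esub> \<phi> u = \<one>\<^bsub>C\<^esub>" "\<phi> u \<otimes>\<^bsub>C\<^esub> \<psi> v = \<one>\<^bsub>C\<^esub>"
    using f(3)[of v u] g(3)[of u v] f(5) g(5) assms by auto
  then show ?thesis using C.inv_unique f(1) g(1) assms(5,6) by metis
qed

text \<open>Comparing \<open>\<phi>\<close> with the candidate inverse \<open>\<psi>\<close> on
  generators already yields bijectivity. The restriction is there because \<open>alg_aut\<close>
  consists of extensional maps.\<close>

lemma alg_autI:
  assumes "kalg A" "alg_hom A A \<phi>" "alg_hom A A \<psi>" "S \<subseteq> carrier A" "subalg_gen A S = carrier A"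
    and "\<And>s. s \<in> S \<Longrightarrow> \<psi> (\<phi> s) = s" "\<And>s. s \<in> S \<Longrightarrow> \<phi> (\<psi> s) = s"
  shows "restrict \<phi> (carrier A) \<in> alg_aut A"
proof -
  interpret kalg A by fact
  have "\<psi> (\<phi> x) = x" "\<phi> (\<psi> x) = x" if "x \<in> carrier A" for x
    using alg_hom_eq_on_gen[OF assms(1,1) alg_hom_comp[OF assms(2,3)] alg_hom_id assms(4), of x]
      alg_hom_eq_on_gen[OF assms(1,1) alg_hom_comp[OF assms(3,2)] alg_hom_id assms(4), of x]
      assms that by auto
  then have "bij_betw (restrict \<phi> (carrier A)) (carrier A) (carrier A)"
    using alg_homD(1)[OF assms(2)] alg_homD(1)[OF assms(3)]
    by (intro bij_betwI[where g = \<psi>]) auto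
  moreover have "alg_hom A A (restrict \<phi> (carrier A))"
    by (rule alg_hom_cong[OF assms(1) _ assms(2)]) simp
  ultimately show ?thesis
    unfolding alg_aut_def alg_hom_def by auto
qed

lemma alg_aut_alg_hom: "\<phi> \<in> alg_aut A \<Longrightarrow> alg_hom A A \<phi>"
  unfolding alg_aut_def alg_hom_def by auto

text \<open>Extensionality fixes the values outside the carrier, so agreement on generators gives
  equality of functions. This is the uniqueness half for the definite descriptions
  \<open>act_A\<close>, \<open>induced_aut\<close> and \<open>tensor_aut\<close>.\<close>

lemma alg_aut_eqI:
  assumes "kalg A" "\<phi> \<in> alg_aut A" "\<psi> \<in> alg_aut A" "S \<subseteq> carrier A" "subalg_gen A S = carrier A"
    and "\<And>s. s \<in> S \<Longrightarrow> \<phi> s = \<psi> s"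
  shows "\<phi> = \<psi>"
proof -
  have "\<phi> x = \<psi> x" if "x \<in> carrier A" for x
    using assms(1,1) alg_aut_alg_hom[OF assms(2)] alg_aut_alg_hom[OF assms(3)] assms(4,6)
    by (rule alg_hom_eq_on_gen) (use assms(5) that in simp_all)
  moreover have "\<phi> \<in> extensional (carrier A)" "\<psi> \<in> extensional (carrier A)"
    using assms(2,3) unfolding alg_aut_def by blast+
  ultimately show ?thesis by (rule extensionalityI[rotated 2])
qed

section \<open>Monoid algebras\<close>

lemma monoid_alg_sel:
  "carrier (monoid_alg M) = {f. finite {m. f m \<noteq> 0} \<and> {m. f m \<noteq> 0} \<subseteq> carrier M}"
  "\<zero>\<^bsub>monoid_alg M\<^esub> = (\<lambda>w. 0)"
  "f \<oplus>\<^bsub>monoid_alg M\<^esub> g = (\<lambda>w. f w + g w)"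
  "s \<odot>\<^bsub>monoid_alg M\<^esub> f = (\<lambda>w. s * f w)"
  "\<one>\<^bsub>monoid_alg M\<^esub> = basis_vec \<one>\<^bsub>M\<^esub>"
  by (simp_all add: monoid_alg_def basis_vec_def)

lemma monoid_alg_memI:
  assumes "finite U" "U \<subseteq> carrier M" "\<And>m. f m \<noteq> 0 \<Longrightarrow> m \<in> U"
  shows "f \<in> carrier (monoid_alg M)"
  using assms unfolding monoid_alg_sel by (auto intro: finite_subset)

lemma monoid_alg_memE:
  assumes "f \<in> carrier (monoid_alg M)"
  obtains U where "finite U" "U \<subseteq> carrier M" "{m. f m \<noteq> 0} \<subseteq> U"
  using assms unfolding monoid_alg_sel by auto

lemma basis_vec_closed: "m \<in> carrier M \<Longrightarrow> basis_vec m \<in> carrier (monoid_alg M)"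
  by (rule monoid_alg_memI[of "{m}"]) (auto simp: basis_vec_def split: if_splits)

text \<open>Enlarging the index set to a rectangle \<open>U \<times> V\<close> adds only zero terms.
  With index sets that do not depend on \<open>w\<close>, associativity and distributivity become
  interchanges of finite sums.\<close>

lemma monoid_alg_mult:
  assumes "finite U" "finite V" "{m. f m \<noteq> 0} \<subseteq> U" "{m. g m \<noteq> 0} \<subseteq> V"
  shows "(f \<otimes>\<^bsub>monoid_alg M\<^esub> g) w = (\<Sum>u\<in>U. \<Sum>v\<in>V. if u \<otimes>\<^bsub>M\<^esub> v = w then f u * g v else 0)"
proof -
  have "(f \<otimes>\<^bsub>monoid_alg M\<^esub> g) w
      = (\<Sum>(u, v) \<in> {(u, v). f u \<noteq> 0 \<and> g v \<noteq> 0 \<and> u \<otimes>\<^bsub>M\<^esub> v = w}. f u * g v)"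
    by (simp add: monoid_alg_def)
  also have "\<dots> = (\<Sum>(u, v) \<in> U \<times> V. if u \<otimes>\<^bsub>M\<^esub> v = w then f u * g v else 0)"
    using assms by (intro sum.mono_neutral_cong_left) (auto split: if_splits)
  finally show ?thesis by (simp add: sum.cartesian_product)
qed

lemma basis_vec_mult:
  "basis_vec u \<otimes>\<^bsub>monoid_alg M\<^esub> basis_vec v = basis_vec (u \<otimes>\<^bsub>M\<^esub> v)"
proof
  fix w
  show "(basis_vec u \<otimes>\<^bsub>monoid_alg M\<^esub> basis_vec v) w = (basis_vec (u \<otimes>\<^bsub>M\<^esub> v) w :: 'b::field)"
    by (subst monoid_alg_mult[of "{u}" "{v}"]) (auto simp: basis_vec_def split: if_splits)
qed

lemma monoid_alg_kalg:
  fixes M :: "('m, 'z) monoid_scheme"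
  assumes "Group.monoid M"
  shows "kalg (monoid_alg M :: ('k::field, 'm \<Rightarrow> 'k) module)"
proof -
  interpret M: Group.monoid M by fact
  let ?F = "monoid_alg M :: ('k, 'm \<Rightarrow> 'k) module"
  note sel = monoid_alg_sel[of M]
  have add: "f \<oplus>\<^bsub>?F\<^esub> g \<in> carrier ?F" if "f \<in> carrier ?F" "g \<in> carrier ?F" for f g
  proof -
    obtain U where U: "finite U" "U \<subseteq> carrier M" "{m. f m \<noteq> 0} \<subseteq> U"
      by (rule monoid_alg_memE[OF \<open>f \<in> carrier ?F\<close>]) blast
    obtain V where V: "finite V" "V \<subseteq> carrier M" "{m. g m \<noteq> 0} \<subseteq> V"
      by (rule monoid_alg_memE[OF \<open>g \<in> carrier ?F\<close>]) blast
    show ?thesis using U V unfolding sel(3) by (intro monoid_alg_memI[of "U \<union> V"]) force+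
  qed
  have smult: "s \<odot>\<^bsub>?F\<^esub> f \<in> carrier ?F" if "f \<in> carrier ?F" for s f
    using that by (auto simp: sel elim: rev_finite_subset)
  have mult: "f \<otimes>\<^bsub>?F\<^esub> g \<in> carrier ?F" if "f \<in> carrier ?F" "g \<in> carrier ?F" for f g
  proof -
    obtain U where U: "finite U" "U \<subseteq> carrier M" "{m. f m \<noteq> 0} \<subseteq> U"
      by (rule monoid_alg_memE[OF \<open>f \<in> carrier ?F\<close>]) blast
    obtain V where V: "finite V" "V \<subseteq> carrier M" "{m. g m \<noteq> 0} \<subseteq> V"
      by (rule monoid_alg_memE[OF \<open>g \<in> carrier ?F\<close>]) blast
    note UV = U V
    show ?thesis
    proof (rule monoid_alg_memI[of "(\<lambda>(u, v). u \<otimes>\<^bsub>M\<^esub> v) ` (U \<times> V)"])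
      fix m assume "(f \<otimes>\<^bsub>?F\<^esub> g) m \<noteq> 0"
      then have "(\<Sum>u\<in>U. \<Sum>v\<in>V. if u \<otimes>\<^bsub>M\<^esub> v = m then f u * g v else 0) \<noteq> 0"
        unfolding monoid_alg_mult[where M = M, OF UV(1,4,3,6)] .
      then obtain u v where "u \<in> U" "v \<in> V" "u \<otimes>\<^bsub>M\<^esub> v = m"
        by (auto elim!: sum.not_neutral_contains_not_neutral split: if_splits)
      then show "m \<in> (\<lambda>(u, v). u \<otimes>\<^bsub>M\<^esub> v) ` (U \<times> V)" by force
    qed (use UV in auto)
  qed
  have assoc: "(f \<otimes>\<^bsub>?F\<^esub> g) \<otimes>\<^bsub>?F\<^esub> h = f \<otimes>\<^bsub>?F\<^esub> (g \<otimes>\<^bsub>?F\<^esub> h)"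
    if "f \<in> carrier ?F" "g \<in> carrier ?F" "h \<in> carrier ?F" for f g h
  proof
    fix w
    obtain U where U: "finite U" "U \<subseteq> carrier M" "{m. f m \<noteq> 0} \<subseteq> U"
      by (rule monoid_alg_memE[OF \<open>f \<in> carrier ?F\<close>]) blast
    obtain V where V: "finite V" "V \<subseteq> carrier M" "{m. g m \<noteq> 0} \<subseteq> V"
      by (rule monoid_alg_memE[OF \<open>g \<in> carrier ?F\<close>]) blast
    obtain W where W: "finite W" "W \<subseteq> carrier M" "{m. h m \<noteq> 0} \<subseteq> W"
      by (rule monoid_alg_memE[OF \<open>h \<in> carrier ?F\<close>]) blast
    note UV = U V
    obtain P where P0: "finite P" "{m. (f \<otimes>\<^bsub>?F\<^esub> g) m \<noteq> 0} \<subseteq> P"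
      by (rule monoid_alg_memE[OF mult[OF \<open>f \<in> carrier ?F\<close> \<open>g \<in> carrier ?F\<close>]]) blast
    obtain Q where Q0: "finite Q" "{m. (g \<otimes>\<^bsub>?F\<^esub> h) m \<noteq> 0} \<subseteq> Q"
      by (rule monoid_alg_memE[OF mult[OF \<open>g \<in> carrier ?F\<close> \<open>h \<in> carrier ?F\<close>]]) blast
    \<comment> \<open>The support of the product is enlarged by all \<open>u \<otimes> v\<close>:
      then each pair \<open>(u, v)\<close> meets exactly one \<open>p\<close> in \<open>P'\<close>,
      and the sum over \<open>p\<close> collapses. The set \<open>Q'\<close> plays the same part for
      the other bracketing.\<close>
    define P' where "P' = P \<union> (\<lambda>(u, v). u \<otimes>\<^bsub>M\<^esub> v) ` (U \<times> V)"
    define Q' where "Q' = Q \<union> (\<lambda>(u, v). u \<otimes>\<^bsub>M\<^esub> v) ` (V \<times> W)"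
    have P: "finite P'" "{m. (f \<otimes>\<^bsub>?F\<^esub> g) m \<noteq> 0} \<subseteq> P'"
      "\<And>u v. u \<in> U \<Longrightarrow> v \<in> V \<Longrightarrow> u \<otimes>\<^bsub>M\<^esub> v \<in> P'"
      using P0 UV by (auto simp: P'_def)
    have Q: "finite Q'" "{m. (g \<otimes>\<^bsub>?F\<^esub> h) m \<noteq> 0} \<subseteq> Q'"
      "\<And>u v. u \<in> V \<Longrightarrow> v \<in> W \<Longrightarrow> u \<otimes>\<^bsub>M\<^esub> v \<in> Q'"
      using Q0 UV W by (auto simp: Q'_def)
    have 1: "((f \<otimes>\<^bsub>?F\<^esub> g) \<otimes>\<^bsub>?F\<^esub> h) w
      = (\<Sum>u\<in>U. \<Sum>v\<in>V. \<Sum>x\<in>W. if (u \<otimes>\<^bsub>M\<^esub> v) \<otimes>\<^bsub>M\<^esub> x = w then f u * g v * h x else 0)"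
    proof -
      have "((f \<otimes>\<^bsub>?F\<^esub> g) \<otimes>\<^bsub>?F\<^esub> h) w = (\<Sum>p\<in>P'. \<Sum>x\<in>W. if p \<otimes>\<^bsub>M\<^esub> x = w then
          (\<Sum>u\<in>U. \<Sum>v\<in>V. if u \<otimes>\<^bsub>M\<^esub> v = p then f u * g v else 0) * h x else 0)"
        by (subst monoid_alg_mult[where M = M, OF P(1) W(1) P(2) W(3)])
          (simp add: monoid_alg_mult[where M = M, OF UV(1,4,3,6)] cong: if_cong)
      also have "\<dots> = (\<Sum>p\<in>P'. \<Sum>x\<in>W. \<Sum>u\<in>U. \<Sum>v\<in>V. if u \<otimes>\<^bsub>M\<^esub> v = p then
          (if (u \<otimes>\<^bsub>M\<^esub> v) \<otimes>\<^bsub>M\<^esub> x = w then f u * g v * h x else 0) else 0)"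
        by (intro sum.cong refl) (auto simp: sum_distrib_right intro!: sum.cong sum.neutral sum.neutral[symmetric])
      also have "\<dots> = (\<Sum>u\<in>U. \<Sum>v\<in>V. \<Sum>x\<in>W. \<Sum>p\<in>P'. if u \<otimes>\<^bsub>M\<^esub> v = p then
          (if (u \<otimes>\<^bsub>M\<^esub> v) \<otimes>\<^bsub>M\<^esub> x = w then f u * g v * h x else 0) else 0)"
        by (simp only: sum.swap[of _ P' U] sum.swap[of _ W U] sum.swap[of _ P' V] sum.swap[of _ W V] sum.swap[of _ P' W])
      also have "\<dots> = (\<Sum>u\<in>U. \<Sum>v\<in>V. \<Sum>x\<in>W. if (u \<otimes>\<^bsub>M\<^esub> v) \<otimes>\<^bsub>M\<^esub> x = w then f u * g v * h x else 0)"
        using P by (intro sum.cong refl) (simp add: sum.delta')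
      finally show ?thesis .
    qed
    have 2: "(f \<otimes>\<^bsub>?F\<^esub> (g \<otimes>\<^bsub>?F\<^esub> h)) w
      = (\<Sum>u\<in>U. \<Sum>v\<in>V. \<Sum>x\<in>W. if u \<otimes>\<^bsub>M\<^esub> (v \<otimes>\<^bsub>M\<^esub> x) = w then f u * g v * h x else 0)"
    proof -
      have "(f \<otimes>\<^bsub>?F\<^esub> (g \<otimes>\<^bsub>?F\<^esub> h)) w = (\<Sum>u\<in>U. \<Sum>p\<in>Q'. if u \<otimes>\<^bsub>M\<^esub> p = w then
          f u * (\<Sum>v\<in>V. \<Sum>x\<in>W. if v \<otimes>\<^bsub>M\<^esub> x = p then g v * h x else 0) else 0)"
        by (subst monoid_alg_mult[where M = M, OF UV(1) Q(1) UV(3) Q(2)])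
          (simp add: monoid_alg_mult[where M = M, OF UV(4) W(1) UV(6) W(3)] cong: if_cong)
      also have "\<dots> = (\<Sum>u\<in>U. \<Sum>p\<in>Q'. \<Sum>v\<in>V. \<Sum>x\<in>W. if v \<otimes>\<^bsub>M\<^esub> x = p then
          (if u \<otimes>\<^bsub>M\<^esub> (v \<otimes>\<^bsub>M\<^esub> x) = w then f u * g v * h x else 0) else 0)"
        by (intro sum.cong refl) (auto simp: sum_distrib_left mult.assoc intro!: sum.cong sum.neutral sum.neutral[symmetric])
      also have "\<dots> = (\<Sum>u\<in>U. \<Sum>v\<in>V. \<Sum>x\<in>W. \<Sum>p\<in>Q'. if v \<otimes>\<^bsub>M\<^esub> x = p then
          (if u \<otimes>\<^bsub>M\<^esub> (v \<otimes>\<^bsub>M\<^esub> x) = w then f u * g v * h x else 0) else 0)"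
        by (simp only: sum.swap[of _ Q' V] sum.swap[of _ Q' W])
      also have "\<dots> = (\<Sum>u\<in>U. \<Sum>v\<in>V. \<Sum>x\<in>W. if u \<otimes>\<^bsub>M\<^esub> (v \<otimes>\<^bsub>M\<^esub> x) = w then f u * g v * h x else 0)"
        using Q by (intro sum.cong refl) (simp add: sum.delta')
      finally show ?thesis .
    qed
    have "(u \<otimes>\<^bsub>M\<^esub> v) \<otimes>\<^bsub>M\<^esub> x = u \<otimes>\<^bsub>M\<^esub> (v \<otimes>\<^bsub>M\<^esub> x)" if "u \<in> U" "v \<in> V" "x \<in> W" for u v x
      using UV(2,5) W(2) that by (intro M.m_assoc) auto
    then show "((f \<otimes>\<^bsub>?F\<^esub> g) \<otimes>\<^bsub>?F\<^esub> h) w = (f \<otimes>\<^bsub>?F\<^esub> (g \<otimes>\<^bsub>?F\<^esub> h)) w"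
      unfolding 1 2 by (intro sum.cong refl) simp
  qed
  have one: "\<one>\<^bsub>?F\<^esub> \<otimes>\<^bsub>?F\<^esub> f = f" "f \<otimes>\<^bsub>?F\<^esub> \<one>\<^bsub>?F\<^esub> = f" if "f \<in> carrier ?F" for f
  proof -
    obtain U where U: "finite U" "U \<subseteq> carrier M" "{m. f m \<noteq> 0} \<subseteq> U"
      by (rule monoid_alg_memE[OF \<open>f \<in> carrier ?F\<close>]) blast
    have e: "{m. (basis_vec \<one>\<^bsub>M\<^esub> m :: 'k) \<noteq> 0} \<subseteq> {\<one>\<^bsub>M\<^esub>}"
      by (auto simp: basis_vec_def split: if_splits)
    have "(\<one>\<^bsub>?F\<^esub> \<otimes>\<^bsub>?F\<^esub> f) w = f w" "(f \<otimes>\<^bsub>?F\<^esub> \<one>\<^bsub>?F\<^esub>) w = f w" for w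
    proof -
      have *: "(\<Sum>v\<in>U. if v = w then f v else 0) = f w"
        using U by (auto simp: sum.delta)
      have "(\<one>\<^bsub>?F\<^esub> \<otimes>\<^bsub>?F\<^esub> f) w = (\<Sum>v\<in>U. if \<one>\<^bsub>M\<^esub> \<otimes>\<^bsub>M\<^esub> v = w then f v else 0)"
        unfolding sel by (subst monoid_alg_mult[where M = M, OF _ U(1) e U(3)]) (auto simp: basis_vec_def intro!: sum.cong)
      also have "\<dots> = (\<Sum>v\<in>U. if v = w then f v else 0)"
        using U(2) by (intro sum.cong refl) auto
      finally show "(\<one>\<^bsub>?F\<^esub> \<otimes>\<^bsub>?F\<^esub> f) w = f w" using * by simp
      have "(f \<otimes>\<^bsub>?F\<^esub> \<one>\<^bsub>?F\<^esub>) w = (\<Sum>v\<in>U. if v \<otimes>\<^bsub>M\<^esub> \<one>\<^bsub>M\<^esub> = w then f v else 0)"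
        unfolding sel by (subst monoid_alg_mult[where M = M, OF U(1) _ U(3) e]) (auto simp: basis_vec_def intro!: sum.cong)
      also have "\<dots> = (\<Sum>v\<in>U. if v = w then f v else 0)"
        using U(2) by (intro sum.cong refl) auto
      finally show "(f \<otimes>\<^bsub>?F\<^esub> \<one>\<^bsub>?F\<^esub>) w = f w" using * by simp
    qed
    then show "\<one>\<^bsub>?F\<^esub> \<otimes>\<^bsub>?F\<^esub> f = f" "f \<otimes>\<^bsub>?F\<^esub> \<one>\<^bsub>?F\<^esub> = f" by auto
  qed
  have distr: "(f \<oplus>\<^bsub>?F\<^esub> g) \<otimes>\<^bsub>?F\<^esub> h = f \<otimes>\<^bsub>?F\<^esub> h \<oplus>\<^bsub>?F\<^esub> g \<otimes>\<^bsub>?F\<^esub> h"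
      "h \<otimes>\<^bsub>?F\<^esub> (f \<oplus>\<^bsub>?F\<^esub> g) = h \<otimes>\<^bsub>?F\<^esub> f \<oplus>\<^bsub>?F\<^esub> h \<otimes>\<^bsub>?F\<^esub> g"
      "(s \<odot>\<^bsub>?F\<^esub> f) \<otimes>\<^bsub>?F\<^esub> h = s \<odot>\<^bsub>?F\<^esub> (f \<otimes>\<^bsub>?F\<^esub> h)"
      "h \<otimes>\<^bsub>?F\<^esub> (s \<odot>\<^bsub>?F\<^esub> f) = s \<odot>\<^bsub>?F\<^esub> (h \<otimes>\<^bsub>?F\<^esub> f)"
    if "f \<in> carrier ?F" "g \<in> carrier ?F" "h \<in> carrier ?F" for f g h s
  proof -
    obtain U where U: "finite U" "U \<subseteq> carrier M" "{m. f m \<noteq> 0} \<subseteq> U"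
      by (rule monoid_alg_memE[OF \<open>f \<in> carrier ?F\<close>]) blast
    obtain V where V: "finite V" "V \<subseteq> carrier M" "{m. g m \<noteq> 0} \<subseteq> V"
      by (rule monoid_alg_memE[OF \<open>g \<in> carrier ?F\<close>]) blast
    obtain W0 where W0: "finite W0" "W0 \<subseteq> carrier M" "{m. h m \<noteq> 0} \<subseteq> W0"
      by (rule monoid_alg_memE[OF \<open>h \<in> carrier ?F\<close>]) blast
    note UV = U(1,3) V(1,3) note W = W0(1,3)
    \<comment> \<open>One finite set carries both supports, so that \<open>f\<close>,
      \<open>g\<close>, their sum and the scalar multiple are all expanded over the same
      indices.\<close>
    define X where "X = U \<union> V"
    have X: "finite X" "{m. f m \<noteq> 0} \<subseteq> X" "{m. g m \<noteq> 0} \<subseteq> X"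
        "{m. (f \<oplus>\<^bsub>?F\<^esub> g) m \<noteq> 0} \<subseteq> X" "{m. (s \<odot>\<^bsub>?F\<^esub> f) m \<noteq> 0} \<subseteq> X"
    proof -
      have "f m = 0" "g m = 0" if "m \<notin> X" for m using U(3) V(3) that by (auto simp: X_def)
      then have "{m. (f \<oplus>\<^bsub>?F\<^esub> g) m \<noteq> 0} \<subseteq> X" by (auto simp: sel) (metis add.right_neutral)
      then show "finite X" "{m. f m \<noteq> 0} \<subseteq> X" "{m. g m \<noteq> 0} \<subseteq> X"
        "{m. (f \<oplus>\<^bsub>?F\<^esub> g) m \<noteq> 0} \<subseteq> X" "{m. (s \<odot>\<^bsub>?F\<^esub> f) m \<noteq> 0} \<subseteq> X"
        using UV by (auto simp: X_def sel(4))
    qed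
    note m = monoid_alg_mult[where M = M, OF X(1) W(1) X(2) W(2)]
      monoid_alg_mult[where M = M, OF X(1) W(1) X(3) W(2)]
      monoid_alg_mult[where M = M, OF X(1) W(1) X(4) W(2)]
      monoid_alg_mult[where M = M, OF X(1) W(1) X(5) W(2)]
      monoid_alg_mult[where M = M, OF W(1) X(1) W(2) X(2)]
      monoid_alg_mult[where M = M, OF W(1) X(1) W(2) X(3)]
      monoid_alg_mult[where M = M, OF W(1) X(1) W(2) X(4)]
      monoid_alg_mult[where M = M, OF W(1) X(1) W(2) X(5)]
    show "(f \<oplus>\<^bsub>?F\<^esub> g) \<otimes>\<^bsub>?F\<^esub> h = f \<otimes>\<^bsub>?F\<^esub> h \<oplus>\<^bsub>?F\<^esub> g \<otimes>\<^bsub>?F\<^esub> h"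
      unfolding sel(3)[of "f \<otimes>\<^bsub>?F\<^esub> h"] fun_eq_iff m
      by (auto simp: sel sum.distrib[symmetric] algebra_simps intro!: sum.cong)
    show "h \<otimes>\<^bsub>?F\<^esub> (f \<oplus>\<^bsub>?F\<^esub> g) = h \<otimes>\<^bsub>?F\<^esub> f \<oplus>\<^bsub>?F\<^esub> h \<otimes>\<^bsub>?F\<^esub> g"
      unfolding sel(3)[of "h \<otimes>\<^bsub>?F\<^esub> f"] fun_eq_iff m
      by (auto simp: sel sum.distrib[symmetric] algebra_simps intro!: sum.cong)
    show "(s \<odot>\<^bsub>?F\<^esub> f) \<otimes>\<^bsub>?F\<^esub> h = s \<odot>\<^bsub>?F\<^esub> (f \<otimes>\<^bsub>?F\<^esub> h)"
      unfolding sel(4)[of _ "f \<otimes>\<^bsub>?F\<^esub> h"] fun_eq_iff m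
      by (auto simp: sel sum_distrib_left algebra_simps intro!: sum.cong)
    show "h \<otimes>\<^bsub>?F\<^esub> (s \<odot>\<^bsub>?F\<^esub> f) = s \<odot>\<^bsub>?F\<^esub> (h \<otimes>\<^bsub>?F\<^esub> f)"
      unfolding sel(4)[of _ "h \<otimes>\<^bsub>?F\<^esub> f"] fun_eq_iff m
      by (auto simp: sel sum_distrib_left algebra_simps intro!: sum.cong)
  qed
  have "ring ?F"
  proof (rule ringI)
    show "abelian_group ?F"
    proof (rule abelian_groupI)
      show "\<exists>g\<in>carrier ?F. g \<oplus>\<^bsub>?F\<^esub> f = \<zero>\<^bsub>?F\<^esub>" if "f \<in> carrier ?F" for f
        using smult[OF that, of "-1"] by (intro bexI[of _ "(-1) \<odot>\<^bsub>?F\<^esub> f"]) (simp_all add: sel)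
    qed (use add in \<open>simp_all add: sel algebra_simps\<close>)
    show "Group.monoid ?F"
      using mult assoc one basis_vec_closed[OF M.one_closed] by unfold_locales (simp_all only: sel(5))
  qed (use distr in auto)
  then show ?thesis
    using smult distr by (intro kalg.intro kalg_axioms.intro) (simp_all add: sel(3,4) algebra_simps)
qed

text \<open>Basis vectors are split off one at a time, by induction on a finite set containing the
  support.\<close>

lemma monoid_alg_induct [consumes 2, case_names zero add]:
  fixes M :: "('m, 'z) monoid_scheme" and f :: "'m \<Rightarrow> 'k::field"
  assumes "Group.monoid M" "f \<in> carrier (monoid_alg M)"
    and "P (\<zero>\<^bsub>(monoid_alg M :: ('k, 'm \<Rightarrow> 'k) module)\<^esub>)"
    and step: "\<And>s m f. m \<in> carrier M \<Longrightarrow> f \<in> carrier (monoid_alg M) \<Longrightarrow> P f \<Longrightarrow>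
      P (s \<odot>\<^bsub>(monoid_alg M :: ('k, 'm \<Rightarrow> 'k) module)\<^esub> basis_vec m \<oplus>\<^bsub>(monoid_alg M :: ('k, 'm \<Rightarrow> 'k) module)\<^esub> f)"
  shows "P f"
proof -
  have "P f" if "finite U" "U \<subseteq> carrier M" "{m. f m \<noteq> 0} \<subseteq> U" for U f
    using that
  proof (induction U arbitrary: f rule: finite_induct)
    case empty
    then have "f = (\<lambda>w. 0)" by auto
    then show ?case using assms(3) by (simp add: monoid_alg_sel)
  next
    case (insert u U)
    have "P (f(u := 0))" using insert.prems by (intro insert.IH) auto
    moreover have "f(u := 0) \<in> carrier (monoid_alg M)"
      using insert by (intro monoid_alg_memI[of U]) (auto split: if_splits)
    ultimately have "P (f u \<odot>\<^bsub>(monoid_alg M :: ('k, 'm \<Rightarrow> 'k) module)\<^esub> basis_vec u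
        \<oplus>\<^bsub>(monoid_alg M :: ('k, 'm \<Rightarrow> 'k) module)\<^esub> f(u := 0))"
      using insert.prems by (intro step) auto
    also have "f u \<odot>\<^bsub>(monoid_alg M :: ('k, 'm \<Rightarrow> 'k) module)\<^esub> basis_vec u
        \<oplus>\<^bsub>(monoid_alg M :: ('k, 'm \<Rightarrow> 'k) module)\<^esub> f(u := 0) = f"
      by (auto simp: monoid_alg_sel basis_vec_def)
    finally show ?case .
  qed
  then show ?thesis by (rule monoid_alg_memE[OF assms(2)]) blast
qed

section \<open>Linear extension of monoid representations\<close>

definition monoid_lift :: "('k::field, 'a) module \<Rightarrow> ('m \<Rightarrow> 'a) \<Rightarrow> ('m \<Rightarrow> 'k) \<Rightarrow> 'a" where
  "monoid_lift C \<theta> f = (\<Oplus>\<^bsub>C\<^esub>m\<in>{m. f m \<noteq> 0}. f m \<odot>\<^bsub>C\<^esub> \<theta> m)"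

text \<open>\<open>\<theta>\<close> is a homomorphism into the multiplicative monoid of
  \<open>C\<close>; extending it linearly is the universal property of the monoid algebra. It is
  applied to words for free algebras and to pairs \<open>(a, b)\<close> for tensor products.\<close>

locale monoid_repr = C: kalg C + M: Group.monoid M
  for M :: "('m, 'z) monoid_scheme" and C :: "('k::field, 'a) module" and \<theta> :: "'m \<Rightarrow> 'a" +
  assumes \<theta>_closed [simp]: "m \<in> carrier M \<Longrightarrow> \<theta> m \<in> carrier C"
    and \<theta>_mult: "m \<in> carrier M \<Longrightarrow> m' \<in> carrier M \<Longrightarrow> \<theta> (m \<otimes>\<^bsub>M\<^esub> m') = \<theta> m \<otimes>\<^bsub>C\<^esub> \<theta> m'"
    and \<theta>_one: "\<theta> \<one>\<^bsub>M\<^esub> = \<one>\<^bsub>C\<^esub>"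
begin

text \<open>The index set in \<open>monoid_lift\<close> is the support and varies with
  \<open>f\<close>; a common finite superset lets several elements be summed together.\<close>

lemma lift_eq:
  assumes "finite U" "U \<subseteq> carrier M" "{m. f m \<noteq> 0} \<subseteq> U"
  shows "monoid_lift C \<theta> f = (\<Oplus>\<^bsub>C\<^esub>m\<in>U. f m \<odot>\<^bsub>C\<^esub> \<theta> m)"
  unfolding monoid_lift_def
  using assms by (intro C.add.finprod_mono_neutral_cong_left) (auto simp: subset_iff Pi_iff)

lemma lift_basis_vec:
  assumes "m \<in> carrier M" shows "monoid_lift C \<theta> (basis_vec m) = \<theta> m"
  using assms by (subst lift_eq[of "{m}"]) (auto simp: basis_vec_def split: if_splits)

lemma lift_closed:
  assumes "f \<in> carrier (monoid_alg M)" shows "monoid_lift C \<theta> f \<in> carrier C"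
proof -
  obtain U where U: "finite U" "U \<subseteq> carrier M" "{m. f m \<noteq> 0} \<subseteq> U"
      by (rule monoid_alg_memE[OF assms]) blast
  then show ?thesis by (subst lift_eq[OF U]) (auto intro!: C.finsum_closed)
qed

lemma lift_add:
  assumes "f \<in> carrier (monoid_alg M)" "g \<in> carrier (monoid_alg M)"
  shows "monoid_lift C \<theta> (f \<oplus>\<^bsub>monoid_alg M\<^esub> g) = monoid_lift C \<theta> f \<oplus>\<^bsub>C\<^esub> monoid_lift C \<theta> g"
proof -
  obtain U where U: "finite U" "U \<subseteq> carrier M" "{m. f m \<noteq> 0} \<subseteq> U"
      by (rule monoid_alg_memE[OF assms(1)]) blast
  obtain V where V: "finite V" "V \<subseteq> carrier M" "{m. g m \<noteq> 0} \<subseteq> V"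
      by (rule monoid_alg_memE[OF assms(2)]) blast
  note UV = U V
  have c: "m \<in> carrier M" if "m \<in> U \<union> V" for m using that UV by auto
  have "monoid_lift C \<theta> (f \<oplus>\<^bsub>monoid_alg M\<^esub> g)
      = (\<Oplus>\<^bsub>C\<^esub>m\<in>U \<union> V. f m \<odot>\<^bsub>C\<^esub> \<theta> m \<oplus>\<^bsub>C\<^esub> g m \<odot>\<^bsub>C\<^esub> \<theta> m)"
  proof -
    have "(f \<oplus>\<^bsub>monoid_alg M\<^esub> g) m = 0" if "m \<notin> U \<union> V" for m
    proof -
      have "f m = 0" "g m = 0" using U(3) V(3) that by blast+
      then show ?thesis by (simp add: monoid_alg_sel)
    qed
    then have "{m. (f \<oplus>\<^bsub>monoid_alg M\<^esub> g) m \<noteq> 0} \<subseteq> U \<union> V" by blast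
    then have "monoid_lift C \<theta> (f \<oplus>\<^bsub>monoid_alg M\<^esub> g)
        = (\<Oplus>\<^bsub>C\<^esub>m\<in>U \<union> V. (f \<oplus>\<^bsub>monoid_alg M\<^esub> g) m \<odot>\<^bsub>C\<^esub> \<theta> m)"
      using UV by (intro lift_eq) simp_all
    also have "\<dots> = (\<Oplus>\<^bsub>C\<^esub>m\<in>U \<union> V. f m \<odot>\<^bsub>C\<^esub> \<theta> m \<oplus>\<^bsub>C\<^esub> g m \<odot>\<^bsub>C\<^esub> \<theta> m)"
      using c by (intro C.finsum_cong') (simp_all add: monoid_alg_sel C.smult_add_left)
    finally show ?thesis .
  qed
  also have "\<dots> = (\<Oplus>\<^bsub>C\<^esub>m\<in>U \<union> V. f m \<odot>\<^bsub>C\<^esub> \<theta> m) \<oplus>\<^bsub>C\<^esub> (\<Oplus>\<^bsub>C\<^esub>m\<in>U \<union> V. g m \<odot>\<^bsub>C\<^esub> \<theta> m)"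
    using c by (intro C.finsum_addf) auto
  also have "(\<Oplus>\<^bsub>C\<^esub>m\<in>U \<union> V. f m \<odot>\<^bsub>C\<^esub> \<theta> m) = monoid_lift C \<theta> f"
    using UV by (intro lift_eq[symmetric]) auto
  also have "(\<Oplus>\<^bsub>C\<^esub>m\<in>U \<union> V. g m \<odot>\<^bsub>C\<^esub> \<theta> m) = monoid_lift C \<theta> g"
    using UV by (intro lift_eq[symmetric]) auto
  finally show ?thesis .
qed

lemma lift_smult:
  assumes "f \<in> carrier (monoid_alg M)"
  shows "monoid_lift C \<theta> (s \<odot>\<^bsub>monoid_alg M\<^esub> f) = s \<odot>\<^bsub>C\<^esub> monoid_lift C \<theta> f"
proof -
  obtain U where U: "finite U" "U \<subseteq> carrier M" "{m. f m \<noteq> 0} \<subseteq> U"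
      by (rule monoid_alg_memE[OF assms]) blast
  have c: "m \<in> carrier M" if "m \<in> U" for m using that U by auto
  have "monoid_lift C \<theta> (s \<odot>\<^bsub>monoid_alg M\<^esub> f) = (\<Oplus>\<^bsub>C\<^esub>m\<in>U. s \<odot>\<^bsub>C\<^esub> (f m \<odot>\<^bsub>C\<^esub> \<theta> m))"
    using U c
    by (subst lift_eq[OF U(1,2)]) (auto simp: monoid_alg_sel C.smult_smult intro!: C.finsum_cong')
  then show ?thesis
    using c U(1) by (simp add: C.smult_finsum lift_eq[OF U])
qed

text \<open>Both sides are linear in each argument. An induction on \<open>g\<close> with a basis
  vector on the left, followed by one on \<open>f\<close>, reduces the claim to
  \<open>\<theta>_mult\<close>.\<close>

lemma lift_mult:
  assumes "f \<in> carrier (monoid_alg M)" "g \<in> carrier (monoid_alg M)"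
  shows "monoid_lift C \<theta> (f \<otimes>\<^bsub>monoid_alg M\<^esub> g) = monoid_lift C \<theta> f \<otimes>\<^bsub>C\<^esub> monoid_lift C \<theta> g"
proof -
  interpret F: kalg "monoid_alg M :: ('k, 'm \<Rightarrow> 'k) module"
    by (rule monoid_alg_kalg[OF M.monoid_axioms])
  have b: "basis_vec m \<in> carrier (monoid_alg M :: ('k, 'm \<Rightarrow> 'k) module)" if "m \<in> carrier M" for m
    using that by (rule basis_vec_closed)
  note lc = lift_closed
  have lift_zero: "monoid_lift C \<theta> \<zero>\<^bsub>(monoid_alg M :: ('k, 'm \<Rightarrow> 'k) module)\<^esub> = \<zero>\<^bsub>C\<^esub>"
    unfolding monoid_lift_def monoid_alg_sel(2) by simp
  have *: "monoid_lift C \<theta> (basis_vec m \<otimes>\<^bsub>monoid_alg M\<^esub> g) = \<theta> m \<otimes>\<^bsub>C\<^esub> monoid_lift C \<theta> g"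
    if m: "m \<in> carrier M" for m
    using M.monoid_axioms assms(2)
  proof (induction g rule: monoid_alg_induct)
    case zero
    then show ?case using m by (simp add: lift_zero b)
  next
    case (add s m' g)
    then show ?case using m b
      by (simp add: F.r_distr F.smult_mult_right basis_vec_mult b lift_add lift_smult lift_basis_vec
        \<theta>_mult lc C.r_distr C.smult_mult_right)
  qed
  show ?thesis using M.monoid_axioms assms(1)
  proof (induction f rule: monoid_alg_induct)
    case zero
    then show ?case using assms(2)
      by (simp add: lift_zero lc)
  next
    case (add s m f)
    note bm = b[OF add(1)]
    have "(s \<odot>\<^bsub>monoid_alg M\<^esub> basis_vec m \<oplus>\<^bsub>monoid_alg M\<^esub> f) \<otimes>\<^bsub>monoid_alg M\<^esub> g
      = s \<odot>\<^bsub>monoid_alg M\<^esub> (basis_vec m \<otimes>\<^bsub>monoid_alg M\<^esub> g) \<oplus>\<^bsub>monoid_alg M\<^esub> f \<otimes>\<^bsub>monoid_alg M\<^esub> g"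
      using add(2) bm assms(2) by (simp only: F.l_distr F.smult_mult_left F.smult_closed)
    moreover have "monoid_lift C \<theta> (s \<odot>\<^bsub>monoid_alg M\<^esub> (basis_vec m \<otimes>\<^bsub>monoid_alg M\<^esub> g)
        \<oplus>\<^bsub>monoid_alg M\<^esub> f \<otimes>\<^bsub>monoid_alg M\<^esub> g)
      = s \<odot>\<^bsub>C\<^esub> (\<theta> m \<otimes>\<^bsub>C\<^esub> monoid_lift C \<theta> g) \<oplus>\<^bsub>C\<^esub> monoid_lift C \<theta> f \<otimes>\<^bsub>C\<^esub> monoid_lift C \<theta> g"
      using add bm assms(2) *[OF add(1)] by (simp add: lift_add lift_smult)
    moreover have "monoid_lift C \<theta> (s \<odot>\<^bsub>monoid_alg M\<^esub> basis_vec m \<oplus>\<^bsub>monoid_alg M\<^esub> f)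
      = s \<odot>\<^bsub>C\<^esub> \<theta> m \<oplus>\<^bsub>C\<^esub> monoid_lift C \<theta> f"
      using add bm by (simp add: lift_add lift_smult lift_basis_vec)
    ultimately show ?case using add(1,2) assms(2)
      by (simp add: lc C.l_distr C.smult_mult_left)
  qed
qed

lemma lift_hom: "alg_hom (monoid_alg M) C (monoid_lift C \<theta>)"
  by (rule alg_homI)
    (simp_all add: lift_closed lift_add lift_mult lift_smult monoid_alg_sel(5) lift_basis_vec \<theta>_one)

end

lemma monoid_alg_gen:
  fixes M :: "('m, 'z) monoid_scheme"
  assumes "Group.monoid M" "f \<in> carrier (monoid_alg M)"
  shows "f \<in> subalg_gen (monoid_alg M :: ('k::field, 'm \<Rightarrow> 'k) module) (basis_vec ` carrier M)"
proof -
  let ?F = "monoid_alg M :: ('k::field, 'm \<Rightarrow> 'k) module"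
  interpret F: kalg ?F by (rule monoid_alg_kalg[OF assms(1)])
  have "basis_vec ` carrier M \<subseteq> carrier ?F" by (auto intro: basis_vec_closed)
  note sub = subalgD[OF F.subalg_gen_subalg[OF this]]
  have "basis_vec m \<in> subalg_gen ?F (basis_vec ` carrier M)" if "m \<in> carrier M" for m
    using that by (intro subsetD[OF subalg_gen_incl] imageI)
  with assms show ?thesis
    by (induction f rule: monoid_alg_induct) (simp_all add: sub)
qed

section \<open>Quotient algebras\<close>

locale kalg_ideal = kalg A + ideal I A for A :: "('k::field, 'a) module" (structure) and I
begin

abbreviation Q where "Q \<equiv> quot_alg A I"

lemma quot_carrier: "carrier Q = (+>) I ` carrier A"
  by (auto simp: quot_alg_def FactRing_simps)

lemma quot_closed: "a \<in> carrier A \<Longrightarrow> I +> a \<in> carrier Q"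
  by (simp add: quot_carrier)

lemma quot_mult: "a \<in> carrier A \<Longrightarrow> b \<in> carrier A \<Longrightarrow> (I +> a) \<otimes>\<^bsub>Q\<^esub> (I +> b) = I +> a \<otimes> b"
  by (simp add: quot_alg_def FactRing_def rcoset_mult_add)

lemma quot_add: "a \<in> carrier A \<Longrightarrow> b \<in> carrier A \<Longrightarrow> (I +> a) \<oplus>\<^bsub>Q\<^esub> (I +> b) = I +> a \<oplus> b"
  by (simp add: quot_alg_def FactRing_def a_rcos_sum)

lemma quot_one: "\<one>\<^bsub>Q\<^esub> = I +> \<one>"
  by (simp add: quot_alg_def FactRing_def)

lemma quot_zero: "\<zero>\<^bsub>Q\<^esub> = I +> \<zero>"
  by (simp add: quot_alg_def FactRing_def a_subset)

lemma quot_eq_iff: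
  assumes "a \<in> carrier A" "b \<in> carrier A"
  shows "I +> a = I +> b \<longleftrightarrow> a \<ominus> b \<in> I"
  using assms quotient_eq_iff_same_a_r_cos[OF is_ideal] by metis

text \<open>\<open>quot_alg\<close> scales a coset through all of its representatives. They lead to
  the same coset because an ideal is closed under scalars, and the union is over a nonempty
  set.\<close>

lemma quot_smult:
  assumes "a \<in> carrier A" shows "s \<odot>\<^bsub>Q\<^esub> (I +> a) = I +> s \<odot> a"
proof -
  have "I +> s \<odot> u = I +> s \<odot> a" if "u \<in> I +> a" for u
  proof -
    have u: "u \<in> carrier A" using that assms a_subset a_r_coset_subset_G by blast
    have "I +> u = I +> a" using that assms a_repr_independence a_subgroup by metis
    then have "s \<odot> (u \<ominus> a) \<in> I"
      using u assms quot_eq_iff ideal_smult_closed[OF is_ideal] by simp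
    then show ?thesis using u assms by (simp add: quot_eq_iff smult_minus)
  qed
  then have "(\<Union>u\<in>I +> a. I +> s \<odot> u) = (\<Union>u\<in>I +> a. I +> s \<odot> a)"
    by (rule SUP_cong[OF refl])
  moreover have "I +> a \<noteq> {}" using a_rcos_self[OF assms] by blast
  ultimately show ?thesis by (simp add: quot_alg_def)
qed

lemmas quot_ops = quot_mult quot_add quot_one quot_zero quot_smult

lemma quot_kalg: "kalg Q"
proof -
  have e: "\<exists>a\<in>carrier A. U = I +> a" if "U \<in> carrier Q" for U
    using that by (auto simp: quot_carrier)
  have "ring Q"
  proof (rule ringI)
    show "abelian_group Q"
    proof (rule abelian_groupI)
      fix U assume "U \<in> carrier Q"
      then obtain a where a: "a \<in> carrier A" "U = I +> a" using e by auto
      then show "\<exists>V\<in>carrier Q. V \<oplus>\<^bsub>Q\<^esub> U = \<zero>\<^bsub>Q\<^esub>"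
        by (intro bexI[of _ "I +> \<ominus> a"]) (auto simp: quot_ops quot_closed l_neg)
    qed (auto simp: quot_carrier quot_ops a_ac)
    show "Group.monoid Q"
      by (rule monoidI) (auto simp: quot_carrier quot_ops m_assoc)
  qed (auto simp: quot_carrier quot_ops l_distr r_distr)
  then show ?thesis
    by (intro kalg.intro kalg_axioms.intro)
      (auto simp: quot_carrier quot_ops smult_add_left smult_add_right smult_smult
        smult_mult_left smult_mult_right)
qed

lemma quot_hom: "alg_hom A Q ((+>) I)"
  by (rule alg_homI) (simp_all add: quot_ops quot_closed)

lemma quot_gen:
  assumes "S \<subseteq> carrier A" "subalg_gen A S = carrier A"
  shows "subalg_gen Q ((+>) I ` S) = carrier Q"
proof -
  interpret Q: kalg Q by (rule quot_kalg)
  interpret kalg_hom A Q "(+>) I" by unfold_locales (rule quot_hom)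
  have "(+>) I ` S \<subseteq> carrier Q" using assms(1) by (auto simp: quot_carrier)
  then have "subalg_gen Q ((+>) I ` S) \<subseteq> carrier Q"
    using subalgD(1)[OF Q.subalg_gen_subalg] by simp
  moreover have "I +> a \<in> subalg_gen Q ((+>) I ` S)" if "a \<in> carrier A" for a
    using hom_image_gen[OF assms(1)] assms(2) that by simp
  ultimately show ?thesis unfolding quot_carrier by blast
qed

text \<open>A representative of each coset is picked by choice; since \<open>\<phi>\<close> kills
  \<open>I\<close>, its value does not depend on the pick.\<close>

lemma quot_lift:
  assumes "kalg C" "alg_hom A C \<phi>" "\<And>x. x \<in> I \<Longrightarrow> \<phi> x = \<zero>\<^bsub>C\<^esub>"
  obtains \<psi> where "alg_hom Q C \<psi>" "\<And>a. a \<in> carrier A \<Longrightarrow> \<psi> (I +> a) = \<phi> a"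
proof -
  interpret C: kalg C by fact
  interpret kalg_hom A C \<phi> by unfold_locales fact
  define \<psi> where "\<psi> U = \<phi> (SOME a. a \<in> carrier A \<and> I +> a = U)" for U
  have *: "\<psi> (I +> a) = \<phi> a" if "a \<in> carrier A" for a
  proof -
    define b where "b = (SOME b. b \<in> carrier A \<and> I +> b = I +> a)"
    have b: "b \<in> carrier A \<and> I +> b = I +> a"
      unfolding b_def using that by (intro someI) simp
    then have "\<phi> (b \<ominus> a) = \<zero>\<^bsub>C\<^esub>" using b that quot_eq_iff[of b a] assms(3)[of "b \<ominus> a"] by simp
    then have "\<phi> b = \<phi> a" using b that by (simp add: hom_minus)
    then show ?thesis by (simp add: \<psi>_def b_def)
  qed
  have "alg_hom Q C \<psi>"
    by (rule alg_homI) (auto simp: quot_carrier quot_ops * hom_add hom_mult hom_smult)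
  then show ?thesis using * that by blast
qed

end

lemma Idl_quot:
  assumes "kalg A" "S \<subseteq> carrier A"
  shows "kalg_ideal A (Idl\<^bsub>A\<^esub> S)"
proof -
  interpret kalg A by fact
  interpret ideal "Idl\<^bsub>A\<^esub> S" A using assms(2) by (rule genideal_ideal)
  show ?thesis by unfold_locales
qed

lemma quot_lift_Idl:
  assumes "kalg A" "S \<subseteq> carrier A" "kalg C" "alg_hom A C \<phi>" "\<And>x. x \<in> S \<Longrightarrow> \<phi> x = \<zero>\<^bsub>C\<^esub>"
  obtains \<psi> where "alg_hom (quot_alg A (Idl\<^bsub>A\<^esub> S)) C \<psi>"
    "\<And>a. a \<in> carrier A \<Longrightarrow> \<psi> (Idl\<^bsub>A\<^esub> S +>\<^bsub>A\<^esub> a) = \<phi> a"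
proof -
  interpret A: kalg_ideal A "Idl\<^bsub>A\<^esub> S" using assms(1,2) by (rule Idl_quot)
  interpret C: kalg C by fact
  interpret kalg_hom A C \<phi> by unfold_locales fact
  show ?thesis
    using A.quot_lift[OF assms(3,4)] hom_Idl_zero[OF assms(2,5)] that by metis
qed

section \<open>Free algebras, localizations and tensor products\<close>

lemma free_monoid_monoid: "Group.monoid (free_monoid X)"
  by (rule Group.monoid.intro) (auto simp: free_monoid_def)

lemma free_alg_kalg: "kalg (free_alg X)"
  unfolding free_alg_def by (rule monoid_alg_kalg[OF free_monoid_monoid])

lemma free_gen_closed: "x \<in> X \<Longrightarrow> free_gen x \<in> carrier (free_alg X)"
  unfolding free_alg_def free_gen_def by (rule basis_vec_closed) (simp add: free_monoid_def)

lemma free_alg_gen: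
  "subalg_gen (free_alg X :: ('k::field, 'x list \<Rightarrow> 'k) module) (free_gen ` X) = carrier (free_alg X)"
proof -
  let ?F = "free_alg X :: ('k, 'x list \<Rightarrow> 'k) module"
  interpret F: kalg ?F by (rule free_alg_kalg)
  have sub: "free_gen ` X \<subseteq> carrier ?F" by (auto intro: free_gen_closed)
  note sD = subalgD[OF F.subalg_gen_subalg[OF sub]]
  have "basis_vec w \<in> subalg_gen ?F (free_gen ` X)" if "w \<in> lists X" for w
    using that
  proof (induction w)
    case Nil
    have "basis_vec [] = \<one>\<^bsub>?F\<^esub>" by (simp add: free_alg_def monoid_alg_sel free_monoid_def)
    then show ?case using sD(2) by simp
  next
    case (Cons x w)
    have "free_gen x \<in> subalg_gen ?F (free_gen ` X)"
      using Cons.hyps by (intro subsetD[OF subalg_gen_incl] imageI)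
    from sD(5)[OF this Cons.IH]
    show ?case by (simp add: free_gen_def free_alg_def basis_vec_mult) (simp add: free_monoid_def)
  qed
  then have "basis_vec ` carrier (free_monoid X) \<subseteq> subalg_gen ?F (free_gen ` X)"
    by (auto simp: free_monoid_def)
  then have "subalg_gen ?F (basis_vec ` carrier (free_monoid X)) \<subseteq> subalg_gen ?F (free_gen ` X)"
    by (rule subalg_gen_least[OF F.subalg_gen_subalg[OF sub]])
  then have "carrier ?F \<subseteq> subalg_gen ?F (free_gen ` X)"
    using monoid_alg_gen[OF free_monoid_monoid[of X]] unfolding free_alg_def by (meson subset_iff)
  then show ?thesis using sD(1) by simp
qed

text \<open>Letters extend to words by multiplying along the word, and words extend to the free
  algebra by linearity.\<close>

lemma free_alg_lift:
  fixes C :: "('k::field, 'a) module"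
  assumes "kalg C" "\<And>x. x \<in> X \<Longrightarrow> \<theta> x \<in> carrier C"
  obtains \<phi> where "alg_hom (free_alg X) C \<phi>" "\<And>x. x \<in> X \<Longrightarrow> \<phi> (free_gen x) = \<theta> x"
proof -
  interpret C: kalg C by fact
  define \<omega> where "\<omega> w = foldr (\<lambda>x y. \<theta> x \<otimes>\<^bsub>C\<^esub> y) w \<one>\<^bsub>C\<^esub>" for w
  have cl: "\<omega> w \<in> carrier C" if "w \<in> lists X" for w
    using that by (induction w) (simp_all add: \<omega>_def assms(2))
  have ap: "\<omega> (v @ w) = \<omega> v \<otimes>\<^bsub>C\<^esub> \<omega> w" if "v \<in> lists X" "w \<in> lists X" for v w
    using that(1)
  proof (induction v)
    case Nil
    then show ?case using cl[OF that(2)] by (simp add: \<omega>_def)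
  next
    case (Cons x v)
    have "\<omega> (x # u) = \<theta> x \<otimes>\<^bsub>C\<^esub> \<omega> u" for u by (simp add: \<omega>_def)
    then show ?case using Cons cl[OF that(2)] cl[of v] assms(2)[of x]
      by (simp add: C.m_assoc)
  qed
  interpret monoid_repr "free_monoid X" C \<omega>
    using cl ap by (intro monoid_repr.intro monoid_repr_axioms.intro assms(1) free_monoid_monoid)
      (simp_all add: free_monoid_def, simp add: \<omega>_def)
  have "monoid_lift C \<omega> (free_gen x) = \<theta> x" if "x \<in> X" for x
    using that lift_basis_vec[of "[x]"] assms(2)
    by (simp add: free_gen_def free_monoid_def \<omega>_def)
  then show ?thesis using lift_hom that unfolding free_alg_def by blast
qed

section \<open>Localizations presented by generators and relations\<close>

locale loc_setup = R: kalg R for R :: "('k::field, 'a) module" and S +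
  assumes S_sub: "S \<subseteq> carrier R"
begin

abbreviation F :: "('k, ('a + 'a) list \<Rightarrow> 'k) module" where
  "F \<equiv> free_alg (loc_gens (carrier R) S)"

abbreviation L :: "('k, (('a + 'a) list \<Rightarrow> 'k) set) module" where "L \<equiv> loc_alg R S"

definition loc_inv :: "'a \<Rightarrow> (('a + 'a) list \<Rightarrow> 'k) set" where
  "loc_inv s = loc_ideal R S +>\<^bsub>F\<^esub> free_gen (Inr s)"

lemma Inl_closed: "a \<in> carrier R \<Longrightarrow> free_gen (Inl a) \<in> carrier F"
  and Inr_closed: "s \<in> S \<Longrightarrow> free_gen (Inr s) \<in> carrier F"
  by (auto intro!: free_gen_closed simp: loc_gens_def)

lemma rels_sub: "loc_rels R S \<subseteq> carrier F"
proof -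
  interpret F: kalg F by (rule free_alg_kalg)
  show ?thesis using S_sub
    unfolding loc_rels_def Let_def by (auto intro!: Inl_closed Inr_closed)
qed

sublocale Q: kalg_ideal F "loc_ideal R S"
  rewrites "quot_alg F (loc_ideal R S) = L"
  using Idl_quot[OF free_alg_kalg rels_sub] by (simp_all add: loc_ideal_def loc_alg_def)

lemma loc_kalg: "kalg L" by (rule Q.quot_kalg)

lemma loc_inv_closed: "s \<in> S \<Longrightarrow> loc_inv s \<in> carrier L"
  unfolding loc_inv_def by (intro Q.quot_closed Inr_closed)

lemma rel_eq:
  assumes "x \<ominus>\<^bsub>F\<^esub> y \<in> loc_rels R S" "x \<in> carrier F" "y \<in> carrier F"
  shows "loc_ideal R S +>\<^bsub>F\<^esub> x = loc_ideal R S +>\<^bsub>F\<^esub> y"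
  using assms Q.genideal_self[OF rels_sub] by (subst Q.quot_eq_iff) (auto simp: loc_ideal_def)

lemma loc_rels_mem:
  "a \<in> carrier R \<Longrightarrow> b \<in> carrier R \<Longrightarrow>
    free_gen (Inl (a \<oplus>\<^bsub>R\<^esub> b)) \<ominus>\<^bsub>F\<^esub> (free_gen (Inl a) \<oplus>\<^bsub>F\<^esub> free_gen (Inl b)) \<in> loc_rels R S"
  "a \<in> carrier R \<Longrightarrow> b \<in> carrier R \<Longrightarrow>
    free_gen (Inl (a \<otimes>\<^bsub>R\<^esub> b)) \<ominus>\<^bsub>F\<^esub> free_gen (Inl a) \<otimes>\<^bsub>F\<^esub> free_gen (Inl b) \<in> loc_rels R S"
  "a \<in> carrier R \<Longrightarrow> free_gen (Inl (u \<odot>\<^bsub>R\<^esub> a)) \<ominus>\<^bsub>F\<^esub> u \<odot>\<^bsub>F\<^esub> free_gen (Inl a) \<in> loc_rels R S"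
  "free_gen (Inl \<one>\<^bsub>R\<^esub>) \<ominus>\<^bsub>F\<^esub> \<one>\<^bsub>F\<^esub> \<in> loc_rels R S"
  "s \<in> S \<Longrightarrow> free_gen (Inl s) \<otimes>\<^bsub>F\<^esub> free_gen (Inr s) \<ominus>\<^bsub>F\<^esub> \<one>\<^bsub>F\<^esub> \<in> loc_rels R S"
  "s \<in> S \<Longrightarrow> free_gen (Inr s) \<otimes>\<^bsub>F\<^esub> free_gen (Inl s) \<ominus>\<^bsub>F\<^esub> \<one>\<^bsub>F\<^esub> \<in> loc_rels R S"
  unfolding loc_rels_def Let_def
  subgoal by (rule UnI1, rule UnI1, rule UnI1, rule UnI1, rule UnI1) blast
  subgoal by (rule UnI1, rule UnI1, rule UnI1, rule UnI1, rule UnI2) blast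
  subgoal by (rule UnI1, rule UnI1, rule UnI1, rule UnI2) blast
  subgoal by (rule UnI1, rule UnI1, rule UnI2) blast
  subgoal by (rule UnI1, rule UnI2) blast
  subgoal by (rule UnI2) blast
  done

lemma loc_map_hom: "alg_hom R L (loc_map R S)"
proof (rule alg_homI; unfold loc_map_def)
  fix a b s assume ab: "a \<in> carrier R" "b \<in> carrier R"
  note c = Inl_closed[OF ab(1)] Inl_closed[OF ab(2)]
  show "loc_ideal R S +>\<^bsub>F\<^esub> free_gen (Inl a) \<in> carrier L"
    using c by (simp add: Q.quot_closed)
  have "loc_ideal R S +>\<^bsub>F\<^esub> free_gen (Inl (a \<oplus>\<^bsub>R\<^esub> b))
      = loc_ideal R S +>\<^bsub>F\<^esub> (free_gen (Inl a) \<oplus>\<^bsub>F\<^esub> free_gen (Inl b))"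
    using ab c by (intro rel_eq loc_rels_mem) (simp_all add: Inl_closed)
  then show "loc_ideal R S +>\<^bsub>F\<^esub> free_gen (Inl (a \<oplus>\<^bsub>R\<^esub> b))
      = (loc_ideal R S +>\<^bsub>F\<^esub> free_gen (Inl a)) \<oplus>\<^bsub>L\<^esub> (loc_ideal R S +>\<^bsub>F\<^esub> free_gen (Inl b))"
    using c by (simp add: Q.quot_add)
  have "loc_ideal R S +>\<^bsub>F\<^esub> free_gen (Inl (a \<otimes>\<^bsub>R\<^esub> b))
      = loc_ideal R S +>\<^bsub>F\<^esub> (free_gen (Inl a) \<otimes>\<^bsub>F\<^esub> free_gen (Inl b))"
    using ab c by (intro rel_eq loc_rels_mem) (simp_all add: Inl_closed)
  then show "loc_ideal R S +>\<^bsub>F\<^esub> free_gen (Inl (a \<otimes>\<^bsub>R\<^esub> b))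
      = (loc_ideal R S +>\<^bsub>F\<^esub> free_gen (Inl a)) \<otimes>\<^bsub>L\<^esub> (loc_ideal R S +>\<^bsub>F\<^esub> free_gen (Inl b))"
    using c by (simp add: Q.quot_mult)
  have "loc_ideal R S +>\<^bsub>F\<^esub> free_gen (Inl (s \<odot>\<^bsub>R\<^esub> a))
      = loc_ideal R S +>\<^bsub>F\<^esub> (s \<odot>\<^bsub>F\<^esub> free_gen (Inl a))"
    using ab c by (intro rel_eq loc_rels_mem) (simp_all add: Inl_closed)
  then show "loc_ideal R S +>\<^bsub>F\<^esub> free_gen (Inl (s \<odot>\<^bsub>R\<^esub> a))
      = s \<odot>\<^bsub>L\<^esub> (loc_ideal R S +>\<^bsub>F\<^esub> free_gen (Inl a))"
    using c by (simp add: Q.quot_smult)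
next
  have "loc_ideal R S +>\<^bsub>F\<^esub> free_gen (Inl \<one>\<^bsub>R\<^esub>) = loc_ideal R S +>\<^bsub>F\<^esub> \<one>\<^bsub>F\<^esub>"
    by (intro rel_eq loc_rels_mem) (simp_all add: Inl_closed)
  then show "loc_ideal R S +>\<^bsub>F\<^esub> free_gen (Inl \<one>\<^bsub>R\<^esub>) = \<one>\<^bsub>L\<^esub>"
    by (simp add: Q.quot_one)
qed

lemma loc_inv:
  assumes "s \<in> S"
  shows "loc_map R S s \<otimes>\<^bsub>L\<^esub> loc_inv s = \<one>\<^bsub>L\<^esub>" "loc_inv s \<otimes>\<^bsub>L\<^esub> loc_map R S s = \<one>\<^bsub>L\<^esub>"
proof -
  note c = Inl_closed[OF subsetD[OF S_sub assms]] Inr_closed[OF assms]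
  have "loc_ideal R S +>\<^bsub>F\<^esub> (free_gen (Inl s) \<otimes>\<^bsub>F\<^esub> free_gen (Inr s)) = loc_ideal R S +>\<^bsub>F\<^esub> \<one>\<^bsub>F\<^esub>"
    using assms c by (intro rel_eq loc_rels_mem) simp_all
  then show "loc_map R S s \<otimes>\<^bsub>L\<^esub> loc_inv s = \<one>\<^bsub>L\<^esub>"
    unfolding loc_map_def loc_inv_def using c by (simp add: Q.quot_mult Q.quot_one)
  have "loc_ideal R S +>\<^bsub>F\<^esub> (free_gen (Inr s) \<otimes>\<^bsub>F\<^esub> free_gen (Inl s)) = loc_ideal R S +>\<^bsub>F\<^esub> \<one>\<^bsub>F\<^esub>"
        using assms c by (intro rel_eq loc_rels_mem) simp_all
  then show "loc_inv s \<otimes>\<^bsub>L\<^esub> loc_map R S s = \<one>\<^bsub>L\<^esub>"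
    unfolding loc_map_def loc_inv_def using c by (simp add: Q.quot_mult Q.quot_one)
qed

text \<open>The presentation has a generator \<open>Inl a\<close> for every \<open>a\<close> in
  \<open>R\<close>. As \<open>loc_map\<close> is a homomorphism, those for a generating set of
  \<open>R\<close> suffice, together with the adjoined inverses.\<close>

lemma loc_gen:
  assumes "T \<subseteq> carrier R" "subalg_gen R T = carrier R"
  shows "subalg_gen L (loc_map R S ` T \<union> loc_inv ` S) = carrier L"
proof -
  interpret L: kalg L by (rule loc_kalg)
  interpret kalg_hom R L "loc_map R S" by unfold_locales (rule loc_map_hom)
  let ?T = "loc_map R S ` T \<union> loc_inv ` S"
  have T: "?T \<subseteq> carrier L" using assms(1) by (auto intro!: loc_inv_closed)
  have "loc_map R S a \<in> subalg_gen L ?T" if "a \<in> carrier R" for a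
  proof -
    have "loc_map R S a \<in> subalg_gen L (loc_map R S ` T)"
      using hom_image_gen[OF assms(1)] assms(2) that by simp
    moreover have "subalg_gen L (loc_map R S ` T) \<subseteq> subalg_gen L ?T"
      using subalg_gen_incl[of ?T L] by (intro L.subalg_gen_mono T) simp
    ultimately show ?thesis by (rule subsetD[rotated])
  qed
  moreover have "loc_inv s \<in> subalg_gen L ?T" if "s \<in> S" for s
    using that by (intro subsetD[OF subalg_gen_incl]) simp
  ultimately have "(\<lambda>x. loc_ideal R S +>\<^bsub>F\<^esub> x) ` free_gen ` loc_gens (carrier R) S \<subseteq> subalg_gen L ?T"
    by (auto simp: loc_gens_def loc_map_def loc_inv_def)
  then have "subalg_gen L ((\<lambda>x. loc_ideal R S +>\<^bsub>F\<^esub> x) ` free_gen ` loc_gens (carrier R) S)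
      \<subseteq> subalg_gen L ?T"
    by (rule L.subalg_gen_mono[OF _ T])
  moreover have "subalg_gen L ((\<lambda>x. loc_ideal R S +>\<^bsub>F\<^esub> x) ` free_gen ` loc_gens (carrier R) S)
      = carrier L"
    by (rule Q.quot_gen) (auto intro: free_gen_closed simp: free_alg_gen)
  ultimately show ?thesis using subalgD(1)[OF L.subalg_gen_subalg[OF T]] by simp
qed

text \<open>The universal property, with the images of the adjoined inverses prescribed by
  \<open>\<psi>\<close>: all six families of relations hold for the map that is
  \<open>\<phi>\<close> on \<open>Inl\<close> and \<open>\<psi>\<close> on
  \<open>Inr\<close>.\<close>

lemma loc_lift:
  assumes C: "kalg C" and \<phi>: "alg_hom R C \<phi>" and \<psi>: "\<And>s. s \<in> S \<Longrightarrow> \<psi> s \<in> carrier C"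
    "\<And>s. s \<in> S \<Longrightarrow> \<phi> s \<otimes>\<^bsub>C\<^esub> \<psi> s = \<one>\<^bsub>C\<^esub>" "\<And>s. s \<in> S \<Longrightarrow> \<psi> s \<otimes>\<^bsub>C\<^esub> \<phi> s = \<one>\<^bsub>C\<^esub>"
  obtains \<chi> where "alg_hom L C \<chi>" "\<And>a. a \<in> carrier R \<Longrightarrow> \<chi> (loc_map R S a) = \<phi> a"
    "\<And>s. s \<in> S \<Longrightarrow> \<chi> (loc_inv s) = \<psi> s"
proof -
  interpret C: kalg C by fact
  note \<phi>D = alg_homD[OF \<phi>]
  obtain \<zeta> where \<zeta>: "alg_hom F C \<zeta>"
    "\<And>x. x \<in> loc_gens (carrier R) S \<Longrightarrow> \<zeta> (free_gen x) = case_sum \<phi> \<psi> x"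
    by (rule free_alg_lift[OF C, of "loc_gens (carrier R) S" "case_sum \<phi> \<psi>"])
      (auto simp: loc_gens_def \<psi> \<phi>D)
  interpret \<zeta>: kalg_hom F C \<zeta> by unfold_locales (rule \<zeta>(1))
  have v: "\<zeta> (free_gen (Inl a)) = \<phi> a" if "a \<in> carrier R" for a
    using \<zeta>(2)[of "Inl a"] that by (simp add: loc_gens_def)
  have v': "\<zeta> (free_gen (Inr s)) = \<psi> s" if "s \<in> S" for s
    using \<zeta>(2)[of "Inr s"] that by (simp add: loc_gens_def)
  have S: "s \<in> carrier R" if "s \<in> S" for s using that S_sub by auto
  have z: "\<zeta> x = \<zero>\<^bsub>C\<^esub>" if "x \<in> loc_rels R S" for x
    using that unfolding loc_rels_def Let_def
    by (auto simp: \<zeta>.hom_minus \<zeta>.hom_add \<zeta>.hom_mult \<zeta>.hom_smult v v' S Inl_closed Inr_closed \<psi> \<phi>D C.r_neg C.minus_eq)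
  obtain \<chi> where \<chi>: "alg_hom L C \<chi>" "\<And>a. a \<in> carrier F \<Longrightarrow> \<chi> (loc_ideal R S +>\<^bsub>F\<^esub> a) = \<zeta> a"
    using quot_lift_Idl[OF free_alg_kalg rels_sub C \<zeta>(1) z] unfolding loc_alg_def loc_ideal_def
    by metis
  show ?thesis
    by (rule that[OF \<chi>(1)]) (simp_all add: loc_map_def loc_inv_def \<chi>(2) v v' Inl_closed Inr_closed)
qed

end

section \<open>Tensor products of algebras\<close>

locale tensor_setup = R: kalg R + S: kalg S
  for R :: "('k::field, 'a) module" and S :: "('k, 'b) module"
begin

abbreviation F :: "('k, 'a \<times> 'b \<Rightarrow> 'k) module" where "F \<equiv> monoid_alg (R \<times>\<times> S)"

abbreviation T :: "('k, ('a \<times> 'b \<Rightarrow> 'k) set) module" where "T \<equiv> tensor_alg R S"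

abbreviation pt :: "'a \<Rightarrow> 'b \<Rightarrow> ('a \<times> 'b \<Rightarrow> 'k) set" where "pt \<equiv> pure_tensor R S"

lemma prod_monoid: "Group.monoid (R \<times>\<times> S)"
  by (rule DirProd_monoid[OF R.monoid_axioms S.monoid_axioms])

lemma vec_closed: "a \<in> carrier R \<Longrightarrow> b \<in> carrier S \<Longrightarrow> basis_vec (a, b) \<in> carrier F"
  by (rule basis_vec_closed) simp

lemma rels_sub: "bilin_rels R S \<subseteq> carrier F"
proof -
  interpret F: kalg F by (rule monoid_alg_kalg[OF prod_monoid])
  show ?thesis unfolding bilin_rels_def Let_def by (auto intro!: vec_closed)
qed

sublocale Q: kalg_ideal F "tensor_ideal R S"
  rewrites "quot_alg F (tensor_ideal R S) = T"
  using Idl_quot[OF monoid_alg_kalg[OF prod_monoid] rels_sub]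
  by (simp_all add: tensor_ideal_def tensor_alg_def)

lemma tensor_kalg: "kalg T" by (rule Q.quot_kalg)

lemma pt_closed: "a \<in> carrier R \<Longrightarrow> b \<in> carrier S \<Longrightarrow> pt a b \<in> carrier T"
  unfolding pure_tensor_def by (intro Q.quot_closed vec_closed)

lemma rel_eq:
  assumes "x \<ominus>\<^bsub>F\<^esub> y \<in> bilin_rels R S" "x \<in> carrier F" "y \<in> carrier F"
  shows "tensor_ideal R S +>\<^bsub>F\<^esub> x = tensor_ideal R S +>\<^bsub>F\<^esub> y"
  using assms Q.genideal_self[OF rels_sub] by (subst Q.quot_eq_iff) (auto simp: tensor_ideal_def)

lemma bilin_rels_mem:
  "a \<in> carrier R \<Longrightarrow> a' \<in> carrier R \<Longrightarrow> b \<in> carrier S \<Longrightarrow>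
    basis_vec (a \<oplus>\<^bsub>R\<^esub> a', b) \<ominus>\<^bsub>F\<^esub> (basis_vec (a, b) \<oplus>\<^bsub>F\<^esub> basis_vec (a', b)) \<in> bilin_rels R S"
  "a \<in> carrier R \<Longrightarrow> b \<in> carrier S \<Longrightarrow> b' \<in> carrier S \<Longrightarrow>
    basis_vec (a, b \<oplus>\<^bsub>S\<^esub> b') \<ominus>\<^bsub>F\<^esub> (basis_vec (a, b) \<oplus>\<^bsub>F\<^esub> basis_vec (a, b')) \<in> bilin_rels R S"
  "a \<in> carrier R \<Longrightarrow> b \<in> carrier S \<Longrightarrow>
    basis_vec (s \<odot>\<^bsub>R\<^esub> a, b) \<ominus>\<^bsub>F\<^esub> s \<odot>\<^bsub>F\<^esub> basis_vec (a, b) \<in> bilin_rels R S"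
  "a \<in> carrier R \<Longrightarrow> b \<in> carrier S \<Longrightarrow>
    basis_vec (a, s \<odot>\<^bsub>S\<^esub> b) \<ominus>\<^bsub>F\<^esub> s \<odot>\<^bsub>F\<^esub> basis_vec (a, b) \<in> bilin_rels R S"
  unfolding bilin_rels_def Let_def
  subgoal by (rule UnI1, rule UnI1, rule UnI1) blast
  subgoal by (rule UnI1, rule UnI1, rule UnI2) blast
  subgoal by (rule UnI1, rule UnI2) blast
  subgoal by (rule UnI2) blast
  done

lemma pt_mult:
  assumes "a \<in> carrier R" "b \<in> carrier S" "a' \<in> carrier R" "b' \<in> carrier S"
  shows "pt a b \<otimes>\<^bsub>T\<^esub> pt a' b' = pt (a \<otimes>\<^bsub>R\<^esub> a') (b \<otimes>\<^bsub>S\<^esub> b')"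
  using assms by (simp add: pure_tensor_def Q.quot_mult vec_closed basis_vec_mult)

lemma pt_one: "pt \<one>\<^bsub>R\<^esub> \<one>\<^bsub>S\<^esub> = \<one>\<^bsub>T\<^esub>"
  by (simp add: pure_tensor_def Q.quot_one monoid_alg_sel)

lemma pt_add_left:
  assumes "a \<in> carrier R" "a' \<in> carrier R" "b \<in> carrier S"
  shows "pt (a \<oplus>\<^bsub>R\<^esub> a') b = pt a b \<oplus>\<^bsub>T\<^esub> pt a' b"
proof -
  have "pt (a \<oplus>\<^bsub>R\<^esub> a') b = tensor_ideal R S +>\<^bsub>F\<^esub> (basis_vec (a, b) \<oplus>\<^bsub>F\<^esub> basis_vec (a', b))"
    unfolding pure_tensor_def using assms
    by (intro rel_eq bilin_rels_mem) (simp_all add: vec_closed)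
  then show ?thesis using assms by (simp add: pure_tensor_def Q.quot_add vec_closed)
qed

lemma pt_add_right:
  assumes "a \<in> carrier R" "b \<in> carrier S" "b' \<in> carrier S"
  shows "pt a (b \<oplus>\<^bsub>S\<^esub> b') = pt a b \<oplus>\<^bsub>T\<^esub> pt a b'"
proof -
  have "pt a (b \<oplus>\<^bsub>S\<^esub> b') = tensor_ideal R S +>\<^bsub>F\<^esub> (basis_vec (a, b) \<oplus>\<^bsub>F\<^esub> basis_vec (a, b'))"
    unfolding pure_tensor_def using assms
    by (intro rel_eq bilin_rels_mem) (simp_all add: vec_closed)
  then show ?thesis using assms by (simp add: pure_tensor_def Q.quot_add vec_closed)
qed

lemma pt_smult_left:
  assumes "a \<in> carrier R" "b \<in> carrier S"
  shows "pt (s \<odot>\<^bsub>R\<^esub> a) b = s \<odot>\<^bsub>T\<^esub> pt a b"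
proof -
  have "pt (s \<odot>\<^bsub>R\<^esub> a) b = tensor_ideal R S +>\<^bsub>F\<^esub> (s \<odot>\<^bsub>F\<^esub> basis_vec (a, b))"
    unfolding pure_tensor_def using assms
    by (intro rel_eq bilin_rels_mem) (simp_all add: vec_closed)
  then show ?thesis using assms by (simp add: pure_tensor_def Q.quot_smult vec_closed)
qed

lemma pt_smult_right:
  assumes "a \<in> carrier R" "b \<in> carrier S"
  shows "pt a (s \<odot>\<^bsub>S\<^esub> b) = s \<odot>\<^bsub>T\<^esub> pt a b"
proof -
  have "pt a (s \<odot>\<^bsub>S\<^esub> b) = tensor_ideal R S +>\<^bsub>F\<^esub> (s \<odot>\<^bsub>F\<^esub> basis_vec (a, b))"
    unfolding pure_tensor_def using assms
    by (intro rel_eq bilin_rels_mem) (simp_all add: vec_closed)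
  then show ?thesis using assms by (simp add: pure_tensor_def Q.quot_smult vec_closed)
qed

lemma pt_left_hom: "alg_hom R T (\<lambda>a. pt a \<one>\<^bsub>S\<^esub>)"
  by (rule alg_homI) (simp_all add: pt_closed pt_add_left pt_mult pt_smult_left pt_one)

lemma pt_right_hom: "alg_hom S T (\<lambda>b. pt \<one>\<^bsub>R\<^esub> b)"
  by (rule alg_homI) (simp_all add: pt_closed pt_add_right pt_mult pt_smult_right pt_one)

lemma tensor_gen_pure: "subalg_gen T {pt a b |a b. a \<in> carrier R \<and> b \<in> carrier S} = carrier T"
proof -
  have sub: "basis_vec ` carrier (R \<times>\<times> S) \<subseteq> carrier F" by (auto intro: vec_closed)
  have "subalg_gen F (basis_vec ` carrier (R \<times>\<times> S)) = carrier F"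
    using subalgD(1)[OF Q.subalg_gen_subalg[OF sub]] monoid_alg_gen[OF prod_monoid] by blast
  from Q.quot_gen[OF sub this]
  have "subalg_gen T ((\<lambda>x. tensor_ideal R S +>\<^bsub>F\<^esub> x) ` basis_vec ` carrier (R \<times>\<times> S)) = carrier T" .
  moreover have "(\<lambda>x. tensor_ideal R S +>\<^bsub>F\<^esub> x) ` basis_vec ` carrier (R \<times>\<times> S)
      = {pt a b |a b. a \<in> carrier R \<and> b \<in> carrier S}"
    by (auto simp: pure_tensor_def image_iff)
  ultimately show ?thesis by simp
qed

text \<open>A pure tensor factors as \<open>pt a \<one> \<otimes> pt \<one> b\<close>, and each
  factor lies in the image of an algebra that has the given generators.\<close>

lemma tensor_gen:
  assumes U: "U \<subseteq> carrier R" "subalg_gen R U = carrier R"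
    and V: "V \<subseteq> carrier S" "subalg_gen S V = carrier S"
  shows "subalg_gen T ((\<lambda>a. pt a \<one>\<^bsub>S\<^esub>) ` U \<union> (\<lambda>b. pt \<one>\<^bsub>R\<^esub> b) ` V) = carrier T"
proof -
  interpret T: kalg T by (rule tensor_kalg)
  interpret l: kalg_hom R T "\<lambda>a. pt a \<one>\<^bsub>S\<^esub>" by unfold_locales (rule pt_left_hom)
  interpret r: kalg_hom S T "\<lambda>b. pt \<one>\<^bsub>R\<^esub> b" by unfold_locales (rule pt_right_hom)
  let ?W = "(\<lambda>a. pt a \<one>\<^bsub>S\<^esub>) ` U \<union> (\<lambda>b. pt \<one>\<^bsub>R\<^esub> b) ` V"
  have W: "?W \<subseteq> carrier T" using U(1) V(1) by (auto intro!: pt_closed)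
  note sD = subalgD[OF T.subalg_gen_subalg[OF W]]
  have pl: "pt a \<one>\<^bsub>S\<^esub> \<in> subalg_gen T ?W" if "a \<in> carrier R" for a
    using l.hom_image_gen[OF U(1)] U(2) that subalg_gen_incl[of ?W T]
      T.subalg_gen_mono[OF _ W, of "(\<lambda>a. pt a \<one>\<^bsub>S\<^esub>) ` U"] by auto
  have pr: "pt \<one>\<^bsub>R\<^esub> b \<in> subalg_gen T ?W" if "b \<in> carrier S" for b
    using r.hom_image_gen[OF V(1)] V(2) that subalg_gen_incl[of ?W T]
      T.subalg_gen_mono[OF _ W, of "(\<lambda>b. pt \<one>\<^bsub>R\<^esub> b) ` V"] by auto
  have "pt a b \<in> subalg_gen T ?W" if "a \<in> carrier R" "b \<in> carrier S" for a b
  proof -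
    have "pt a b = pt a \<one>\<^bsub>S\<^esub> \<otimes>\<^bsub>T\<^esub> pt \<one>\<^bsub>R\<^esub> b" using that by (simp add: pt_mult)
    then show ?thesis using sD(5)[OF pl[OF that(1)] pr[OF that(2)]] by simp
  qed
  then have "{pt a b |a b. a \<in> carrier R \<and> b \<in> carrier S} \<subseteq> subalg_gen T ?W" by blast
  from T.subalg_gen_mono[OF this W] show ?thesis
    using sD(1) unfolding tensor_gen_pure by simp
qed

text \<open>The assignment of \<open>pt (f a) (g b)\<close> to \<open>(a, b)\<close> is
  multiplicative, so it extends to the monoid algebra, and it respects the bilinearity relations
  because \<open>f\<close> and \<open>g\<close> are linear.\<close>

lemma tensor_hom:
  assumes f: "alg_hom R R f" and g: "alg_hom S S g"
  obtains \<phi> where "alg_hom T T \<phi>"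
    "\<And>a b. a \<in> carrier R \<Longrightarrow> b \<in> carrier S \<Longrightarrow> \<phi> (pt a b) = pt (f a) (g b)"
proof -
  note fD = alg_homD[OF f] note gD = alg_homD[OF g]
  interpret T: kalg T by (rule tensor_kalg)
  interpret m: monoid_repr "R \<times>\<times> S" T "\<lambda>(a, b). pt (f a) (g b)"
    by (intro monoid_repr.intro monoid_repr_axioms.intro tensor_kalg prod_monoid)
      (auto simp: pt_closed pt_mult pt_one fD gD)
  define \<zeta> where "\<zeta> = monoid_lift T (\<lambda>(a, b). pt (f a) (g b))"
  interpret \<zeta>: kalg_hom F T \<zeta>
    by unfold_locales (simp add: \<zeta>_def m.lift_hom)
  have v: "\<zeta> (basis_vec (a, b)) = pt (f a) (g b)" if "a \<in> carrier R" "b \<in> carrier S" for a b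
    using that m.lift_basis_vec[of "(a, b)"] by (simp add: \<zeta>_def)
  have z: "\<zeta> x = \<zero>\<^bsub>T\<^esub>" if "x \<in> bilin_rels R S" for x
    using that unfolding bilin_rels_def Let_def
    by (auto simp: \<zeta>.hom_minus \<zeta>.hom_add \<zeta>.hom_smult v vec_closed fD gD pt_closed
      pt_add_left pt_add_right pt_smult_left pt_smult_right T.r_neg T.minus_eq)
  obtain \<chi> where \<chi>: "alg_hom T T \<chi>" "\<And>a. a \<in> carrier F \<Longrightarrow> \<chi> (tensor_ideal R S +>\<^bsub>F\<^esub> a) = \<zeta> a"
    using quot_lift_Idl[OF monoid_alg_kalg[OF prod_monoid] rels_sub tensor_kalg \<zeta>.hom z]
    unfolding tensor_alg_def tensor_ideal_def by metis
  show ?thesis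
    by (rule that[OF \<chi>(1)]) (simp add: pure_tensor_def \<chi>(2) v vec_closed)
qed

end

section \<open>Eigenvectors and graded subspaces\<close>

text \<open>A coincidence of two powers would make some positive power of \<open>q\<close> equal to
  1. The hypothesis on \<open>q\<close> enters the proof at this point: different degrees have
  different weights.\<close>

lemma power_int_inj_not_root_of_unity:
  fixes q :: "'k::field"
  assumes "q \<noteq> 0" "\<And>m::nat. m \<ge> 1 \<Longrightarrow> q ^ m \<noteq> 1" "q powi a = q powi b"
  shows "a = b"
proof -
  have *: "\<not> a < b" if "q powi a = q powi b" for a b
  proof
    assume "a < b"
    have "q powi (b - a) = 1" using that assms(1) by (simp add: power_int_diff)
    moreover have "q powi (b - a) = q ^ nat (b - a)" using \<open>a < b\<close> by (simp add: power_int_def)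
    ultimately show False using assms(2)[of "nat (b - a)"] \<open>a < b\<close> by simp
  qed
  show ?thesis using *[of a b] *[of b a] assms(3) by simp
qed

section \<open>Subspaces, sums of subspaces and separation of eigenvectors\<close>

definition subspace :: "('k::field, 'a) module \<Rightarrow> 'a set \<Rightarrow> bool" where
  "subspace A V \<longleftrightarrow> V \<subseteq> carrier A \<and> \<zero>\<^bsub>A\<^esub> \<in> V \<and> (\<forall>x\<in>V. \<forall>y\<in>V. x \<oplus>\<^bsub>A\<^esub> y \<in> V) \<and>
     (\<forall>s. \<forall>x\<in>V. s \<odot>\<^bsub>A\<^esub> x \<in> V)"

lemma subspaceD:
  assumes "subspace A V"
  shows "x \<in> V \<Longrightarrow> x \<in> carrier A" "\<zero>\<^bsub>A\<^esub> \<in> V" "x \<in> V \<Longrightarrow> y \<in> V \<Longrightarrow> x \<oplus>\<^bsub>A\<^esub> y \<in> V"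
    "x \<in> V \<Longrightarrow> s \<odot>\<^bsub>A\<^esub> x \<in> V"
  using assms unfolding subspace_def by auto

lemma subalg_subspace: "subalg A V \<Longrightarrow> subspace A V"
  using subalgD[of A V] unfolding subspace_def by auto

lemma (in kalg) subspace_zero: "subspace A {\<zero>}"
  unfolding subspace_def by simp

lemma (in kalg) subspace_minus: "subspace A V \<Longrightarrow> x \<in> V \<Longrightarrow> y \<in> V \<Longrightarrow> x \<ominus> y \<in> V"
  by (simp add: minus_eq minus_eq_smult subspaceD)

lemma (in kalg) ideal_subspace: "ideal I A \<Longrightarrow> subspace A I"
  unfolding subspace_def
  using ideal.Icarr additive_subgroup.zero_closed[OF ideal.axioms(1)]
    additive_subgroup.a_closed[OF ideal.axioms(1)] ideal_smult_closed by fastforce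

lemma (in kalg) subspace_idealI:
  assumes "subspace A I" "\<And>a x. a \<in> carrier A \<Longrightarrow> x \<in> I \<Longrightarrow> a \<otimes> x \<in> I"
    "\<And>a x. a \<in> carrier A \<Longrightarrow> x \<in> I \<Longrightarrow> x \<otimes> a \<in> I"
  shows "ideal I A"
proof (rule idealI[OF ring_axioms], rule add.subgroupI)
  note ID = subspaceD[OF assms(1)]
  show "I \<subseteq> carrier A" "I \<noteq> {}" using ID(1,2) by auto
  show "\<ominus> x \<in> I" if "x \<in> I" for x using that ID by (simp add: minus_eq_smult)
  show "x \<oplus> y \<in> I" if "x \<in> I" "y \<in> I" for x y using that by (rule ID(3))
qed (use assms in auto)

lemma (in kalg) subspace_finsum:
  assumes "subspace A V" "finite W" "\<And>w. w \<in> W \<Longrightarrow> f w \<in> V"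
  shows "(\<Oplus>w\<in>W. f w) \<in> V"
  using assms(2,3)
proof (induction W rule: finite_induct)
  case empty
  then show ?case using subspaceD(2)[OF assms(1)] by simp
next
  case (insert w W)
  then have "(\<Oplus>w\<in>insert w W. f w) = f w \<oplus> (\<Oplus>w\<in>W. f w)"
    using subspaceD(1)[OF assms(1)] by (intro finsum_insert) auto
  then show ?case using insert subspaceD(3)[OF assms(1)] by simp
qed

text \<open>Eigenvectors for distinct eigenvalues: apply \<open>\<phi> - \<chi> u\<close> to remove the summand \<open>u\<close>.\<close>

lemma (in kalg) eigenvectors_mem_subspace:
  assumes V: "subspace A V"
    and \<Phi>: "\<And>\<phi> \<chi>. (\<phi>, \<chi>) \<in> \<Phi> \<Longrightarrow> alg_hom A A \<phi>" "\<And>\<phi> \<chi> v. (\<phi>, \<chi>) \<in> \<Phi> \<Longrightarrow> v \<in> V \<Longrightarrow> \<phi> v \<in> V"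
    and sep: "\<And>w w'. w \<in> W \<Longrightarrow> w' \<in> W \<Longrightarrow> w \<noteq> w' \<Longrightarrow> \<exists>(\<phi>, \<chi>)\<in>\<Phi>. \<chi> w \<noteq> \<chi> w'"
    and W: "finite W" "\<And>w. w \<in> W \<Longrightarrow> x w \<in> carrier A"
    and eig: "\<And>\<phi> \<chi> w. (\<phi>, \<chi>) \<in> \<Phi> \<Longrightarrow> w \<in> W \<Longrightarrow> \<phi> (x w) = \<chi> w \<odot> x w"
    and sum: "(\<Oplus>w\<in>W. x w) \<in> V"
    and w0: "w0 \<in> W"
  shows "x w0 \<in> V"
proof -
  \<comment> \<open>The family \<open>y\<close> is arbitrary here, because the induction step
    replaces it by the rescaled family \<open>(\<chi> w - \<chi> u) \<odot> y w\<close>, which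
    consists of eigenvectors again.\<close>
  have claim: "y w0 \<in> V" if "finite U" "U \<subseteq> W - {w0}" "\<And>w. w \<in> W \<Longrightarrow> y w \<in> carrier A"
    "\<And>\<phi> \<chi> w. (\<phi>, \<chi>) \<in> \<Phi> \<Longrightarrow> w \<in> W \<Longrightarrow> \<phi> (y w) = \<chi> w \<odot> y w"
    "y w0 \<oplus> (\<Oplus>w\<in>U. y w) \<in> V" for U y
    using that
  proof (induction U arbitrary: y rule: finite_induct)
    case empty
    then show ?case using w0 by simp
  next
    case (insert u U)
    have u: "u \<in> W" "u \<noteq> w0" using insert.prems(1) by auto
    obtain \<phi> \<chi> where \<phi>: "(\<phi>, \<chi>) \<in> \<Phi>" "\<chi> w0 \<noteq> \<chi> u"
      using sep[OF w0 u(1)] u(2) by auto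
    interpret \<phi>: kalg_hom A A \<phi> by unfold_locales (rule \<Phi>(1)[OF \<phi>(1)])
    have UW: "w \<in> W" if "w \<in> U" for w using that insert.prems(1) by auto
    have cU: "y \<in> U \<rightarrow> carrier A" using insert.prems(2) UW by auto
    define v where "v = y w0 \<oplus> (\<Oplus>w\<in>insert u U. y w)"
    define y' where "y' w = (\<chi> w - \<chi> u) \<odot> y w" for w
    have v_eq: "v = y w0 \<oplus> (y u \<oplus> (\<Oplus>w\<in>U. y w))"
      unfolding v_def using insert.hyps cU insert.prems(2)[OF u(1)] by simp
    have c: "y w0 \<in> carrier A" "y u \<in> carrier A" "(\<Oplus>w\<in>U. y w) \<in> carrier A"
      using insert.prems(2) w0 u cU by (auto intro: finsum_closed)
    have e: "\<phi> (y w) = \<chi> w \<odot> y w" if "w \<in> W" for w using insert.prems(3) \<phi>(1) that by simp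
    have eU: "\<phi> (\<Oplus>w\<in>U. y w) = (\<Oplus>w\<in>U. \<chi> w \<odot> y w)"
    proof -
      have "\<phi> (\<Oplus>w\<in>U. y w) = (\<Oplus>w\<in>U. \<phi> (y w))"
        using insert.hyps(1) cU by (intro \<phi>.hom_finsum) auto
      also have "\<dots> = (\<Oplus>w\<in>U. \<chi> w \<odot> y w)"
        using cU e UW by (intro finsum_cong') auto
      finally show ?thesis .
    qed
    have y'U: "(\<Oplus>w\<in>U. y' w) = (\<Oplus>w\<in>U. \<chi> w \<odot> y w) \<oplus> (- \<chi> u) \<odot> (\<Oplus>w\<in>U. y w)"
    proof -
      have "(\<Oplus>w\<in>U. y' w) = (\<Oplus>w\<in>U. \<chi> w \<odot> y w \<oplus> (- \<chi> u) \<odot> y w)"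
        using cU by (intro finsum_cong') (auto simp: y'_def Pi_iff simp flip: smult_add_left)
      also have "\<dots> = (\<Oplus>w\<in>U. \<chi> w \<odot> y w) \<oplus> (\<Oplus>w\<in>U. (- \<chi> u) \<odot> y w)"
        using cU by (intro finsum_addf) auto
      also have "(\<Oplus>w\<in>U. (- \<chi> u) \<odot> y w) = (- \<chi> u) \<odot> (\<Oplus>w\<in>U. y w)"
        using insert.hyps(1) cU by (intro smult_finsum[symmetric]) auto
      finally show ?thesis .
    qed
    have cS: "(\<Oplus>w\<in>U. \<chi> w \<odot> y w) \<in> carrier A" using cU by (intro finsum_closed) auto
    have "\<phi> v \<oplus> (- \<chi> u) \<odot> v = y' w0 \<oplus> (\<Oplus>w\<in>U. y' w)"
    proof -
      have z: "\<chi> u \<odot> y u \<oplus> (- \<chi> u) \<odot> y u = \<zero>" using c by (simp flip: smult_add_left)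
      have "\<phi> v \<oplus> (- \<chi> u) \<odot> v
        = (\<chi> w0 \<odot> y w0 \<oplus> (\<chi> u \<odot> y u \<oplus> (\<Oplus>w\<in>U. \<chi> w \<odot> y w)))
          \<oplus> ((- \<chi> u) \<odot> y w0 \<oplus> ((- \<chi> u) \<odot> y u \<oplus> (- \<chi> u) \<odot> (\<Oplus>w\<in>U. y w)))"
        unfolding v_eq using c e[OF w0] e[OF u(1)] eU by (simp add: \<phi>.hom_add smult_add_right)
      also have "\<dots> = (\<chi> w0 \<odot> y w0 \<oplus> (- \<chi> u) \<odot> y w0) \<oplus> ((\<chi> u \<odot> y u \<oplus> (- \<chi> u) \<odot> y u)
          \<oplus> ((\<Oplus>w\<in>U. \<chi> w \<odot> y w) \<oplus> (- \<chi> u) \<odot> (\<Oplus>w\<in>U. y w)))"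
        using c cS by (simp add: a_ac)
      also have "\<dots> = y' w0 \<oplus> (\<Oplus>w\<in>U. y' w)"
        unfolding z y'U using c cS by (simp add: y'_def flip: smult_add_left)
      finally show ?thesis .
    qed
    moreover have "\<phi> v \<oplus> (- \<chi> u) \<odot> v \<in> V"
    proof -
      have "v \<in> V" using insert.prems(4) by (simp add: v_def)
      then show ?thesis using \<Phi>(2)[OF \<phi>(1)] by (intro subspaceD(3)[OF V] subspaceD(4)[OF V]) auto
    qed
    ultimately have "y' w0 \<oplus> (\<Oplus>w\<in>U. y' w) \<in> V" by simp
    then have "y' w0 \<in> V"
    proof (rule insert.IH[rotated 3])
      show "U \<subseteq> W - {w0}" using insert.prems(1) by auto
      show "y' w \<in> carrier A" if "w \<in> W" for w using insert.prems(2)[OF that] by (simp add: y'_def)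
      show "\<phi>' (y' w) = \<chi>' w \<odot> y' w" if "(\<phi>', \<chi>') \<in> \<Phi>" "w \<in> W" for \<phi>' \<chi>' w
        using alg_homD(4)[OF \<Phi>(1)[OF that(1)] insert.prems(2)[OF that(2)]] insert.prems(3)[OF that]
          insert.prems(2)[OF that(2)] by (simp add: y'_def smult_smult mult.commute)
    qed
    \<comment> \<open>The rescaling can be undone at \<open>w0\<close>, since \<open>\<phi>\<close>
      was chosen with different eigenvalues at \<open>w0\<close> and \<open>u\<close>.\<close>
    then have "inverse (\<chi> w0 - \<chi> u) \<odot> y' w0 \<in> V" by (rule subspaceD(4)[OF V])
    then show ?case using \<phi>(2) c by (simp add: y'_def smult_smult)
  qed
  have "x w0 \<oplus> (\<Oplus>w\<in>W - {w0}. x w) = (\<Oplus>w\<in>insert w0 (W - {w0}). x w)"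
    using W w0 by (subst finsum_insert) auto
  then have "x w0 \<oplus> (\<Oplus>w\<in>W - {w0}. x w) \<in> V" using sum w0 by (simp add: insert_absorb)
  then show ?thesis using W eig by (intro claim[of "W - {w0}" x]) auto
qed

text \<open>The sum of the subspaces \<open>D w\<close>. Directness is not built in; where it
  matters it is derived from eigenvalues.\<close>

inductive_set graded_span :: "('k::field, 'a) module \<Rightarrow> 'w set \<Rightarrow> ('w \<Rightarrow> 'a set) \<Rightarrow> 'a set"
  for A :: "('k::field, 'a) module" and \<Omega> :: "'w set" and D :: "'w \<Rightarrow> 'a set" where
  zero: "\<zero>\<^bsub>A\<^esub> \<in> graded_span A \<Omega> D"
| add: "w \<in> \<Omega> \<Longrightarrow> x \<in> D w \<Longrightarrow> y \<in> graded_span A \<Omega> D \<Longrightarrow> x \<oplus>\<^bsub>A\<^esub> y \<in> graded_span A \<Omega> D"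

locale graded = kalg A for A :: "('k::field, 'a) module" (structure) and \<Omega> :: "'w set" and D +
  assumes D_subspace: "w \<in> \<Omega> \<Longrightarrow> subspace A (D w)"
begin

lemma D_carrier: "w \<in> \<Omega> \<Longrightarrow> x \<in> D w \<Longrightarrow> x \<in> carrier A"
  using subspaceD(1)[OF D_subspace] .

lemma span_carrier: "x \<in> graded_span A \<Omega> D \<Longrightarrow> x \<in> carrier A"
  by (induction rule: graded_span.induct) (auto dest: D_carrier)

lemma span_incl: "w \<in> \<Omega> \<Longrightarrow> x \<in> D w \<Longrightarrow> x \<in> graded_span A \<Omega> D"
  using graded_span.add[OF _ _ graded_span.zero, of w \<Omega> x D A] D_carrier by simp

lemma span_add:
  assumes "x \<in> graded_span A \<Omega> D" "y \<in> graded_span A \<Omega> D"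
  shows "x \<oplus> y \<in> graded_span A \<Omega> D"
  using assms
proof (induction rule: graded_span.induct)
  case zero
  then show ?case using span_carrier by simp
next
  case (add w x z)
  then have "x \<oplus> (z \<oplus> y) \<in> graded_span A \<Omega> D" by - (rule graded_span.add[of w], simp_all)
  then show ?case using add D_carrier span_carrier by (simp add: a_assoc)
qed

lemma span_map:
  assumes x: "x \<in> graded_span A \<Omega> D"
    and f: "f \<zero> = \<zero>" "\<And>x y. x \<in> carrier A \<Longrightarrow> y \<in> carrier A \<Longrightarrow> f (x \<oplus> y) = f x \<oplus> f y"
    and H: "\<And>w x. w \<in> \<Omega> \<Longrightarrow> x \<in> D w \<Longrightarrow> f x \<in> graded_span A \<Omega> D"
  shows "f x \<in> graded_span A \<Omega> D"
  using x
proof (induction rule: graded_span.induct)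
  case zero
  then show ?case using f graded_span.zero by simp
next
  case (add w x y)
  then show ?case using f(2)[OF D_carrier span_carrier] span_add[OF H] by simp
qed

lemma span_subspace: "subspace A (graded_span A \<Omega> D)"
  unfolding subspace_def
proof (intro conjI ballI allI)
  fix s x assume "x \<in> graded_span A \<Omega> D"
  then show "s \<odot> x \<in> graded_span A \<Omega> D"
    by (rule span_map) (auto simp: smult_add_right intro: span_incl subspaceD(4)[OF D_subspace])
qed (auto intro: span_carrier graded_span.zero span_add)

text \<open>The inductive rules may use a degree repeatedly. Separation of eigenvectors wants at
  most one summand per degree, because equal degrees have equal eigenvalues.\<close>

lemma span_repr:
  assumes "x \<in> graded_span A \<Omega> D"
  obtains W f where "finite W" "W \<subseteq> \<Omega>" "\<And>w. w \<in> W \<Longrightarrow> f w \<in> D w" "x = (\<Oplus>w\<in>W. f w)"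
proof -
  have "\<exists>W f. finite W \<and> W \<subseteq> \<Omega> \<and> (\<forall>w\<in>W. f w \<in> D w) \<and> x = (\<Oplus>w\<in>W. f w)"
    using assms
  proof (induction rule: graded_span.induct)
    case zero
    show ?case by (rule exI[of _ "{}"]) simp
  next
    case (add w x y)
    then obtain W f where W: "finite W" "W \<subseteq> \<Omega>" "\<And>w. w \<in> W \<Longrightarrow> f w \<in> D w" "y = (\<Oplus>w\<in>W. f w)"
      by blast
    \<comment> \<open>A new summand of a degree that already occurs is merged with the old one; this
      stays in \<open>D w\<close>, a subspace.\<close>
    define g where "g = f(w := if w \<in> W then x \<oplus> f w else x)"
    have c: "f v \<in> carrier A" if "v \<in> W" for v using W(2,3) that D_carrier by blast
    have x: "x \<in> carrier A" using add D_carrier by blast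
    have "g v \<in> D v" if "v \<in> insert w W" for v
      using that W(3) add(1,2) subspaceD(3)[OF D_subspace] by (auto simp: g_def)
    moreover have "x \<oplus> y = (\<Oplus>v\<in>insert w W. g v)"
    proof -
      have g: "(\<Oplus>v\<in>W - {w}. g v) = (\<Oplus>v\<in>W - {w}. f v)"
        using c by (intro finsum_cong') (auto simp: g_def)
      have "(\<Oplus>v\<in>insert w W. g v) = (\<Oplus>v\<in>insert w (W - {w}). g v)" by (simp add: insert_Diff_single)
      also have "\<dots> = g w \<oplus> (\<Oplus>v\<in>W - {w}. g v)"
        using W(1) c x by (subst finsum_insert) (auto simp: g_def)
      finally have 1: "(\<Oplus>v\<in>insert w W. g v) = g w \<oplus> (\<Oplus>v\<in>W - {w}. f v)" unfolding g .
      have cl: "(\<Oplus>v\<in>W - {w}. f v) \<in> carrier A" using c by (intro finsum_closed) auto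
      show ?thesis
      proof (cases "w \<in> W")
        case True
        have "y = (\<Oplus>v\<in>insert w (W - {w}). f v)" using W(4) True by (simp add: insert_absorb)
        also have "\<dots> = f w \<oplus> (\<Oplus>v\<in>W - {w}. f v)"
          using W(1) c True by (subst finsum_insert) auto
        finally show ?thesis unfolding 1 using True c[OF True] x cl by (simp add: g_def a_assoc)
      next
        case False
        then show ?thesis unfolding 1 using W(4) by (simp add: g_def)
      qed
    qed
    ultimately show ?case using W(1,2) add(1)
      by (intro exI[of _ "insert w W"] exI[of _ g]) auto
  qed
  then show ?thesis using that by blast
qed

text \<open>The elements whose left multiplication preserves the span form a subalgebra. So it is
  enough to multiply a homogeneous element by a generator.\<close>

lemma span_left_closed:
  assumes T: "T \<subseteq> carrier A" and m: "\<And>s w x. s \<in> T \<Longrightarrow> w \<in> \<Omega> \<Longrightarrow> x \<in> D w \<Longrightarrow> s \<otimes> x \<in> graded_span A \<Omega> D"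
    and a: "a \<in> subalg_gen A T" and x: "x \<in> graded_span A \<Omega> D"
  shows "a \<otimes> x \<in> graded_span A \<Omega> D"
proof -
  let ?V = "{a \<in> carrier A. \<forall>x\<in>graded_span A \<Omega> D. a \<otimes> x \<in> graded_span A \<Omega> D}"
  have "subalg A ?V"
  proof (rule subalgI)
    fix a b assume ab: "a \<in> ?V" "b \<in> ?V"
    show "a \<oplus> b \<in> ?V" using ab span_carrier span_add by (auto simp: l_distr)
    have "a \<otimes> b \<otimes> x \<in> graded_span A \<Omega> D" if "x \<in> graded_span A \<Omega> D" for x
      using ab that span_carrier[OF that] by (simp add: m_assoc)
    then show "a \<otimes> b \<in> ?V" using ab by simp
  next
    fix s a assume "a \<in> ?V"
    then show "s \<odot> a \<in> ?V" using span_carrier subspaceD(4)[OF span_subspace] by (auto simp: smult_mult_left)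
  qed (use span_carrier in auto)
  moreover have "s \<in> ?V" if "s \<in> T" for s
  proof -
    have s: "s \<in> carrier A" using T that by auto
    have "s \<otimes> x \<in> graded_span A \<Omega> D" if "x \<in> graded_span A \<Omega> D" for x
      using that by (rule span_map) (use s m[OF \<open>s \<in> T\<close>] in \<open>auto simp: r_distr\<close>)
    then show ?thesis using s by simp
  qed
  ultimately have "subalg_gen A T \<subseteq> ?V" by (intro subalg_gen_least) auto
  then show ?thesis using a x by auto
qed

lemma span_right_closed:
  assumes T: "T \<subseteq> carrier A" and m: "\<And>s w x. s \<in> T \<Longrightarrow> w \<in> \<Omega> \<Longrightarrow> x \<in> D w \<Longrightarrow> x \<otimes> s \<in> graded_span A \<Omega> D"
    and a: "a \<in> subalg_gen A T" and x: "x \<in> graded_span A \<Omega> D"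
  shows "x \<otimes> a \<in> graded_span A \<Omega> D"
proof -
  let ?V = "{a \<in> carrier A. \<forall>x\<in>graded_span A \<Omega> D. x \<otimes> a \<in> graded_span A \<Omega> D}"
  have "subalg A ?V"
  proof (rule subalgI)
    fix a b assume ab: "a \<in> ?V" "b \<in> ?V"
    show "a \<oplus> b \<in> ?V" using ab span_carrier span_add by (auto simp: r_distr)
    have "x \<otimes> (a \<otimes> b) \<in> graded_span A \<Omega> D" if "x \<in> graded_span A \<Omega> D" for x
      using ab that span_carrier[OF that] by (simp flip: m_assoc)
    then show "a \<otimes> b \<in> ?V" using ab by simp
  next
    fix s a assume "a \<in> ?V"
    then show "s \<odot> a \<in> ?V" using span_carrier subspaceD(4)[OF span_subspace] by (auto simp: smult_mult_right)
  qed (use span_carrier in auto)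
  moreover have "s \<in> ?V" if "s \<in> T" for s
  proof -
    have s: "s \<in> carrier A" using T that by auto
    have "x \<otimes> s \<in> graded_span A \<Omega> D" if "x \<in> graded_span A \<Omega> D" for x
      using that by (rule span_map) (use s m[OF \<open>s \<in> T\<close>] in \<open>auto simp: l_distr\<close>)
    then show ?thesis using s by simp
  qed
  ultimately have "subalg_gen A T \<subseteq> ?V" by (intro subalg_gen_least) auto
  then show ?thesis using a x by auto
qed

end

section \<open>Torus extensions\<close>

text \<open>
  In the application \<open>R = R\<^sup>+ \<otimes> R\<^sup>-\<close>, \<open>S\<close> generates \<open>B\<close>, \<open>G = H \<times> H\<close>, \<open>Gt = H~\<close>, \<open>z l True\<close> is
  \<open>1 \<otimes> Z\<^bsub>l c_l\<^esub>\<close> with inverse \<open>z l False\<close>, and \<open>mid \<delta>\<close> scales column \<open>l\<close> of \<open>Y\<close> by \<open>\<delta> l\<close>, that is, it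
  records the degree in the inner index \<open>l\<close> of the generators \<open>Y\<^bsub>i l\<^esub> \<otimes> Z\<^bsub>l j\<^esub>\<close>.
\<close>

locale torus_extension = R: kalg R for R :: "('k::field, 'a) module" (structure) +
  fixes q :: 'k and t :: nat and S :: "'a set" and act :: "'g \<Rightarrow> 'a \<Rightarrow> 'a" and G Gt :: "'g set"
    and z :: "nat \<Rightarrow> bool \<Rightarrow> 'a" and mid :: "(nat \<Rightarrow> 'k) \<Rightarrow> 'g"
  assumes q0: "q \<noteq> 0" and q_nroot: "\<And>m::nat. m \<ge> 1 \<Longrightarrow> q ^ m \<noteq> 1"
    and S_sub: "S \<subseteq> carrier R"
    and act_hom: "g \<in> G \<Longrightarrow> alg_hom R R (act g)"
    and Gt_sub: "Gt \<subseteq> G"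
    and z_closed: "l \<in> {1..t} \<Longrightarrow> z l e \<in> carrier R"
    and z_inv: "l \<in> {1..t} \<Longrightarrow> z l e \<otimes> z l (\<not> e) = \<one>"
    and z_comm: "l \<in> {1..t} \<Longrightarrow> m \<in> {1..t} \<Longrightarrow> z l e \<otimes> z m e' = z m e' \<otimes> z l e"
    and gen: "subalg_gen R (S \<union> {z l e |l e. l \<in> {1..t}}) = carrier R"
    and act_S: "g \<in> G \<Longrightarrow> s \<in> S \<Longrightarrow> \<exists>\<kappa>. act g s = \<kappa> \<odot> s"
    and act_z: "g \<in> G \<Longrightarrow> l \<in> {1..t} \<Longrightarrow> \<exists>\<kappa>. act g (z l e) = \<kappa> \<odot> z l e"
    and mid_G: "(\<And>l. l \<in> {1..t} \<Longrightarrow> \<delta> l \<noteq> 0) \<Longrightarrow> mid \<delta> \<in> G"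
    and mid_S: "s \<in> S \<Longrightarrow> \<exists>d. (\<forall>l. l \<notin> {1..t} \<longrightarrow> d l = 0) \<and> (\<forall>\<delta>. (\<forall>l\<in>{1..t}. \<delta> l \<noteq> 0) \<longrightarrow>
        act (mid \<delta>) s = (\<Prod>l\<in>{1..t}. \<delta> l powi d l) \<odot> s)"
    and act_decomp: "g \<in> G \<Longrightarrow> \<exists>h\<in>Gt. \<exists>\<delta>. (\<forall>l\<in>{1..t}. \<delta> l \<noteq> 0) \<and>
        (\<forall>s\<in>S. act g s = act h (act (mid \<delta>) s))"
    and conj_z: "l \<in> {1..t} \<Longrightarrow> \<exists>h\<in>Gt. \<exists>\<delta>. (\<forall>l\<in>{1..t}. \<delta> l \<noteq> 0) \<and>
        (\<forall>s\<in>S. z l e \<otimes> s \<otimes> z l (\<not> e) = act h (act (mid \<delta>) s))"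
    and mid_conj: "l \<in> {1..t} \<Longrightarrow> \<exists>w\<in>subalg_gen R S. \<exists>w'\<in>subalg_gen R S. \<exists>h\<in>Gt. w \<otimes> w' = \<one> \<and> w' \<otimes> w = \<one> \<and>
        (\<forall>s\<in>S. act (mid (\<lambda>m. if m = l then q\<^sup>2 else 1)) s = act h (w \<otimes> s \<otimes> w'))"
    and tau: "l \<in> {1..t} \<Longrightarrow> \<exists>g\<in>G. (\<forall>s\<in>S. act g s = s) \<and>
        (\<forall>m\<in>{1..t}. act g (z m True) = (if m = l then q else 1) \<odot> z m True \<and>
                     act g (z m False) = (if m = l then inverse q else 1) \<odot> z m False)"
begin

abbreviation B where "B \<equiv> subalg_gen R S"

section \<open>The subalgebra B and its stability\<close>

abbreviation RB where "RB \<equiv> R\<lparr>carrier := B\<rparr>"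

lemma B_subalg: "subalg R B" by (rule R.subalg_gen_subalg[OF S_sub])

lemmas BD = subalgD[OF B_subalg]

lemma B_carrier: "b \<in> B \<Longrightarrow> b \<in> carrier R" using BD(1) by auto

lemma S_B: "s \<in> S \<Longrightarrow> s \<in> B" using subalg_gen_incl by (rule subsetD)

lemma hom_eq_on_B:
  assumes "alg_hom R R \<phi>" "alg_hom R R \<psi>" "\<And>s. s \<in> S \<Longrightarrow> \<phi> s = \<psi> s" "b \<in> B"
  shows "\<phi> b = \<psi> b"
  using R.kalg_axioms R.kalg_axioms assms(1,2) S_sub assms(3,4) by (rule alg_hom_eq_on_gen)

lemma conj_hom:
  assumes "u \<in> carrier R" "v \<in> carrier R" "u \<otimes> v = \<one>" "v \<otimes> u = \<one>"
  shows "alg_hom R R (\<lambda>x. u \<otimes> x \<otimes> v)"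
proof (rule alg_homI)
  fix a b assume ab: "a \<in> carrier R" "b \<in> carrier R"
  have "(u \<otimes> a \<otimes> v) \<otimes> (u \<otimes> b \<otimes> v) = u \<otimes> a \<otimes> (v \<otimes> u) \<otimes> b \<otimes> v"
    using ab assms(1,2) by (simp add: R.m_assoc)
  then show "u \<otimes> (a \<otimes> b) \<otimes> v = (u \<otimes> a \<otimes> v) \<otimes> (u \<otimes> b \<otimes> v)"
    using ab assms by (simp add: R.m_assoc)
qed (use assms in \<open>simp_all add: R.l_distr R.r_distr R.smult_mult_left R.smult_mult_right\<close>)

lemma hom_B:
  assumes "alg_hom R R \<phi>" "\<And>s. s \<in> S \<Longrightarrow> \<phi> s \<in> B" "b \<in> B" shows "\<phi> b \<in> B"
proof -
  interpret kalg_hom R R \<phi> by unfold_locales (rule assms(1))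
  have "B \<subseteq> {a \<in> carrier R. \<phi> a \<in> B}"
    using assms(2) S_sub by (intro subalg_gen_least vimage_subalg B_subalg) auto
  then show ?thesis using assms(3) by auto
qed

lemma act_B: "g \<in> G \<Longrightarrow> b \<in> B \<Longrightarrow> act g b \<in> B"
proof (rule hom_B[OF act_hom])
  fix s assume "g \<in> G" "s \<in> S"
  then show "act g s \<in> B" using act_S[of g s] BD(6)[OF S_B] by auto
qed

lemma conj_z_hom: "l \<in> {1..t} \<Longrightarrow> alg_hom R R (\<lambda>x. z l e \<otimes> x \<otimes> z l (\<not> e))"
  using z_inv[of l e] z_inv[of l "\<not> e"] by (intro conj_hom z_closed) auto

text \<open>Ideals of \<open>RB\<close> are read inside \<open>R\<close>. They are subspaces because
  the scalars \<open>s \<odot> \<one>\<close> belong to \<open>B\<close>.\<close>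

lemma RB_idealD:
  assumes "ideal I RB"
  shows "I \<subseteq> B" "subspace R I" "b \<in> B \<Longrightarrow> x \<in> I \<Longrightarrow> b \<otimes> x \<in> I" "b \<in> B \<Longrightarrow> x \<in> I \<Longrightarrow> x \<otimes> b \<in> I"
proof -
  show sub: "I \<subseteq> B" using ideal.Icarr[OF assms] by auto
  show l: "b \<otimes> x \<in> I" if "b \<in> B" "x \<in> I" for b x
    using ideal.I_l_closed[OF assms, of x b] that by simp
  show "x \<otimes> b \<in> I" if "b \<in> B" "x \<in> I" for b x
    using ideal.I_r_closed[OF assms, of x b] that by simp
  have "s \<odot> x \<in> I" if "x \<in> I" for s x
    using l[OF BD(6)[OF BD(2)] that, of s] that sub B_carrier
    by (auto simp: R.smult_mult_left)
  then show "subspace R I"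
    unfolding subspace_def
    using sub BD(1) additive_subgroup.zero_closed[OF ideal.axioms(1)[OF assms]]
      additive_subgroup.a_closed[OF ideal.axioms(1)[OF assms]] by auto
qed

section \<open>The grading of B by inner degrees\<close>

definition \<Omega> :: "(nat \<Rightarrow> int) set" where "\<Omega> = {d. \<forall>l. l \<notin> {1..t} \<longrightarrow> d l = 0}"

definition wt :: "(nat \<Rightarrow> 'k) \<Rightarrow> (nat \<Rightarrow> int) \<Rightarrow> 'k" where
  "wt \<delta> d = (\<Prod>l\<in>{1..t}. \<delta> l powi d l)"

text \<open>Degrees are joint weights of the inner torus. Monomials in the generators would be the
  other option, but they need not be linearly independent.\<close>

definition Bd :: "(nat \<Rightarrow> int) \<Rightarrow> 'a set" where
  "Bd d = {b \<in> B. \<forall>\<delta>. (\<forall>l\<in>{1..t}. \<delta> l \<noteq> 0) \<longrightarrow> act (mid \<delta>) b = wt \<delta> d \<odot> b}"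

text \<open>Being zero outside \<open>{1..t}\<close> makes the exponent vectors a copy of Z^t;
  otherwise two of them could differ where no weight sees it.\<close>

lemma \<Omega>_ne: "d \<in> \<Omega> \<Longrightarrow> d' \<in> \<Omega> \<Longrightarrow> d \<noteq> d' \<Longrightarrow> \<exists>l\<in>{1..t}. d l \<noteq> d' l"
proof (rule ccontr)
  assume d: "d \<in> \<Omega>" "d' \<in> \<Omega>" "d \<noteq> d'" "\<not> (\<exists>l\<in>{1..t}. d l \<noteq> d' l)"
  have "d l = d' l" for l
    by (cases "l \<in> {1..t}") (use d(1,2,4) in \<open>simp_all add: \<Omega>_def\<close>)
  then show False using d(3) by auto
qed

lemma midG: "(\<forall>l\<in>{1..t}. \<delta> l \<noteq> 0) \<Longrightarrow> mid \<delta> \<in> G"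
  using mid_G by auto

lemma BdD:
  assumes "b \<in> Bd d"
  shows "b \<in> B" "b \<in> carrier R" "(\<forall>l\<in>{1..t}. \<delta> l \<noteq> 0) \<Longrightarrow> act (mid \<delta>) b = wt \<delta> d \<odot> b"
  using assms B_carrier unfolding Bd_def by auto

lemma Bd_subspace: "subspace R (Bd d)"
  unfolding subspace_def
proof (intro conjI ballI allI)
  note aD = alg_homD[OF act_hom[OF midG]]
  show "Bd d \<subseteq> carrier R" using BdD(2) by auto
  have "act (mid \<delta>) \<zero> = \<zero>" if "\<forall>l\<in>{1..t}. \<delta> l \<noteq> 0" for \<delta>
    using aD(4)[OF that, of \<zero> 0] aD(1)[OF that, of \<zero>] by simp
  then show "\<zero> \<in> Bd d" using BD(3) by (simp add: Bd_def)
  fix x y s assume x: "x \<in> Bd d"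
  have "act (mid \<delta>) (s \<odot> x) = wt \<delta> d \<odot> (s \<odot> x)" if "\<forall>l\<in>{1..t}. \<delta> l \<noteq> 0" for \<delta>
    using aD(4)[OF that, of x s] BdD[OF x] that by (simp add: R.smult_smult mult.commute)
  then show "s \<odot> x \<in> Bd d" using BD(6) BdD(1)[OF x] by (simp add: Bd_def)
  assume y: "y \<in> Bd d"
  have "act (mid \<delta>) (x \<oplus> y) = wt \<delta> d \<odot> (x \<oplus> y)" if "\<forall>l\<in>{1..t}. \<delta> l \<noteq> 0" for \<delta>
    using aD(2)[OF that, of x y] BdD[OF x] BdD[OF y] that by (simp add: R.smult_add_right)
  then show "x \<oplus> y \<in> Bd d" using BD(4) BdD(1)[OF x] BdD(1)[OF y] by (simp add: Bd_def)
qed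

text \<open>\<open>\<one>\<close> has degree zero and a generator shifts degrees by its own, so left
  multiplication by elements of \<open>B\<close> preserves the span of the \<open>Bd d\<close>.
  Apply this to \<open>b = b \<otimes> \<one>\<close>.\<close>

lemma B_graded: "B \<subseteq> graded_span R \<Omega> Bd"
proof -
  interpret graded R \<Omega> Bd by unfold_locales (rule Bd_subspace)
  have 1: "\<one> \<in> graded_span R \<Omega> Bd"
    using alg_homD(5)[OF act_hom[OF midG]] BD(2)
    by (intro span_incl[of "\<lambda>_. 0"]) (auto simp: \<Omega>_def Bd_def wt_def)
  have m: "s \<otimes> b \<in> graded_span R \<Omega> Bd" if s: "s \<in> S" and "e \<in> \<Omega>" "b \<in> Bd e" for s e b
  proof -
    obtain d where d: "\<forall>l. l \<notin> {1..t} \<longrightarrow> d l = 0" "\<And>\<delta>. (\<forall>l\<in>{1..t}. \<delta> l \<noteq> 0) \<Longrightarrow>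
        act (mid \<delta>) s = (\<Prod>l\<in>{1..t}. \<delta> l powi d l) \<odot> s"
      using mid_S[OF s] by blast
    have sB: "s \<in> B" "s \<in> carrier R" using S_B[OF s] B_carrier by auto
    show ?thesis
    proof (rule span_incl[of "\<lambda>l. d l + e l"])
      show "(\<lambda>l. d l + e l) \<in> \<Omega>" using d(1) \<open>e \<in> \<Omega>\<close> by (auto simp: \<Omega>_def)
      have b: "b \<in> B" "b \<in> carrier R" using BdD[OF \<open>b \<in> Bd e\<close>] by auto
      have "act (mid \<delta>) (s \<otimes> b) = wt \<delta> (\<lambda>l. d l + e l) \<odot> (s \<otimes> b)" if \<delta>: "\<forall>l\<in>{1..t}. \<delta> l \<noteq> 0" for \<delta>
      proof -
        have "act (mid \<delta>) (s \<otimes> b) = (wt \<delta> d \<odot> s) \<otimes> (wt \<delta> e \<odot> b)"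
          using alg_homD(3)[OF act_hom[OF midG[OF \<delta>]] sB(2) b(2)] d(2)[OF \<delta>] \<open>b \<in> Bd e\<close> \<delta>
          by (simp add: wt_def Bd_def)
        also have "\<dots> = (wt \<delta> d * wt \<delta> e) \<odot> (s \<otimes> b)"
          using sB b by (simp add: R.smult_mult_left R.smult_mult_right R.smult_smult mult.commute)
        also have "wt \<delta> d * wt \<delta> e = wt \<delta> (\<lambda>l. d l + e l)"
          unfolding wt_def prod.distrib[symmetric] using \<delta> by (intro prod.cong) (auto simp: power_int_add)
        finally show ?thesis .
      qed
      then show "s \<otimes> b \<in> Bd (\<lambda>l. d l + e l)" using BD(5)[OF sB(1) b(1)] by (simp add: Bd_def)
    qed
  qed
  have "b \<otimes> \<one> \<in> graded_span R \<Omega> Bd" if "b \<in> B" for b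
    using span_left_closed[OF S_sub m that 1] .
  then show ?thesis using B_carrier by force
qed

text \<open>Conjugation by a unit of \<open>B\<close> scales \<open>Bd d\<close> by \<open>q\<^sup>2\<close> to the power \<open>d l\<close>, up to an element
  of \<open>Gt\<close>. As \<open>q\<close> is not a root of unity, this separates the degrees.\<close>

lemma ideal_mid_invariant:
  assumes I: "ideal I RB" and inv: "\<And>g x. g \<in> Gt \<Longrightarrow> x \<in> I \<Longrightarrow> act g x \<in> I"
    and \<delta>: "\<forall>l\<in>{1..t}. \<delta> l \<noteq> 0" and x: "x \<in> I"
  shows "act (mid \<delta>) x \<in> I"
proof -
  interpret graded R \<Omega> Bd by unfold_locales (rule Bd_subspace)
  note ID = RB_idealD[OF I]
  have "x \<in> graded_span R \<Omega> Bd" using x ID(1) B_graded by auto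
  then obtain W f where W: "finite W" "W \<subseteq> \<Omega>" "\<And>w. w \<in> W \<Longrightarrow> f w \<in> Bd w" "x = (\<Oplus>w\<in>W. f w)"
    by (rule span_repr) blast
  have fc: "f w \<in> carrier R" "f w \<in> B" if "w \<in> W" for w
    using W(3)[OF that] B_carrier by (auto simp: Bd_def)
  \<comment> \<open>\<open>\<mu> l\<close> is the inner scaling that \<open>mid_conj\<close>
    provides; for \<open>l\<close> in \<open>{1..t}\<close> these scalings together see every
    coordinate of a degree.\<close>
  define \<mu> where "\<mu> l = (\<lambda>m::nat. if m = l then q\<^sup>2 else 1)" for l
  have \<mu>: "\<forall>m\<in>{1..t}. \<mu> l m \<noteq> 0" for l using q0 by (auto simp: \<mu>_def)
  define \<Phi> where "\<Phi> = (\<lambda>l. (act (mid (\<mu> l)), wt (\<mu> l))) ` {1..t}"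
  \<comment> \<open>On \<open>B\<close> this scaling is conjugation by a unit of \<open>B\<close>
    followed by an element of \<open>Gt\<close>. The first preserves \<open>I\<close> as an ideal,
    the second by invariance.\<close>
  have st: "act (mid (\<mu> l)) y \<in> I" if l: "l \<in> {1..t}" and y: "y \<in> I" for l y
  proof -
    obtain w w' h where w: "w \<in> B" "w' \<in> B" "h \<in> Gt" "w \<otimes> w' = \<one>" "w' \<otimes> w = \<one>"
      "\<And>s. s \<in> S \<Longrightarrow> act (mid (\<mu> l)) s = act h (w \<otimes> s \<otimes> w')"
      using mid_conj[OF l] unfolding \<mu>_def by blast
    have "act (mid (\<mu> l)) y = act h (w \<otimes> y \<otimes> w')"
    proof (rule hom_eq_on_B[of _ "\<lambda>x. act h (w \<otimes> x \<otimes> w')"])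
      show "alg_hom R R (act (mid (\<mu> l)))" by (rule act_hom[OF midG[OF \<mu>]])
      have "alg_hom R R (\<lambda>x. w \<otimes> x \<otimes> w')" using w B_carrier by (intro conj_hom) auto
      moreover have "alg_hom R R (act h)" using w(3) Gt_sub act_hom by auto
      ultimately show "alg_hom R R (\<lambda>x. act h (w \<otimes> x \<otimes> w'))" by (rule alg_hom_comp)
      show "y \<in> B" using y ID(1) by auto
    qed (use w(6) in simp)
    then show ?thesis using inv[OF w(3) ID(4)[OF w(2) ID(3)[OF w(1) y]]] by simp
  qed
  have "f w \<in> I" if "w \<in> W" for w
  proof (rule R.eigenvectors_mem_subspace[OF ID(2), of \<Phi> W f w])
    show "alg_hom R R \<phi>" if "(\<phi>, \<chi>) \<in> \<Phi>" for \<phi> \<chi>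
      using that act_hom[OF midG[OF \<mu>]] by (auto simp: \<Phi>_def)
    show "\<phi> v \<in> I" if "(\<phi>, \<chi>) \<in> \<Phi>" "v \<in> I" for \<phi> \<chi> v
      using that st by (auto simp: \<Phi>_def)
    show "\<phi> (f v) = \<chi> v \<odot> f v" if "(\<phi>, \<chi>) \<in> \<Phi>" "v \<in> W" for \<phi> \<chi> v
      using that W(3)[OF that(2)] \<mu> by (auto simp: \<Phi>_def Bd_def)
    show "\<exists>(\<phi>, \<chi>)\<in>\<Phi>. \<chi> v \<noteq> \<chi> v'" if vv: "v \<in> W" "v' \<in> W" "v \<noteq> v'" for v v'
    proof -
      obtain l where l: "l \<in> {1..t}" "v l \<noteq> v' l" using \<Omega>_ne vv W(2) by blast
      have "wt (\<mu> l) d = q powi (2 * d l)" for d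
      proof -
        have "wt (\<mu> l) d = (\<Prod>m\<in>{1..t}. if m = l then q powi (2 * d l) else 1)"
          unfolding wt_def by (intro prod.cong) (auto simp: \<mu>_def power_int_mult)
        then show ?thesis using l(1) by simp
      qed
      moreover have "q powi (2 * v l) \<noteq> q powi (2 * v' l)"
        using power_int_inj_not_root_of_unity[OF q0 q_nroot, of "2 * v l" "2 * v' l"] l(2) by auto
      ultimately show ?thesis using l(1) by (auto simp: \<Phi>_def intro!: bexI[of _ l])
    qed
    show "(\<Oplus>w\<in>W. f w) \<in> I" using x unfolding W(4) .
  qed (use W(1) fc(1) that in simp_all)
  \<comment> \<open>Now that the homogeneous components lie in \<open>I\<close>, an arbitrary inner
    scaling only multiplies each of them by a scalar.\<close>
  moreover have "act (mid \<delta>) x = (\<Oplus>w\<in>W. wt \<delta> w \<odot> f w)"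
  proof -
    interpret a: kalg_hom R R "act (mid \<delta>)" by unfold_locales (rule act_hom[OF midG[OF \<delta>]])
    have "act (mid \<delta>) x = (\<Oplus>w\<in>W. act (mid \<delta>) (f w))"
      unfolding W(4) using W(1) fc by (intro a.hom_finsum) auto
    also have "\<dots> = (\<Oplus>w\<in>W. wt \<delta> w \<odot> f w)"
      using fc W(3) \<delta> by (intro R.finsum_cong') (auto simp: Bd_def)
    finally show ?thesis .
  qed
  ultimately show ?thesis
    using W(1) subspaceD(4)[OF ID(2)] by (simp add: R.subspace_finsum[OF ID(2)])
qed

text \<open>Both maps agree on \<open>B\<close> with an element of \<open>Gt\<close> after an inner
  scaling \<open>mid \<delta>\<close>, and \<open>I\<close> is stable under each of the two. The
  second conclusion is what makes left multiplication by \<open>z l e\<close> preserve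
  \<open>ext I\<close>.\<close>

lemma ideal_G_invariant:
  assumes I: "ideal I RB" and inv: "\<And>g x. g \<in> Gt \<Longrightarrow> x \<in> I \<Longrightarrow> act g x \<in> I"
    and x: "x \<in> I"
  shows "g \<in> G \<Longrightarrow> act g x \<in> I" "l \<in> {1..t} \<Longrightarrow> z l e \<otimes> x \<otimes> z l (\<not> e) \<in> I"
proof -
  have *: "\<phi> x \<in> I" if \<phi>: "alg_hom R R \<phi>" and ex: "\<exists>h\<in>Gt. \<exists>\<delta>. (\<forall>l\<in>{1..t}. \<delta> l \<noteq> 0) \<and>
        (\<forall>s\<in>S. \<phi> s = act h (act (mid \<delta>) s))" for \<phi>
  proof -
    from ex obtain h where h0: "h \<in> Gt" "\<exists>\<delta>. (\<forall>l\<in>{1..t}. \<delta> l \<noteq> 0) \<and> (\<forall>s\<in>S. \<phi> s = act h (act (mid \<delta>) s))"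
      by (rule bexE)
    from h0(2) obtain \<delta> where "(\<forall>l\<in>{1..t}. \<delta> l \<noteq> 0) \<and> (\<forall>s\<in>S. \<phi> s = act h (act (mid \<delta>) s))"
      by (rule exE)
    then have h: "h \<in> Gt" "\<forall>l\<in>{1..t}. \<delta> l \<noteq> 0" "\<And>s. s \<in> S \<Longrightarrow> \<phi> s = act h (act (mid \<delta>) s)"
      using h0(1) by simp_all
    have "alg_hom R R (\<lambda>s. act h (act (mid \<delta>) s))"
      using h(1) Gt_sub by (intro alg_hom_comp[OF act_hom[OF midG[OF h(2)]] act_hom]) auto
    from hom_eq_on_B[OF \<phi> this h(3)] have "\<phi> x = act h (act (mid \<delta>) x)"
      using x RB_idealD(1)[OF I] by auto
    then show ?thesis using inv[OF h(1) ideal_mid_invariant[OF I inv h(2) x]] by simp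
  qed
  show "act g x \<in> I" if "g \<in> G" using *[OF act_hom[OF that] act_decomp[OF that]] .
  show "z l e \<otimes> x \<otimes> z l (\<not> e) \<in> I" if "l \<in> {1..t}"
    using *[OF conj_z_hom[OF that] conj_z[OF that]] .
qed


lemma B_kalg: "kalg RB" by (rule R.subalg_kalg[OF B_subalg])

lemma B_idealI:
  assumes "V \<subseteq> B" "subspace R V" "\<And>b x. b \<in> B \<Longrightarrow> x \<in> V \<Longrightarrow> b \<otimes> x \<in> V"
    "\<And>b x. b \<in> B \<Longrightarrow> x \<in> V \<Longrightarrow> x \<otimes> b \<in> V"
  shows "ideal V RB"
proof -
  interpret RB: kalg RB by (rule B_kalg)
  have "subspace RB V" using assms(1,2) unfolding subspace_def by simp
  then show ?thesis using assms(3,4) by (intro RB.subspace_idealI) simp_all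
qed

section \<open>Laurent monomials in the units \<open>z l True\<close>\<close>

definition zact :: "nat \<Rightarrow> int \<Rightarrow> 'a \<Rightarrow> 'a" where
  "zact l k = (if k \<ge> 0 then (\<lambda>x. z l True \<otimes> x) ^^ nat k else (\<lambda>x. z l False \<otimes> x) ^^ nat (- k))"

text \<open>The list of coordinates is a parameter so that one can induct on it. Each coordinate
  contributes iterated left multiplications, by \<open>z l True\<close> or, for a negative exponent,
  by its inverse \<open>z l False\<close>.\<close>

definition zp_on :: "nat list \<Rightarrow> (nat \<Rightarrow> int) \<Rightarrow> 'a" where
  "zp_on ls d = foldr (\<lambda>l. zact l (d l)) ls \<one>"

definition zp :: "(nat \<Rightarrow> int) \<Rightarrow> 'a" where "zp d = zp_on [1..<Suc t] d"

lemma z_mult_closed: "l \<in> {1..t} \<Longrightarrow> x \<in> carrier R \<Longrightarrow> z l e \<otimes> x \<in> carrier R"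
  by (intro R.m_closed z_closed)

lemma z_cancel: "l \<in> {1..t} \<Longrightarrow> x \<in> carrier R \<Longrightarrow> z l e \<otimes> (z l (\<not> e) \<otimes> x) = x"
  using z_inv[of l e] z_closed[of l e] z_closed[of l "\<not> e"] by (simp flip: R.m_assoc)

lemma z_funpow_closed: "l \<in> {1..t} \<Longrightarrow> x \<in> carrier R \<Longrightarrow> ((\<lambda>x. z l e \<otimes> x) ^^ j) x \<in> carrier R"
proof (induction j)
  case (Suc j)
  then show ?case using z_mult_closed[OF Suc.prems(1)] by simp
qed simp

lemma zact_induct:
  assumes "x \<in> carrier R" "P x" "l \<in> {1..t}"
    and step: "\<And>e y. y \<in> carrier R \<Longrightarrow> P y \<Longrightarrow> P (z l e \<otimes> y)"
  shows "zact l k x \<in> carrier R \<and> P (zact l k x)"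
proof -
  have "((\<lambda>x. z l e \<otimes> x) ^^ j) x \<in> carrier R \<and> P (((\<lambda>x. z l e \<otimes> x) ^^ j) x)" for e j
    by (induction j) (simp_all add: assms(1,2) step z_mult_closed[OF assms(3)])
  then show ?thesis by (simp add: zact_def)
qed

lemma zp_on_induct:
  assumes "set ls \<subseteq> {1..t}" "P \<one>"
    and step: "\<And>l e y. l \<in> {1..t} \<Longrightarrow> y \<in> carrier R \<Longrightarrow> P y \<Longrightarrow> P (z l e \<otimes> y)"
  shows "zp_on ls d \<in> carrier R \<and> P (zp_on ls d)"
  using assms(1)
proof (induction ls)
  case Nil
  then show ?case using assms(2) by (simp add: zp_on_def)
next
  case (Cons l ls)
  then have "zact l (d l) (zp_on ls d) \<in> carrier R \<and> P (zact l (d l) (zp_on ls d))"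
    by (intro zact_induct step) auto
  then show ?case by (simp add: zp_on_def)
qed

text \<open>A monomial arises from \<open>\<one>\<close> by left multiplications with the
  \<open>z l e\<close>. Facts that do not mention the exponents, such as normality and being a unit,
  are proved in this way.\<close>

lemma zp_induct:
  assumes "P \<one>" "\<And>l e y. l \<in> {1..t} \<Longrightarrow> y \<in> carrier R \<Longrightarrow> P y \<Longrightarrow> P (z l e \<otimes> y)"
  shows "P (zp d)"
proof -
  have "set [1..<Suc t] \<subseteq> {1..t}" by auto
  from zp_on_induct[OF this, of P d] show ?thesis unfolding zp_def using assms by blast
qed

lemma zp_on_closed: "set ls \<subseteq> {1..t} \<Longrightarrow> zp_on ls d \<in> carrier R"
  using zp_on_induct[of ls "\<lambda>_. True"] by simp

lemma zp_closed: "zp d \<in> carrier R"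
  unfolding zp_def by (intro zp_on_closed) auto

lemma z_zact_same:
  assumes l: "l \<in> {1..t}" and x: "x \<in> carrier R"
  shows "z l e \<otimes> zact l k x = zact l (k + (if e then 1 else -1)) x"
\<comment> \<open>If the step agrees in sign with \<open>k\<close>, where 0 counts as nonnegative,
  one more factor is iterated. Otherwise a factor cancels, except at \<open>k = 0\<close>, where the
  first inverse appears.\<close>
proof (cases "e = (k \<ge> 0)")
  case True
  show ?thesis
  proof (cases e)
    case True
    then have "nat (k + 1) = Suc (nat k)" using \<open>e = (k \<ge> 0)\<close> by simp
    then show ?thesis using True \<open>e = (k \<ge> 0)\<close> by (simp add: zact_def)
  next
    case False
    then have "nat (1 - k) = Suc (nat (- k))" using \<open>e = (k \<ge> 0)\<close> by simp
    then show ?thesis using False \<open>e = (k \<ge> 0)\<close> by (simp add: zact_def)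
  qed
next
  case False
  show ?thesis
  proof (cases "k \<ge> 0")
    case True
    then have e: "\<not> e" using False by simp
    show ?thesis
    proof (cases "k = 0")
      case True
      then show ?thesis using e by (simp add: zact_def)
    next
      case False
      then obtain j where j: "nat k = Suc j" "nat (k - 1) = j" using \<open>k \<ge> 0\<close> by (intro that[of "nat (k - 1)"]) auto
      have "((\<lambda>x. z l True \<otimes> x) ^^ j) x \<in> carrier R" using l x by (rule z_funpow_closed)
      then show ?thesis using e \<open>k \<ge> 0\<close> False j z_cancel[OF l, of _ False] by (simp add: zact_def)
    qed
  next
    case k: False
    then have e: e using False by simp
    obtain j where j: "nat (- k) = Suc j" "nat (- k - 1) = j" using k by (intro that[of "nat (- k - 1)"]) auto
    have c: "((\<lambda>x. z l False \<otimes> x) ^^ j) x \<in> carrier R"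
      using l x by (rule z_funpow_closed)
    have "z l True \<otimes> (z l False \<otimes> ((\<lambda>x. z l False \<otimes> x) ^^ j) x) = ((\<lambda>x. z l False \<otimes> x) ^^ j) x"
      using z_cancel[OF l c, of True] by simp
    moreover have "zact l (k + 1) x = ((\<lambda>x. z l False \<otimes> x) ^^ j) x"
      using k j by (cases "k = -1") (auto simp: zact_def)
    ultimately show ?thesis using e k j(1) by (simp add: zact_def)
  qed
qed

lemma z_zact_other:
  assumes l: "l \<in> {1..t}" "m \<in> {1..t}" and x: "x \<in> carrier R"
  shows "z m e \<otimes> zact l k x = zact l k (z m e \<otimes> x)"
proof -
  have "((\<lambda>x. z l e' \<otimes> x) ^^ j) x \<in> carrier R \<and>
    z m e \<otimes> ((\<lambda>x. z l e' \<otimes> x) ^^ j) x = ((\<lambda>x. z l e' \<otimes> x) ^^ j) (z m e \<otimes> x)" for e' j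
  proof (induction j)
    case (Suc j)
    define y where "y = ((\<lambda>x. z l e' \<otimes> x) ^^ j) x"
    have y: "y \<in> carrier R" using Suc by (simp add: y_def)
    have "z m e \<otimes> (z l e' \<otimes> y) = z l e' \<otimes> (z m e \<otimes> y)"
      using l y z_closed z_comm[OF l(2,1), of e e'] by (simp flip: R.m_assoc)
    then show ?case using Suc l by (simp add: y_def z_mult_closed)
  qed (use x in simp)
  then show ?thesis by (simp add: zact_def)
qed

text \<open>The factor commutes past the other coordinates until it reaches its own; distinctness
  makes that slot unique.\<close>

lemma z_zp_on:
  assumes "distinct ls" "l \<in> set ls" "set ls \<subseteq> {1..t}"
  shows "z l e \<otimes> zp_on ls d = zp_on ls (d(l := d l + (if e then 1 else -1)))"
  using assms
proof (induction ls)
  case (Cons m ls)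
  define d' where "d' = d(l := d l + (if e then 1 else -1))"
  have c: "zp_on ls d \<in> carrier R" using Cons.prems(3) by (intro zp_on_closed) auto
  have m: "m \<in> {1..t}" "l \<in> {1..t}" using Cons.prems by auto
  have u: "zp_on (m # ls) f = zact m (f m) (zp_on ls f)" for f by (simp add: zp_on_def)
  have "z l e \<otimes> zact m (d m) (zp_on ls d) = zact m (d' m) (zp_on ls d')"
  proof (cases "m = l")
    case True
    then have "l \<notin> set ls" using Cons.prems(1) by simp
    then have *: "zp_on ls d' = zp_on ls d"
      unfolding zp_on_def d'_def by (intro foldr_cong) auto
    show ?thesis
      using z_zact_same[OF m(1) c, of e "d m"] unfolding True * by (simp add: d'_def)
  next
    case False
    have IH: "z l e \<otimes> zp_on ls d = zp_on ls d'"
      unfolding d'_def by (rule Cons.IH) (use Cons.prems False in auto)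
    have "d' m = d m" using False by (simp add: d'_def)
    then show ?thesis using z_zact_other[OF m c, of e "d m"] unfolding IH by simp
  qed
  then show ?case unfolding u unfolding d'_def .
qed simp

lemma z_zp:
  "l \<in> {1..t} \<Longrightarrow> z l e \<otimes> zp d = zp (d(l := d l + (if e then 1 else -1)))"
  unfolding zp_def by (intro z_zp_on) auto

lemma zp_zero: "zp (\<lambda>_. 0) = \<one>"
proof -
  have "zp_on ls (\<lambda>_. 0) = \<one>" for ls
    by (induction ls) (simp_all add: zp_on_def zact_def)
  then show ?thesis by (simp add: zp_def)
qed

lemma zp_Units: "zp d \<in> Units R"
proof (rule zp_induct)
  fix l e y assume l: "l \<in> {1..t}" and y: "y \<in> Units R"
  have "z l e \<in> Units R"
    using z_inv[OF l, of e] z_inv[OF l, of "\<not> e"] z_closed[OF l] by (auto simp: Units_def)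
  then show "z l e \<otimes> y \<in> Units R" using y by (rule R.Units_m_closed)
qed simp

text \<open>On the generators of \<open>B\<close>, conjugation by \<open>z l e\<close> is a
  composite of two elements of \<open>G\<close>, and these preserve \<open>B\<close>.\<close>

lemma conj_z_B: "l \<in> {1..t} \<Longrightarrow> b \<in> B \<Longrightarrow> z l e \<otimes> b \<otimes> z l (\<not> e) \<in> B"
proof (rule hom_B[OF conj_z_hom])
  fix s assume l: "l \<in> {1..t}" and s: "s \<in> S"
  from conj_z[OF l, of e] obtain h where h: "h \<in> Gt" "\<exists>\<delta>. (\<forall>l\<in>{1..t}. \<delta> l \<noteq> 0) \<and>
    (\<forall>s\<in>S. z l e \<otimes> s \<otimes> z l (\<not> e) = act h (act (mid \<delta>) s))" by (rule bexE)
  from h(2) obtain \<delta> where d: "(\<forall>l\<in>{1..t}. \<delta> l \<noteq> 0) \<and>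
    (\<forall>s\<in>S. z l e \<otimes> s \<otimes> z l (\<not> e) = act h (act (mid \<delta>) s))" by (rule exE)
  have "act h (act (mid \<delta>) s) \<in> B"
    using d h(1) Gt_sub S_B[OF s] midG by (intro act_B) auto
  then show "z l e \<otimes> s \<otimes> z l (\<not> e) \<in> B" using d s by simp
qed

lemma z_move: "l \<in> {1..t} \<Longrightarrow> b \<in> carrier R \<Longrightarrow> z l e \<otimes> b = (z l e \<otimes> b \<otimes> z l (\<not> e)) \<otimes> z l e"
  using z_inv[of l "\<not> e"] z_closed[of l] by (simp add: R.m_assoc)

text \<open>This lets an element of \<open>B\<close> on the right of a monomial move to its left at
  the price of another element of \<open>B\<close>, as needed to multiply
  \<open>b \<otimes> zp d\<close> from the right.\<close>

lemma zp_normal: "\<forall>b\<in>B. \<exists>b'\<in>B. zp d \<otimes> b = b' \<otimes> zp d"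
proof (rule zp_induct)
  show "\<forall>b\<in>B. \<exists>b'\<in>B. \<one> \<otimes> b = b' \<otimes> \<one>" using B_carrier by auto
next
  fix l e y assume l: "l \<in> {1..t}" and y: "y \<in> carrier R" and IH: "\<forall>b\<in>B. \<exists>b'\<in>B. y \<otimes> b = b' \<otimes> y"
  show "\<forall>b\<in>B. \<exists>b'\<in>B. z l e \<otimes> y \<otimes> b = b' \<otimes> (z l e \<otimes> y)"
  proof
    fix b assume b: "b \<in> B"
    obtain b' where b': "b' \<in> B" "y \<otimes> b = b' \<otimes> y" using IH b by blast
    note c = B_carrier[OF b] B_carrier[OF b'(1)] z_closed[OF l] y
    have "z l e \<otimes> y \<otimes> b = z l e \<otimes> b' \<otimes> y" using b'(2) c by (simp add: R.m_assoc)
    also have "\<dots> = (z l e \<otimes> b' \<otimes> z l (\<not> e)) \<otimes> z l e \<otimes> y" using z_move[OF l c(2)] by simp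
    also have "\<dots> = (z l e \<otimes> b' \<otimes> z l (\<not> e)) \<otimes> (z l e \<otimes> y)" using c by (simp add: R.m_assoc)
    finally show "\<exists>b'\<in>B. z l e \<otimes> y \<otimes> b = b' \<otimes> (z l e \<otimes> y)"
      using conj_z_B[OF l b'(1)] by blast
  qed
qed

lemma zp_comm:
  assumes m: "m \<in> {1..t}" shows "zp d \<otimes> z m e' = z m e' \<otimes> zp d"
proof (rule zp_induct)
  fix l e y assume l: "l \<in> {1..t}" and y: "y \<in> carrier R" and IH: "y \<otimes> z m e' = z m e' \<otimes> y"
  note c = z_closed[OF m, of e'] z_closed[OF l, of e]
  have "z l e \<otimes> y \<otimes> z m e' = z l e \<otimes> z m e' \<otimes> y" using c y IH by (simp add: R.m_assoc)
  also have "\<dots> = z m e' \<otimes> (z l e \<otimes> y)" using c y z_comm[OF l m] by (simp add: R.m_assoc)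
  finally show "z l e \<otimes> y \<otimes> z m e' = z m e' \<otimes> (z l e \<otimes> y)" .
qed (use z_closed[OF m] in simp)

lemma act_zp:
  assumes g: "g \<in> G" shows "\<exists>\<kappa>. act g (zp d) = \<kappa> \<odot> zp d"
proof (rule zp_induct)
  show "\<exists>\<kappa>. act g \<one> = \<kappa> \<odot> \<one>" using alg_homD(5)[OF act_hom[OF g]] by (intro exI[of _ 1]) simp
next
  fix l e y assume l: "l \<in> {1..t}" and y: "y \<in> carrier R" and IH: "\<exists>\<kappa>. act g y = \<kappa> \<odot> y"
  obtain \<kappa> where k: "act g y = \<kappa> \<odot> y" using IH by blast
  obtain \<mu> where k': "act g (z l e) = \<mu> \<odot> z l e" using act_z[OF g l] by blast
  have "act g (z l e \<otimes> y) = (\<mu> * \<kappa>) \<odot> (z l e \<otimes> y)"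
    using alg_homD(3)[OF act_hom[OF g] z_closed[OF l] y] k k' y z_closed[OF l, of e]
    by (simp add: R.smult_mult_left R.smult_mult_right R.smult_smult mult.commute)
  then show "\<exists>\<kappa>. act g (z l e \<otimes> y) = \<kappa> \<odot> (z l e \<otimes> y)" by blast
qed

text \<open>The element from \<open>tau\<close> multiplies \<open>z l True\<close> by
  \<open>q\<close> and its inverse by \<open>inverse q\<close>, so the eigenvalue on a monomial
  reads off the exponent of coordinate \<open>l\<close>, whatever its sign.\<close>

lemma tau_zp:
  assumes l: "l \<in> {1..t}"
  obtains g where "g \<in> G" "\<And>b. b \<in> B \<Longrightarrow> act g b = b" "\<And>d. act g (zp d) = (q powi d l) \<odot> zp d"
proof -
  from tau[OF l] obtain g where g: "g \<in> G" "(\<forall>s\<in>S. act g s = s) \<and>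
        (\<forall>m\<in>{1..t}. act g (z m True) = (if m = l then q else 1) \<odot> z m True \<and>
                     act g (z m False) = (if m = l then inverse q else 1) \<odot> z m False)" by (rule bexE)
  note aD = alg_homD[OF act_hom[OF g(1)]]
  have B: "act g b = b" if "b \<in> B" for b
    using g(2) by (intro hom_eq_on_B[OF act_hom[OF g(1)] alg_hom_id _ that]) simp
  have zz: "act g (z m e) = (if m = l then if e then q else inverse q else 1) \<odot> z m e"
    if "m \<in> {1..t}" for m e using g(2) that by (cases e) auto
  have st: "act g (z m e \<otimes> y) = ((if m = l then if e then q else inverse q else 1) * \<kappa>) \<odot> (z m e \<otimes> y)"
    if "m \<in> {1..t}" "y \<in> carrier R" "act g y = \<kappa> \<odot> y" for m e y \<kappa>
    using aD(3)[OF z_closed[OF that(1)] that(2)] zz[OF that(1)] that(2,3) z_closed[OF that(1), of e]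
    by (simp add: R.smult_mult_left R.smult_mult_right R.smult_smult mult.commute)
  have pw: "((\<lambda>x. z m e \<otimes> x) ^^ j) y \<in> carrier R \<and> act g (((\<lambda>x. z m e \<otimes> x) ^^ j) y)
      = ((if m = l then if e then q else inverse q else 1) ^ j * \<kappa>) \<odot> ((\<lambda>x. z m e \<otimes> x) ^^ j) y"
    if "m \<in> {1..t}" "y \<in> carrier R" "act g y = \<kappa> \<odot> y" for m e y \<kappa> j
  proof (induction j)
    case (Suc j)
    then show ?case using st[OF that(1), of "((\<lambda>x. z m e \<otimes> x) ^^ j) y"] that(1)
      by (simp add: z_mult_closed mult.assoc)
  qed (use that in simp)
  have za: "act g (zact m k y) = ((if m = l then q powi k else 1) * \<kappa>) \<odot> zact m k y"
    if "m \<in> {1..t}" "y \<in> carrier R" "act g y = \<kappa> \<odot> y" for m y \<kappa> k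
    using pw[OF that, where e = True and j = "nat k"] pw[OF that, where e = False and j = "nat (- k)"]
    by (simp add: zact_def power_int_def)
  have "act g (zp_on ls d) = (if l \<in> set ls then q powi d l else 1) \<odot> zp_on ls d"
    if "distinct ls" "set ls \<subseteq> {1..t}" for ls d using that
  proof (induction ls)
    case Nil
    then show ?case using aD(5) by (simp add: zp_on_def)
  next
    case (Cons m ls)
    have c: "zp_on ls d \<in> carrier R" using Cons.prems(2) by (intro zp_on_closed) auto
    have "act g (zp_on ls d) = (if l \<in> set ls then q powi d l else 1) \<odot> zp_on ls d" using Cons by simp
    from za[OF _ c this, of m "d m"] Cons.prems show ?case by (auto simp: zp_on_def)
  qed
  then have "act g (zp d) = (q powi d l) \<odot> zp d" for d
  proof -
    have "set [1..<Suc t] \<subseteq> {1..t}" "l \<in> set [1..<Suc t]" using l by auto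
    with \<open>\<And>ls d. _ \<Longrightarrow> _ \<Longrightarrow> act g (zp_on ls d) = _\<close>[of "[1..<Suc t]" d] show ?thesis
      unfolding zp_def by (simp only: distinct_upt if_True)
  qed
  then show ?thesis using that[OF g(1) B] by blast
qed

section \<open>Extension of ideals from B to R\<close>

definition E :: "'a set \<Rightarrow> (nat \<Rightarrow> int) \<Rightarrow> 'a set" where "E V d = {b \<otimes> zp d |b. b \<in> V}"

text \<open>For a \<open>Gt\<close>-invariant ideal \<open>V\<close> of \<open>B\<close> this turns
  out to be the ideal of \<open>R\<close> generated by \<open>V\<close>. The coefficients from
  \<open>V\<close> stand to the left of the monomials.\<close>

definition ext :: "'a set \<Rightarrow> 'a set" where "ext V = graded_span R \<Omega> (E V)"

lemma E_subspace:
  assumes "subspace R V" shows "subspace R (E V d)"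
  unfolding subspace_def
proof (intro conjI ballI allI)
  note VD = subspaceD[OF assms]
  show "E V d \<subseteq> carrier R" using VD(1) zp_closed by (auto simp: E_def)
  have "\<zero> = \<zero> \<otimes> zp d" using zp_closed by simp
  then show "\<zero> \<in> E V d" using VD(2) unfolding E_def by blast
  fix x y s assume "x \<in> E V d"
  then obtain b where b: "b \<in> V" "x = b \<otimes> zp d" by (auto simp: E_def)
  have "s \<odot> x = (s \<odot> b) \<otimes> zp d" using b VD(1) zp_closed by (simp add: R.smult_mult_left)
  then show "s \<odot> x \<in> E V d" using VD(4)[OF b(1)] unfolding E_def by blast
  assume "y \<in> E V d"
  then obtain b' where b': "b' \<in> V" "y = b' \<otimes> zp d" by (auto simp: E_def)
  have "x \<oplus> y = (b \<oplus> b') \<otimes> zp d" using b b' VD(1) zp_closed by (simp add: R.l_distr)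
  then show "x \<oplus> y \<in> E V d" using VD(3)[OF b(1) b'(1)] unfolding E_def by blast
qed

lemma ext_graded: "subspace R V \<Longrightarrow> graded R \<Omega> (E V)"
  by unfold_locales (rule E_subspace)

lemma \<Omega>_upd: "d \<in> \<Omega> \<Longrightarrow> l \<in> {1..t} \<Longrightarrow> d(l := k) \<in> \<Omega>"
  by (auto simp: \<Omega>_def)

lemma gens_sub: "S \<union> {z l e |l e. l \<in> {1..t}} \<subseteq> carrier R"
  using S_sub z_closed by auto

lemma E_in_ext: "subspace R V \<Longrightarrow> d \<in> \<Omega> \<Longrightarrow> b \<in> V \<Longrightarrow> b \<otimes> zp d \<in> ext V"
  unfolding ext_def by (rule graded.span_incl[OF ext_graded, of V d]) (auto simp: E_def)

text \<open>Moving \<open>z l e\<close> past a coefficient conjugates that coefficient, which is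
  where stability under conjugation is used; afterwards it only shifts the exponent of the
  monomial.\<close>

lemma ext_left:
  assumes V: "subspace R V" and l: "\<And>b x. b \<in> B \<Longrightarrow> x \<in> V \<Longrightarrow> b \<otimes> x \<in> V"
    and c: "\<And>l e x. l \<in> {1..t} \<Longrightarrow> x \<in> V \<Longrightarrow> z l e \<otimes> x \<otimes> z l (\<not> e) \<in> V"
    and a: "a \<in> carrier R" and x: "x \<in> ext V"
  shows "a \<otimes> x \<in> ext V"
proof -
  interpret graded R \<Omega> "E V" by (rule ext_graded[OF V])
  have "s \<otimes> y \<in> ext V" if s: "s \<in> S \<union> {z l e |l e. l \<in> {1..t}}" and d: "d \<in> \<Omega>" "y \<in> E V d" for s d y
  proof -
    obtain b where b: "b \<in> V" "y = b \<otimes> zp d" using d(2) by (auto simp: E_def)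
    have bc: "b \<in> carrier R" using subspaceD(1)[OF V b(1)] .
    consider "s \<in> S" | l e where "l \<in> {1..t}" "s = z l e" using s by auto
    then show ?thesis
    proof cases
      case 1
      have "s \<otimes> y = (s \<otimes> b) \<otimes> zp d"
        using b(2) bc zp_closed 1 S_sub by (auto simp: R.m_assoc)
      then show ?thesis using E_in_ext[OF V d(1) l[OF S_B[OF 1] b(1)]] by simp
    next
      case 2
      have "s \<otimes> y = (z l e \<otimes> b) \<otimes> zp d"
        using b(2) bc zp_closed 2 z_closed[OF 2(1)] by (simp add: R.m_assoc)
      also have "\<dots> = (z l e \<otimes> b \<otimes> z l (\<not> e)) \<otimes> z l e \<otimes> zp d" using z_move[OF 2(1) bc] by simp
      also have "\<dots> = (z l e \<otimes> b \<otimes> z l (\<not> e)) \<otimes> (z l e \<otimes> zp d)"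
        using bc zp_closed z_closed[OF 2(1)] by (simp add: R.m_assoc)
      finally show ?thesis
        unfolding z_zp[OF 2(1)] using E_in_ext[OF V \<Omega>_upd[OF d(1) 2(1)] c[OF 2(1) b(1)]] by simp
    qed
  qed
  then show ?thesis
    using span_left_closed[OF gens_sub, of a x] a x gen unfolding ext_def by simp
qed

text \<open>From the right a generator of \<open>B\<close> passes the monomial by
  \<open>zp_normal\<close> and multiplies the coefficient, while \<open>z l e\<close> commutes with
  the monomial and shifts an exponent.\<close>

lemma ext_right:
  assumes V: "subspace R V" and r: "\<And>b x. b \<in> B \<Longrightarrow> x \<in> V \<Longrightarrow> x \<otimes> b \<in> V"
    and a: "a \<in> carrier R" and x: "x \<in> ext V"
  shows "x \<otimes> a \<in> ext V"
proof -
  interpret graded R \<Omega> "E V" by (rule ext_graded[OF V])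
  have "y \<otimes> s \<in> ext V" if s: "s \<in> S \<union> {z l e |l e. l \<in> {1..t}}" and d: "d \<in> \<Omega>" "y \<in> E V d" for s d y
  proof -
    obtain b where b: "b \<in> V" "y = b \<otimes> zp d" using d(2) by (auto simp: E_def)
    have bc: "b \<in> carrier R" using subspaceD(1)[OF V b(1)] .
    consider "s \<in> S" | l e where "l \<in> {1..t}" "s = z l e" using s by auto
    then show ?thesis
    proof cases
      case 1
      obtain s' where s': "s' \<in> B" "zp d \<otimes> s = s' \<otimes> zp d" using zp_normal[of d] S_B[OF 1] by blast
      have "y \<otimes> s = (b \<otimes> s') \<otimes> zp d"
        using b(2) bc zp_closed s' B_carrier[OF s'(1)] B_carrier[OF S_B[OF 1]] by (simp add: R.m_assoc)
      then show ?thesis using E_in_ext[OF V d(1) r[OF s'(1) b(1)]] by simp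
    next
      case 2
      have "y \<otimes> s = b \<otimes> (z l e \<otimes> zp d)"
        using b(2) bc zp_closed 2 z_closed[OF 2(1)] zp_comm[OF 2(1)] by (simp add: R.m_assoc)
      then show ?thesis
        unfolding z_zp[OF 2(1)] using E_in_ext[OF V \<Omega>_upd[OF d(1) 2(1)] b(1)] by simp
    qed
  qed
  then show ?thesis
    using span_right_closed[OF gens_sub, of a x] a x gen unfolding ext_def by simp
qed

text \<open>\<open>ext B\<close> contains \<open>\<one>\<close> and is stable under left
  multiplication by \<open>R\<close>. So R is the sum of the spaces B z^d.\<close>

lemma ext_B: "ext B = carrier R"
proof -
  note BS = subalg_subspace[OF B_subalg]
  have "(\<lambda>_. 0) \<in> \<Omega>" by (simp add: \<Omega>_def)
  then have "\<one> \<in> ext B" using E_in_ext[OF BS _ BD(2), of "\<lambda>_. 0"] by (simp add: zp_zero)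
  have "a \<otimes> \<one> \<in> ext B" if "a \<in> carrier R" for a
    using BS BD(5) conj_z_B that \<open>\<one> \<in> ext B\<close> by (rule ext_left)
  then have "a \<in> ext B" if "a \<in> carrier R" for a using that by (metis R.r_one)
  then show ?thesis using graded.span_carrier[OF ext_graded[OF BS]] by (auto simp: ext_def)
qed


lemma Gt_inv_ideal_stable:
  assumes "ideal I RB" "\<And>g x. g \<in> Gt \<Longrightarrow> x \<in> I \<Longrightarrow> act g x \<in> I"
  shows "subspace R I" "I \<subseteq> B" "\<And>b x. b \<in> B \<Longrightarrow> x \<in> I \<Longrightarrow> b \<otimes> x \<in> I"
    "\<And>b x. b \<in> B \<Longrightarrow> x \<in> I \<Longrightarrow> x \<otimes> b \<in> I"
    "\<And>g x. g \<in> G \<Longrightarrow> x \<in> I \<Longrightarrow> act g x \<in> I"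
    "\<And>l e x. l \<in> {1..t} \<Longrightarrow> x \<in> I \<Longrightarrow> z l e \<otimes> x \<otimes> z l (\<not> e) \<in> I"
  using RB_idealD[OF assms(1)] ideal_G_invariant[OF assms] by simp_all

lemma ext_ideal:
  assumes "ideal I RB" "\<And>g x. g \<in> Gt \<Longrightarrow> x \<in> I \<Longrightarrow> act g x \<in> I"
  shows "ideal (ext I) R"
proof (rule R.subspace_idealI)
  note st = Gt_inv_ideal_stable[OF assms]
  show "subspace R (ext I)"
    unfolding ext_def by (rule graded.span_subspace[OF ext_graded[OF st(1)]])
  show "a \<otimes> x \<in> ext I" if "a \<in> carrier R" "x \<in> ext I" for a x
    using st(1,3,6) that by (rule ext_left)
  show "x \<otimes> a \<in> ext I" if "a \<in> carrier R" "x \<in> ext I" for a x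
    using st(1,4) that by (rule ext_right)
qed

text \<open>A group element preserves \<open>I\<close>, by the invariance gained from homogeneity,
  and multiplies each monomial by a scalar.\<close>

lemma ext_invariant:
  assumes "ideal I RB" "\<And>g x. g \<in> Gt \<Longrightarrow> x \<in> I \<Longrightarrow> act g x \<in> I"
    and g: "g \<in> G" and x: "x \<in> ext I"
  shows "act g x \<in> ext I"
proof -
  note st = Gt_inv_ideal_stable[OF assms(1,2)]
  interpret graded R \<Omega> "E I" by (rule ext_graded[OF st(1)])
  interpret a: kalg_hom R R "act g" by unfold_locales (rule act_hom[OF g])
  show ?thesis
    using x unfolding ext_def
  proof (rule span_map)
    fix d y assume d: "d \<in> \<Omega>" "y \<in> E I d"
    then obtain b where b: "b \<in> I" "y = b \<otimes> zp d" by (auto simp: E_def)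
    obtain \<kappa> where k: "act g (zp d) = \<kappa> \<odot> zp d" using act_zp[OF g] by blast
    have gI: "act g b \<in> I" using assms(1,2) g b(1) by (rule Gt_inv_ideal_stable(5))
    have c: "b \<in> carrier R" "act g b \<in> I" "act g b \<in> carrier R"
      using subspaceD(1)[OF st(1)] gI b(1) by auto
    have "act g y = (\<kappa> \<odot> act g b) \<otimes> zp d"
      using b(2) c zp_closed k by (simp add: a.hom_mult R.smult_mult_left R.smult_mult_right)
    then show "act g y \<in> graded_span R \<Omega> (E I)"
      using E_in_ext[OF st(1) d(1) subspaceD(4)[OF st(1) c(2)]] by (simp add: ext_def)
  qed (simp_all add: a.hom_add)
qed

text \<open>The automorphisms from \<open>tau\<close> fix \<open>B\<close> and separate the summands \<open>B z\<^sup>d\<close>.\<close>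

lemma tau_separation:
  assumes V: "subspace R V" and inv: "\<And>g x. g \<in> G \<Longrightarrow> x \<in> V \<Longrightarrow> act g x \<in> V"
    and W: "finite W" "W \<subseteq> \<Omega>" "\<And>w. w \<in> W \<Longrightarrow> f w \<in> E B w" "(\<Oplus>w\<in>W. f w) \<in> V" "w \<in> W"
  shows "f w \<in> V"
proof -
  \<comment> \<open>Each automorphism is paired with its eigenvalue as a function of the degree.
    Letting \<open>l\<close> run through \<open>{1..t}\<close> separates any two degrees.\<close>
  define \<Phi> where "\<Phi> = {(act g, \<lambda>d. q powi d l) |g l. l \<in> {1..t} \<and> g \<in> G \<and> (\<forall>b\<in>B. act g b = b) \<and> (\<forall>d. act g (zp d) = (q powi d l) \<odot> zp d)}"
  have fc: "f w \<in> carrier R" if "w \<in> W" for w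
    using W(3)[OF that] subspaceD(1)[OF E_subspace[OF subalg_subspace[OF B_subalg]]] by blast
  show ?thesis
  proof (rule R.eigenvectors_mem_subspace[OF V, of \<Phi> W f w])
    show "alg_hom R R \<phi>" if "(\<phi>, \<chi>) \<in> \<Phi>" for \<phi> \<chi>
      using that act_hom by (auto simp: \<Phi>_def)
    show "\<phi> v \<in> V" if "(\<phi>, \<chi>) \<in> \<Phi>" "v \<in> V" for \<phi> \<chi> v
      using that inv by (auto simp: \<Phi>_def)
    show "\<phi> (f v) = \<chi> v \<odot> f v" if ph: "(\<phi>, \<chi>) \<in> \<Phi>" and v: "v \<in> W" for \<phi> \<chi> v
    proof -
      from ph obtain g l where g: "\<phi> = act g" "\<chi> = (\<lambda>d. q powi d l)" "g \<in> G" "\<forall>b\<in>B. act g b = b"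
        "\<forall>d. act g (zp d) = (q powi d l) \<odot> zp d" by (auto simp: \<Phi>_def)
      obtain b where b: "b \<in> B" "f v = b \<otimes> zp v" using W(3)[OF v] by (auto simp: E_def)
      have "act g (b \<otimes> zp v) = act g b \<otimes> act g (zp v)"
        using B_carrier[OF b(1)] zp_closed by (intro alg_homD(3)[OF act_hom[OF g(3)]])
      also have "\<dots> = (q powi v l) \<odot> (b \<otimes> zp v)"
        using g(4,5) b(1) B_carrier[OF b(1)] zp_closed by (simp add: R.smult_mult_right)
      finally show ?thesis by (simp add: g(1,2) b(2))
    qed
    show "\<exists>(\<phi>, \<chi>)\<in>\<Phi>. \<chi> v \<noteq> \<chi> v'" if vv: "v \<in> W" "v' \<in> W" "v \<noteq> v'" for v v'
    proof -
      obtain l where l: "l \<in> {1..t}" "v l \<noteq> v' l" using \<Omega>_ne[of v v'] vv W(2) by blast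
      obtain g where g: "g \<in> G" "\<And>b. b \<in> B \<Longrightarrow> act g b = b" "\<And>d. act g (zp d) = (q powi d l) \<odot> zp d"
        using tau_zp[OF l(1)] by blast
      have "(act g, \<lambda>d. q powi d l) \<in> \<Phi>" using g l(1) unfolding \<Phi>_def by blast
      moreover have "q powi v l \<noteq> q powi v' l"
        using power_int_inj_not_root_of_unity[OF q0 q_nroot, of "v l" "v' l"] l(2) by auto
      ultimately show ?thesis by (auto intro!: bexI[of _ "(act g, \<lambda>d. q powi d l)"])
    qed
  qed (use W(1,4,5) fc in simp_all)
qed

lemma E_mono: "V \<subseteq> V' \<Longrightarrow> E V d \<subseteq> E V' d"
  by (auto simp: E_def)

text \<open>An element x of B that is a sum of terms b_d z^d with coefficients in \<open>I\<close>
  has to equal its coefficient b_0: otherwise it would have two different expressions in the sum of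
  the spaces B z^d, whose directness is \<open>tau_separation\<close> for the zero subspace.\<close>

lemma ext_Int_B:
  assumes "ideal I RB" "\<And>g x. g \<in> Gt \<Longrightarrow> x \<in> I \<Longrightarrow> act g x \<in> I"
  shows "ext I \<inter> B = I"
proof (intro equalityI subsetI)
  note st = Gt_inv_ideal_stable[OF assms]
  interpret graded R \<Omega> "E I" by (rule ext_graded[OF st(1)])
  have z0: "(\<lambda>_. 0) \<in> \<Omega>" by (simp add: \<Omega>_def)
  show "x \<in> ext I \<inter> B" if "x \<in> I" for x
    using E_in_ext[OF st(1) z0 that] that st(2) B_carrier by (auto simp: zp_zero)
  fix x assume x: "x \<in> ext I \<inter> B"
  define o0 where "o0 = (\<lambda>_::nat. 0::int)"
  obtain W f where W: "finite W" "W \<subseteq> \<Omega>" "\<And>w. w \<in> W \<Longrightarrow> f w \<in> E I w" "x = (\<Oplus>w\<in>W. f w)"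
    using x unfolding ext_def by (blast elim: span_repr)
  have fc: "f w \<in> carrier R" if "w \<in> W" for w using W(3)[OF that] W(2) that D_carrier by blast
  \<comment> \<open>The coefficient of degree zero, with default \<open>\<zero>\<close> if that
    degree does not occur. The monomial of degree zero is \<open>\<one>\<close>, so \<open>y\<close>
    itself lies in \<open>I\<close>.\<close>
  define y where "y = (if o0 \<in> W then f o0 else \<zero>)"
  have xc: "x \<in> B" "x \<in> carrier R" using x B_carrier by auto
  have yI: "y \<in> I"
    using W(3)[of o0] subspaceD(2)[OF st(1)] subspaceD(1)[OF st(1)]
    by (auto simp: y_def E_def o0_def zp_zero)
  have yc: "y \<in> carrier R" using yI subspaceD(1)[OF st(1)] by simp
  define s where "s = (\<Oplus>w\<in>W - {o0}. f w)"
  have sc: "s \<in> carrier R" using fc unfolding s_def by (intro R.finsum_closed) auto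
  have xs: "x = y \<oplus> s"
  proof (cases "o0 \<in> W")
    case True
    then have "x = (\<Oplus>w\<in>insert o0 (W - {o0}). f w)" using W(4) by (simp add: insert_absorb)
    also have "\<dots> = f o0 \<oplus> s" unfolding s_def using W(1) fc True by (intro R.finsum_insert) auto
    finally show ?thesis using True by (simp add: y_def)
  next
    case False
    then show ?thesis using W(4) sc by (simp add: y_def s_def)
  qed
  \<comment> \<open>Both expressions of \<open>x\<close> are moved to one side: the term of degree
    zero becomes \<open>y \<ominus> x\<close>, and the total is zero.\<close>
  define g where "g = (\<lambda>w. if w = o0 then y \<ominus> x else f w)"
  have sg: "(\<Oplus>w\<in>insert o0 (W - {o0}). g w) = (y \<ominus> x) \<oplus> s"
  proof -
    have "(\<Oplus>w\<in>W - {o0}. g w) = s" unfolding s_def using fc by (intro R.finsum_cong') (auto simp: g_def)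
    moreover have "(\<Oplus>w\<in>insert o0 (W - {o0}). g w) = g o0 \<oplus> (\<Oplus>w\<in>W - {o0}. g w)"
      using W(1) fc xc yc by (intro R.finsum_insert) (auto simp: g_def)
    ultimately show ?thesis by (simp add: g_def)
  qed
  also have "\<dots> = \<zero>"
  proof -
    have "y \<ominus> x = \<ominus> s" unfolding xs using yc sc by (simp add: R.minus_eq R.minus_add R.r_neg2)
    then show ?thesis using sc by (simp add: R.l_neg)
  qed
  finally have "(\<Oplus>w\<in>insert o0 (W - {o0}). g w) \<in> {\<zero>}" by simp
  \<comment> \<open>A vanishing sum of terms of distinct degrees has only vanishing terms.\<close>
  then have "g o0 \<in> {\<zero>}"
  proof (rule tau_separation[OF R.subspace_zero, rotated 4])
    show "g w \<in> E B w" if "w \<in> insert o0 (W - {o0})" for w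
    proof (cases "w = o0")
      case True
      have "y \<ominus> x \<in> B" using R.subspace_minus[OF subalg_subspace[OF B_subalg]] yI st(2) xc by auto
      moreover have "y \<ominus> x = (y \<ominus> x) \<otimes> zp o0" using yc xc by (simp add: o0_def zp_zero)
      ultimately show ?thesis using True unfolding g_def E_def by auto
    next
      case False
      then show ?thesis using W(3) that E_mono[OF st(2)] by (auto simp: g_def)
    qed
    show "act h v \<in> {\<zero>}" if "h \<in> G" "v \<in> {\<zero>}" for h v
    proof -
      interpret a: kalg_hom R R "act h" by unfold_locales (rule act_hom[OF that(1)])
      show ?thesis using that(2) by simp
    qed
  qed (use W(1,2) z0 in \<open>auto simp: o0_def\<close>)
  then have "y = x" using yc xc by (simp add: g_def)
  then show "x \<in> I" using yI by simp
qed

section \<open>Contraction of invariant ideals and the correspondence of primes\<close>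

lemma contract_ideal:
  assumes J: "ideal J R" and inv: "\<And>g x. g \<in> G \<Longrightarrow> x \<in> J \<Longrightarrow> act g x \<in> J"
  shows "ideal (J \<inter> B) RB" "\<And>g x. g \<in> G \<Longrightarrow> x \<in> J \<inter> B \<Longrightarrow> act g x \<in> J \<inter> B"
    "ext (J \<inter> B) = J"
proof -
  interpret J: ideal J R by fact
  note JS = subspaceD[OF R.ideal_subspace[OF J]]
  have V: "subspace R (J \<inter> B)"
    using JS BD(1,3,4,6) unfolding subspace_def by auto
  show "ideal (J \<inter> B) RB"
    using V BD(5) J.I_l_closed J.I_r_closed B_carrier by (intro B_idealI) auto
  show "act g x \<in> J \<inter> B" if "g \<in> G" "x \<in> J \<inter> B" for g x
    using that inv act_B by auto
  show "ext (J \<inter> B) = J"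
  proof (intro equalityI subsetI)
    interpret graded R \<Omega> "E (J \<inter> B)" by (rule ext_graded[OF V])
    fix x
    { assume "x \<in> ext (J \<inter> B)"
      then obtain W f where W: "finite W" "W \<subseteq> \<Omega>" "\<And>w. w \<in> W \<Longrightarrow> f w \<in> E (J \<inter> B) w" "x = (\<Oplus>w\<in>W. f w)"
        unfolding ext_def by (blast elim: span_repr)
      have "f w \<in> J" if "w \<in> W" for w
        using W(3)[OF that] J.I_r_closed zp_closed by (auto simp: E_def)
      then show "x \<in> J" unfolding W(4) using W(1) by (intro R.subspace_finsum R.ideal_subspace[OF J]) }
    assume x: "x \<in> J"
    interpret gB: graded R \<Omega> "E B" by (rule ext_graded[OF subalg_subspace[OF B_subalg]])
    have "x \<in> graded_span R \<Omega> (E B)" using x JS(1) ext_B unfolding ext_def by auto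
    then obtain W f where W: "finite W" "W \<subseteq> \<Omega>" "\<And>w. w \<in> W \<Longrightarrow> f w \<in> E B w" "x = (\<Oplus>w\<in>W. f w)"
      by (blast elim: gB.span_repr)
    \<comment> \<open>By invariance \<open>J\<close> contains each term b z^d of its elements;
      cancelling the unit z^d puts b into \<open>J \<inter> B\<close>.\<close>
    have "f w \<in> ext (J \<inter> B)" if w: "w \<in> W" for w
    proof -
      have fJ: "f w \<in> J"
        using R.ideal_subspace[OF J] inv W(1,2,3) x[unfolded W(4)] w by (rule tau_separation)
      obtain b where b: "b \<in> B" "f w = b \<otimes> zp w" using W(3)[OF w] by (auto simp: E_def)
      have "f w \<otimes> inv (zp w) = b"
        using b B_carrier zp_closed zp_Units[of w] by (simp add: R.m_assoc)
      moreover have "f w \<otimes> inv (zp w) \<in> J"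
        using fJ zp_Units by (intro J.I_r_closed) auto
      ultimately have "b \<in> J \<inter> B" using b(1) by simp
      then show ?thesis using E_in_ext[OF V _ \<open>b \<in> J \<inter> B\<close>, of w] W(2) w b(2) by auto
    qed
    then show "x \<in> ext (J \<inter> B)"
      unfolding W(4) ext_def using W(1) by (intro R.subspace_finsum span_subspace)
  qed
qed

lemma ext_mono:
  assumes "V \<subseteq> V'" shows "ext V \<subseteq> ext V'"
proof
  fix x assume "x \<in> ext V"
  then show "x \<in> ext V'" unfolding ext_def
    by (induction rule: graded_span.induct) (use E_mono[OF assms] in \<open>auto intro: graded_span.intros\<close>)
qed

text \<open>A sum of products formed in \<open>B\<close> is also one in \<open>R\<close>. This
  inclusion carries the primeness of \<open>P\<close> over to \<open>ext P\<close>.\<close>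

lemma ideal_prod_contract: "(I \<inter> B) \<cdot>\<^bsub>RB\<^esub> (J \<inter> B) \<subseteq> (I \<cdot>\<^bsub>R\<^esub> J) \<inter> B"
proof
  fix x assume "x \<in> (I \<inter> B) \<cdot>\<^bsub>RB\<^esub> (J \<inter> B)"
  then show "x \<in> (I \<cdot>\<^bsub>R\<^esub> J) \<inter> B"
    by (induction rule: ideal_prod.induct) (auto intro: ideal_prod.intros BD(4,5))
qed

text \<open>\<open>ext P\<close> is the required prime, and any other candidate satisfies
  \<open>Q = ext (Q \<inter> B)\<close>. The groups enter only through their carriers, since
  \<open>G_prime\<close> refers to nothing else of them.\<close>

theorem unique_G_prime_over:
  fixes GG :: "('g, 'y) monoid_scheme" and GT :: "('g, 'x) monoid_scheme"
  assumes GG: "carrier GG = G" and GT: "carrier GT = Gt" and P: "G_prime GT act RB P"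
  shows "\<exists>!Q. G_prime GG act R Q \<and> Q \<inter> B = P"
proof -
  have Pi: "ideal P RB" "\<And>g x. g \<in> Gt \<Longrightarrow> x \<in> P \<Longrightarrow> act g x \<in> P" "P \<noteq> B"
    and Pp: "\<And>I J. invariant_ideal GT act RB I \<Longrightarrow> invariant_ideal GT act RB J \<Longrightarrow>
        I \<cdot>\<^bsub>RB\<^esub> J \<subseteq> P \<Longrightarrow> I \<subseteq> P \<or> J \<subseteq> P"
    using P GT unfolding G_prime_def invariant_ideal_def by simp_all
  have con: "invariant_ideal GT act RB (J \<inter> B)" "ext (J \<inter> B) = J" if "invariant_ideal GG act R J" for J
    using that contract_ideal[of J] GG GT Gt_sub unfolding invariant_ideal_def by auto
  show ?thesis
  proof (intro ex1I[of _ "ext P"] conjI)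
    show eq: "ext P \<inter> B = P" using Pi(1,2) by (rule ext_Int_B)
    show "G_prime GG act R (ext P)"
      unfolding G_prime_def
    proof (intro conjI allI impI)
      show "invariant_ideal GG act R (ext P)"
        unfolding invariant_ideal_def GG using ext_ideal[OF Pi(1,2)] ext_invariant[OF Pi(1,2)] by blast
      show "ext P \<noteq> carrier R" using eq Pi(3) BD(1) by auto
      fix I J assume I: "invariant_ideal GG act R I" and J: "invariant_ideal GG act R J" and IJ: "I \<cdot> J \<subseteq> ext P"
      have "(I \<inter> B) \<cdot>\<^bsub>RB\<^esub> (J \<inter> B) \<subseteq> P" using ideal_prod_contract[of I J] IJ eq by blast
      then have "I \<inter> B \<subseteq> P \<or> J \<inter> B \<subseteq> P" using Pp con(1)[OF I] con(1)[OF J] by blast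
      then have "ext (I \<inter> B) \<subseteq> ext P \<or> ext (J \<inter> B) \<subseteq> ext P" using ext_mono by blast
      then show "I \<subseteq> ext P \<or> J \<subseteq> ext P" unfolding con(2)[OF I] con(2)[OF J] .
    qed
    show "Q = ext P" if "G_prime GG act R Q \<and> Q \<inter> B = P" for Q
      using con(2)[of Q] that unfolding G_prime_def by auto
  qed
qed

end

section \<open>Quantum matrices\<close>

text \<open>The four families of relations in one: \<open>(i, j)\<close> precedes \<open>(l, m)\<close> lexicographically.\<close>

definition qmat_relations :: "nat \<Rightarrow> 'k::field \<Rightarrow> ('k, 'a) module \<Rightarrow> (nat \<Rightarrow> nat \<Rightarrow> 'a) \<Rightarrow> bool" where
  "qmat_relations n q C x \<longleftrightarrow>
     (\<forall>i j. {i, j} \<subseteq> {1..n} \<longrightarrow> x i j \<in> carrier C) \<and>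
     (\<forall>i j l m. {i, j, l, m} \<subseteq> {1..n} \<and> (i < l \<or> i = l \<and> j < m) \<longrightarrow>
        x i j \<otimes>\<^bsub>C\<^esub> x l m = (if i = l \<or> j = m then q else 1) \<odot>\<^bsub>C\<^esub> (x l m \<otimes>\<^bsub>C\<^esub> x i j)
          \<oplus>\<^bsub>C\<^esub> (if i < l \<and> j < m then q - inverse q else 0) \<odot>\<^bsub>C\<^esub> (x i m \<otimes>\<^bsub>C\<^esub> x l j))"

lemma qmat_relations_closed:
  "qmat_relations n q C x \<Longrightarrow> {i, j} \<subseteq> {1..n} \<Longrightarrow> x i j \<in> carrier C"
  unfolding qmat_relations_def by (drule conjunct1) blast

lemma qmat_relations_rel:
  assumes "qmat_relations n q C x" "{i, j, l, m} \<subseteq> {1..n} \<and> (i < l \<or> i = l \<and> j < m)"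
  shows "x i j \<otimes>\<^bsub>C\<^esub> x l m = (if i = l \<or> j = m then q else 1) \<odot>\<^bsub>C\<^esub> (x l m \<otimes>\<^bsub>C\<^esub> x i j)
      \<oplus>\<^bsub>C\<^esub> (if i < l \<and> j < m then q - inverse q else 0) \<odot>\<^bsub>C\<^esub> (x i m \<otimes>\<^bsub>C\<^esub> x l j)"
  by (rule conjunct2[OF assms(1)[unfolded qmat_relations_def], rule_format]) (use assms(2) in simp_all)

lemma qmat_relationsD:
  assumes "qmat_relations n q C x" "kalg C"
  shows "{i, j} \<subseteq> {1..n} \<Longrightarrow> x i j \<in> carrier C"
    and "{i, j, l} \<subseteq> {1..n} \<Longrightarrow> i < l \<Longrightarrow> x i j \<otimes>\<^bsub>C\<^esub> x l j = q \<odot>\<^bsub>C\<^esub> (x l j \<otimes>\<^bsub>C\<^esub> x i j)"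
    and "{i, j, m} \<subseteq> {1..n} \<Longrightarrow> j < m \<Longrightarrow> x i j \<otimes>\<^bsub>C\<^esub> x i m = q \<odot>\<^bsub>C\<^esub> (x i m \<otimes>\<^bsub>C\<^esub> x i j)"
    and "{i, j, l, m} \<subseteq> {1..n} \<Longrightarrow> i < l \<Longrightarrow> j > m \<Longrightarrow> x i j \<otimes>\<^bsub>C\<^esub> x l m = x l m \<otimes>\<^bsub>C\<^esub> x i j"
    and "{i, j, l, m} \<subseteq> {1..n} \<Longrightarrow> i < l \<Longrightarrow> j < m \<Longrightarrow>
        x i j \<otimes>\<^bsub>C\<^esub> x l m = x l m \<otimes>\<^bsub>C\<^esub> x i j \<oplus>\<^bsub>C\<^esub> (q - inverse q) \<odot>\<^bsub>C\<^esub> (x i m \<otimes>\<^bsub>C\<^esub> x l j)"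
proof -
  interpret C: kalg C by fact
  show c: "x i j \<in> carrier C" if "{i, j} \<subseteq> {1..n}" for i j
    using assms(1) that by (rule qmat_relations_closed)
  have rel: "x i j \<otimes>\<^bsub>C\<^esub> x l m = (if i = l \<or> j = m then q else 1) \<odot>\<^bsub>C\<^esub> (x l m \<otimes>\<^bsub>C\<^esub> x i j)
      \<oplus>\<^bsub>C\<^esub> (if i < l \<and> j < m then q - inverse q else 0) \<odot>\<^bsub>C\<^esub> (x i m \<otimes>\<^bsub>C\<^esub> x l j)"
    if "{i, j, l, m} \<subseteq> {1..n}" "i < l \<or> i = l \<and> j < m" for i j l m
    using assms(1) conjI[OF that] by (rule qmat_relations_rel)
  show "{i, j, l} \<subseteq> {1..n} \<Longrightarrow> i < l \<Longrightarrow> x i j \<otimes>\<^bsub>C\<^esub> x l j = q \<odot>\<^bsub>C\<^esub> (x l j \<otimes>\<^bsub>C\<^esub> x i j)"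
    using rel[of i j l j] c[of i j] c[of l j] by simp
  show "{i, j, m} \<subseteq> {1..n} \<Longrightarrow> j < m \<Longrightarrow> x i j \<otimes>\<^bsub>C\<^esub> x i m = q \<odot>\<^bsub>C\<^esub> (x i m \<otimes>\<^bsub>C\<^esub> x i j)"
    using rel[of i j i m] c[of i j] c[of i m] by simp
  show "{i, j, l, m} \<subseteq> {1..n} \<Longrightarrow> i < l \<Longrightarrow> j > m \<Longrightarrow> x i j \<otimes>\<^bsub>C\<^esub> x l m = x l m \<otimes>\<^bsub>C\<^esub> x i j"
    using rel[of i j l m] c[of i j] c[of l m] c[of i m] c[of l j] by simp
  show "{i, j, l, m} \<subseteq> {1..n} \<Longrightarrow> i < l \<Longrightarrow> j < m \<Longrightarrow>
        x i j \<otimes>\<^bsub>C\<^esub> x l m = x l m \<otimes>\<^bsub>C\<^esub> x i j \<oplus>\<^bsub>C\<^esub> (q - inverse q) \<odot>\<^bsub>C\<^esub> (x i m \<otimes>\<^bsub>C\<^esub> x l j)"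
    using rel[of i j l m] c[of i j] c[of l m] by simp
qed

lemma qmat_relations_hom:
  assumes "kalg C" "qmat_relations n q C x" "alg_hom C D \<phi>"
  shows "qmat_relations n q D (\<lambda>i j. \<phi> (x i j))"
  unfolding qmat_relations_def
proof (intro conjI allI impI)
  interpret C: kalg C by fact
  note h = alg_homD[OF assms(3)]
  have c: "x i j \<in> carrier C" if "{i, j} \<subseteq> {1..n}" for i j
    using assms(2) that by (rule qmat_relations_closed)
  show "\<phi> (x i j) \<in> carrier D" if "{i, j} \<subseteq> {1..n}" for i j using c[OF that] by (rule h(1))
  fix i j l m :: nat assume a: "{i, j, l, m} \<subseteq> {1..n} \<and> (i < l \<or> i = l \<and> j < m)"
  have "\<phi> (x i j \<otimes>\<^bsub>C\<^esub> x l m) = \<phi> ((if i = l \<or> j = m then q else 1) \<odot>\<^bsub>C\<^esub> (x l m \<otimes>\<^bsub>C\<^esub> x i j)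
      \<oplus>\<^bsub>C\<^esub> (if i < l \<and> j < m then q - inverse q else 0) \<odot>\<^bsub>C\<^esub> (x i m \<otimes>\<^bsub>C\<^esub> x l j))"
    unfolding qmat_relations_rel[OF assms(2) a] ..
  then show "\<phi> (x i j) \<otimes>\<^bsub>D\<^esub> \<phi> (x l m) = (if i = l \<or> j = m then q else 1) \<odot>\<^bsub>D\<^esub> (\<phi> (x l m) \<otimes>\<^bsub>D\<^esub> \<phi> (x i j))
      \<oplus>\<^bsub>D\<^esub> (if i < l \<and> j < m then q - inverse q else 0) \<odot>\<^bsub>D\<^esub> (\<phi> (x i m) \<otimes>\<^bsub>D\<^esub> \<phi> (x l j))"
    using a c[of i j] c[of l m] c[of i m] c[of l j] by (simp add: h del: if_split)
qed

text \<open>All monomials of one relation involve the same two rows and the same two columns, so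
  scaling multiplies the whole relation by
  \<open>\<alpha> i * \<alpha> l * \<beta> j * \<beta> m\<close>.\<close>

lemma qmat_relations_scale:
  assumes "kalg C" "qmat_relations n q C x"
  shows "qmat_relations n q C (\<lambda>i j. (\<alpha> i * \<beta> j) \<odot>\<^bsub>C\<^esub> x i j)"
  unfolding qmat_relations_def
proof (intro conjI allI impI)
  interpret C: kalg C by fact
  have c: "x i j \<in> carrier C" if "{i, j} \<subseteq> {1..n}" for i j
    using assms(2) that by (rule qmat_relations_closed)
  then show "(\<alpha> i * \<beta> j) \<odot>\<^bsub>C\<^esub> x i j \<in> carrier C" if "{i, j} \<subseteq> {1..n}" for i j using that by simp
  have mm: "(s \<odot>\<^bsub>C\<^esub> a) \<otimes>\<^bsub>C\<^esub> (s' \<odot>\<^bsub>C\<^esub> b) = (s * s') \<odot>\<^bsub>C\<^esub> (a \<otimes>\<^bsub>C\<^esub> b)"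
    if "a \<in> carrier C" "b \<in> carrier C" for s s' a b
    using that by (simp add: C.smult_mult_left C.smult_mult_right C.smult_smult mult.commute)
  fix i j l m :: nat assume a: "{i, j, l, m} \<subseteq> {1..n} \<and> (i < l \<or> i = l \<and> j < m)"
  have "x i j \<otimes>\<^bsub>C\<^esub> x l m = (if i = l \<or> j = m then q else 1) \<odot>\<^bsub>C\<^esub> (x l m \<otimes>\<^bsub>C\<^esub> x i j)
      \<oplus>\<^bsub>C\<^esub> (if i < l \<and> j < m then q - inverse q else 0) \<odot>\<^bsub>C\<^esub> (x i m \<otimes>\<^bsub>C\<^esub> x l j)"
    using assms(2) a by (rule qmat_relations_rel)
  then show "((\<alpha> i * \<beta> j) \<odot>\<^bsub>C\<^esub> x i j) \<otimes>\<^bsub>C\<^esub> ((\<alpha> l * \<beta> m) \<odot>\<^bsub>C\<^esub> x l m)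
      = (if i = l \<or> j = m then q else 1) \<odot>\<^bsub>C\<^esub> (((\<alpha> l * \<beta> m) \<odot>\<^bsub>C\<^esub> x l m) \<otimes>\<^bsub>C\<^esub> ((\<alpha> i * \<beta> j) \<odot>\<^bsub>C\<^esub> x i j))
      \<oplus>\<^bsub>C\<^esub> (if i < l \<and> j < m then q - inverse q else 0) \<odot>\<^bsub>C\<^esub> (((\<alpha> i * \<beta> m) \<odot>\<^bsub>C\<^esub> x i m) \<otimes>\<^bsub>C\<^esub> ((\<alpha> l * \<beta> j) \<odot>\<^bsub>C\<^esub> x l j))"
    using a c[of i j] c[of l m] c[of i m] c[of l j]
    by (simp add: mm C.smult_add_right C.smult_smult ac_simps del: if_split)
qed

text \<open>The two vanishing hypotheses kill the correction term of the diagonal relations.\<close>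

lemma qmat_relations_normal:
  assumes "kalg C" "qmat_relations n q C x" "q \<noteq> 0" "{a, b, i, j} \<subseteq> {1..n}"
    and "i < a \<Longrightarrow> j < b \<Longrightarrow> x i b \<otimes>\<^bsub>C\<^esub> x a j = \<zero>\<^bsub>C\<^esub>"
    and "a < i \<Longrightarrow> b < j \<Longrightarrow> x a j \<otimes>\<^bsub>C\<^esub> x i b = \<zero>\<^bsub>C\<^esub>"
  shows "x a b \<otimes>\<^bsub>C\<^esub> x i j = (q powi ((if i = a then sgn (int j - int b) else 0) +
     (if j = b then sgn (int i - int a) else 0))) \<odot>\<^bsub>C\<^esub> (x i j \<otimes>\<^bsub>C\<^esub> x a b)"
proof -
  interpret C: kalg C by fact
  note xD = qmat_relationsD[OF assms(2,1)]
  have c: "x i j \<in> carrier C" "x a b \<in> carrier C" "x i b \<in> carrier C" "x a j \<in> carrier C"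
    using assms(4) by (auto intro!: xD(1))
  \<comment> \<open>The relations have the earlier entry on the left; for the opposite order
    \<open>q\<close> is moved to the other side.\<close>
  have flip: "v = inverse q \<odot>\<^bsub>C\<^esub> u" if "u = q \<odot>\<^bsub>C\<^esub> v" "v \<in> carrier C" for u v
    using that assms(3) by (simp add: C.smult_smult)
  consider "i = a" "j = b" | "i = a" "b < j" | "i = a" "j < b" | "i < a" "j = b" | "a < i" "j = b"
    | "i < a" "j < b" | "a < i" "b < j" | "i < a" "b < j" | "a < i" "j < b" by linarith
  then show ?thesis
  proof cases
    case 1
    then show ?thesis using c by simp
  next
    case 2
    then show ?thesis using xD(3)[of a b j] assms(4) by (simp add: sgn_if)
  next
    case 3
    then have "x i j \<otimes>\<^bsub>C\<^esub> x a b = q \<odot>\<^bsub>C\<^esub> (x a b \<otimes>\<^bsub>C\<^esub> x i j)" using xD(3)[of a j b] assms(4) by simp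
    from flip[OF this] show ?thesis using 3 c by (simp add: sgn_if power_int_minus)
  next
    case 4
    then have "x i j \<otimes>\<^bsub>C\<^esub> x a b = q \<odot>\<^bsub>C\<^esub> (x a b \<otimes>\<^bsub>C\<^esub> x i j)" using xD(2)[of i b a] assms(4) by simp
    from flip[OF this] show ?thesis using 4 c by (simp add: sgn_if power_int_minus)
  next
    case 5
    then show ?thesis using xD(2)[of a b i] assms(4) by (simp add: sgn_if)
  next
    case 6
    then have "x i j \<otimes>\<^bsub>C\<^esub> x a b = x a b \<otimes>\<^bsub>C\<^esub> x i j \<oplus>\<^bsub>C\<^esub> (q - inverse q) \<odot>\<^bsub>C\<^esub> (x i b \<otimes>\<^bsub>C\<^esub> x a j)"
      using assms(4) by (intro xD(5)) auto
    then show ?thesis using assms(5)[OF 6] 6 c by simp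
  next
    case 7
    then have "x a b \<otimes>\<^bsub>C\<^esub> x i j = x i j \<otimes>\<^bsub>C\<^esub> x a b \<oplus>\<^bsub>C\<^esub> (q - inverse q) \<odot>\<^bsub>C\<^esub> (x a j \<otimes>\<^bsub>C\<^esub> x i b)"
      using assms(4) by (intro xD(5)) auto
    then show ?thesis using assms(6)[OF 7] 7 c by simp
  next
    case 8
    then have "x i j \<otimes>\<^bsub>C\<^esub> x a b = x a b \<otimes>\<^bsub>C\<^esub> x i j" using assms(4) by (intro xD(4)) auto
    then show ?thesis using 8 c by simp
  next
    case 9
    then have "x a b \<otimes>\<^bsub>C\<^esub> x i j = x i j \<otimes>\<^bsub>C\<^esub> x a b" using assms(4) by (intro xD(4)) auto
    then show ?thesis using 9 c by simp
  qed
qed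

lemma (in kalg) minus_eq_iff:
  assumes "a \<in> carrier A" "b \<in> carrier A" "c \<in> carrier A"
  shows "a \<ominus> b = c \<longleftrightarrow> a = b \<oplus> c"
proof
  assume "a = b \<oplus> c"
  then have "a \<ominus> b = b \<oplus> (\<ominus> b \<oplus> c)" using assms by (simp add: minus_eq a_ac)
  then show "a \<ominus> b = c" using assms by (simp add: r_neg2)
next
  assume "a \<ominus> b = c"
  then show "a = b \<oplus> c" using assms by (auto simp: minus_eq a_ac r_neg)
qed

section \<open>The presentation of quantum matrices\<close>

lemma mat_idx_iff: "(i, j) \<in> mat_idx n \<longleftrightarrow> {i, j} \<subseteq> {1..n}"
  by (simp add: mat_idx_def)

lemma x_closed: "{i, j} \<subseteq> {1..n} \<Longrightarrow> free_gen (i, j) \<in> carrier (free_alg (mat_idx n))"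
  by (rule free_gen_closed) (simp add: mat_idx_def)

lemma qmat_rels_cases:
  fixes n :: nat and q :: "'k::field"
  assumes "x \<in> qmat_rels n q"
  defines "F \<equiv> free_alg (mat_idx n) :: ('k, (nat \<times> nat) list \<Rightarrow> 'k) module"
  obtains (col) i j l where "{i, j, l} \<subseteq> {1..n}" "i < l"
      "x = free_gen (i, j) \<otimes>\<^bsub>F\<^esub> free_gen (l, j) \<ominus>\<^bsub>F\<^esub> q \<odot>\<^bsub>F\<^esub> (free_gen (l, j) \<otimes>\<^bsub>F\<^esub> free_gen (i, j))"
  | (row) i j m where "{i, j, m} \<subseteq> {1..n}" "j < m"
      "x = free_gen (i, j) \<otimes>\<^bsub>F\<^esub> free_gen (i, m) \<ominus>\<^bsub>F\<^esub> q \<odot>\<^bsub>F\<^esub> (free_gen (i, m) \<otimes>\<^bsub>F\<^esub> free_gen (i, j))"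
  | (anti) i j l m where "{i, j, l, m} \<subseteq> {1..n}" "i < l" "m < j"
      "x = free_gen (i, j) \<otimes>\<^bsub>F\<^esub> free_gen (l, m) \<ominus>\<^bsub>F\<^esub> free_gen (l, m) \<otimes>\<^bsub>F\<^esub> free_gen (i, j)"
  | (diag) i j l m where "{i, j, l, m} \<subseteq> {1..n}" "i < l" "j < m"
      "x = (free_gen (i, j) \<otimes>\<^bsub>F\<^esub> free_gen (l, m) \<ominus>\<^bsub>F\<^esub> free_gen (l, m) \<otimes>\<^bsub>F\<^esub> free_gen (i, j))
        \<ominus>\<^bsub>F\<^esub> (q - inverse q) \<odot>\<^bsub>F\<^esub> (free_gen (i, m) \<otimes>\<^bsub>F\<^esub> free_gen (l, j))"
  using assms(1) unfolding qmat_rels_def Let_def F_def[symmetric]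
  by (elim UnE CollectE exE conjE) assumption+

lemma qmat_rels_mem:
  fixes n :: nat and q :: "'k::field"
  defines "F \<equiv> free_alg (mat_idx n) :: ('k, (nat \<times> nat) list \<Rightarrow> 'k) module"
  shows "{i, j, l} \<subseteq> {1..n} \<Longrightarrow> i < l \<Longrightarrow>
      free_gen (i, j) \<otimes>\<^bsub>F\<^esub> free_gen (l, j) \<ominus>\<^bsub>F\<^esub> q \<odot>\<^bsub>F\<^esub> (free_gen (l, j) \<otimes>\<^bsub>F\<^esub> free_gen (i, j)) \<in> qmat_rels n q"
    "{i, j, m} \<subseteq> {1..n} \<Longrightarrow> j < m \<Longrightarrow>
      free_gen (i, j) \<otimes>\<^bsub>F\<^esub> free_gen (i, m) \<ominus>\<^bsub>F\<^esub> q \<odot>\<^bsub>F\<^esub> (free_gen (i, m) \<otimes>\<^bsub>F\<^esub> free_gen (i, j)) \<in> qmat_rels n q"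
    "{i, j, l, m} \<subseteq> {1..n} \<Longrightarrow> i < l \<Longrightarrow> m < j \<Longrightarrow>
      free_gen (i, j) \<otimes>\<^bsub>F\<^esub> free_gen (l, m) \<ominus>\<^bsub>F\<^esub> free_gen (l, m) \<otimes>\<^bsub>F\<^esub> free_gen (i, j) \<in> qmat_rels n q"
    "{i, j, l, m} \<subseteq> {1..n} \<Longrightarrow> i < l \<Longrightarrow> j < m \<Longrightarrow>
      (free_gen (i, j) \<otimes>\<^bsub>F\<^esub> free_gen (l, m) \<ominus>\<^bsub>F\<^esub> free_gen (l, m) \<otimes>\<^bsub>F\<^esub> free_gen (i, j))
        \<ominus>\<^bsub>F\<^esub> (q - inverse q) \<odot>\<^bsub>F\<^esub> (free_gen (i, m) \<otimes>\<^bsub>F\<^esub> free_gen (l, j)) \<in> qmat_rels n q"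
  unfolding qmat_rels_def Let_def F_def[symmetric]
  subgoal by (rule UnI1, rule UnI1, rule UnI1, intro CollectI exI conjI, rule refl)
  subgoal by (rule UnI1, rule UnI1, rule UnI2, intro CollectI exI conjI, rule refl)
  subgoal by (rule UnI1, rule UnI2, intro CollectI exI conjI, rule refl)
  subgoal by (rule UnI2, intro CollectI exI conjI, rule refl)
  done

lemma qmat_rels_sub: "qmat_rels n q \<subseteq> carrier (free_alg (mat_idx n))"
proof
  fix x :: "(nat \<times> nat) list \<Rightarrow> 'a" assume x: "x \<in> qmat_rels n q"
  interpret F: kalg "free_alg (mat_idx n) :: ('a, (nat \<times> nat) list \<Rightarrow> 'a) module" by (rule free_alg_kalg)
  from x show "x \<in> carrier (free_alg (mat_idx n))"
  proof (cases rule: qmat_rels_cases)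
    case (col i j l)
    show ?thesis unfolding col(3) by (intro F.minus_closed F.m_closed F.smult_closed x_closed) (use col(1) in auto)
  next
    case (row i j m)
    show ?thesis unfolding row(3) by (intro F.minus_closed F.m_closed F.smult_closed x_closed) (use row(1) in auto)
  next
    case (anti i j l m)
    show ?thesis unfolding anti(4) by (intro F.minus_closed F.m_closed F.smult_closed x_closed) (use anti(1) in auto)
  next
    case (diag i j l m)
    show ?thesis unfolding diag(4) by (intro F.minus_closed F.m_closed F.smult_closed x_closed) (use diag(1) in auto)
  qed
qed

locale qmat_alg = fixes n :: nat and q :: "'k::field"
begin

abbreviation FX :: "('k, (nat \<times> nat) list \<Rightarrow> 'k) module" where "FX \<equiv> free_alg (mat_idx n)"
abbreviation A where "A \<equiv> qmat n q"
abbreviation X where "X \<equiv> qX n q"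

sublocale Q: kalg_ideal FX "qmat_ideal n q"
  rewrites "quot_alg FX (qmat_ideal n q) = A"
  using Idl_quot[OF free_alg_kalg qmat_rels_sub] by (simp_all add: qmat_ideal_def qmat_def)

lemma A_kalg: "kalg A" by (rule Q.quot_kalg)

lemma proj_rel: "x \<in> qmat_rels n q \<Longrightarrow> qmat_ideal n q +>\<^bsub>FX\<^esub> x = \<zero>\<^bsub>A\<^esub>"
proof -
  assume x: "x \<in> qmat_rels n q"
  have xc: "x \<in> carrier FX" using x qmat_rels_sub by auto
  have "x \<in> qmat_ideal n q" using x Q.genideal_self[OF qmat_rels_sub] by (auto simp: qmat_ideal_def)
  then show ?thesis using xc unfolding Q.quot_zero by (subst Q.quot_eq_iff) (simp_all add: Q.minus_eq)
qed

lemma X_relations: "qmat_relations n q A X"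
proof -
  interpret Ak: kalg A by (rule A_kalg)
  interpret p: kalg_hom FX A "\<lambda>x. qmat_ideal n q +>\<^bsub>FX\<^esub> x"
    by unfold_locales (rule Q.quot_hom)
  note X = qX_def[of n q]
  have c: "free_gen (i, j) \<in> carrier FX" if "{i, j} \<subseteq> {1..n}" for i j using that by (rule x_closed)
  show ?thesis
    unfolding qmat_relations_def
  proof (intro conjI allI impI)
    show Xc: "X i j \<in> carrier A" if "{i, j} \<subseteq> {1..n}" for i j
      unfolding X using that by (intro p.hom_closed x_closed)
    fix i j l m :: nat assume a: "{i, j, l, m} \<subseteq> {1..n} \<and> (i < l \<or> i = l \<and> j < m)"
    note c = c[of i j] c[of l m] c[of i m] c[of l j] and Xc = Xc[of i j] Xc[of l m] Xc[of i m] Xc[of l j]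
    note hom = p.hom_minus p.hom_mult p.hom_smult Ak.minus_eq_iff
    \<comment> \<open>The combined relation splits into the four families of the presentation; in
      the first three the coefficient of the correction term is zero.\<close>
    consider "i < l" "j = m" | "i = l" "j < m" | "i < l" "m < j" | "i < l" "j < m" using a by linarith
    then show "X i j \<otimes>\<^bsub>A\<^esub> X l m = (if i = l \<or> j = m then q else 1) \<odot>\<^bsub>A\<^esub> (X l m \<otimes>\<^bsub>A\<^esub> X i j)
      \<oplus>\<^bsub>A\<^esub> (if i < l \<and> j < m then q - inverse q else 0) \<odot>\<^bsub>A\<^esub> (X i m \<otimes>\<^bsub>A\<^esub> X l j)"
    proof cases
      case 1
      then show ?thesis using proj_rel[OF qmat_rels_mem(1)[of i j l n q]] a c Xc by (simp add: X hom)
    next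
      case 2
      then show ?thesis using proj_rel[OF qmat_rels_mem(2)[of i j m n q]] a c Xc by (simp add: X hom)
    next
      case 3
      then show ?thesis using proj_rel[OF qmat_rels_mem(3)[of i j l m n q]] a c Xc by (simp add: X hom)
    next
      case 4
      then show ?thesis using proj_rel[OF qmat_rels_mem(4)[of i j l m n q]] a c Xc by (simp add: X hom)
    qed
  qed
qed

lemma X_gen: "subalg_gen A {X i j |i j. {i, j} \<subseteq> {1..n}} = carrier A"
proof -
  have "free_gen ` mat_idx n \<subseteq> carrier FX" by (auto intro: free_gen_closed)
  from Q.quot_gen[OF this free_alg_gen]
  have "subalg_gen A ((\<lambda>x. qmat_ideal n q +>\<^bsub>FX\<^esub> x) ` free_gen ` mat_idx n) = carrier A" .
  moreover have "(\<lambda>x. qmat_ideal n q +>\<^bsub>FX\<^esub> x) ` free_gen ` mat_idx n = {X i j |i j. {i, j} \<subseteq> {1..n}}"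
    unfolding qX_def mat_idx_iff[symmetric] by (auto simp: image_iff Bex_def split_paired_Ex)
  ultimately show ?thesis by simp
qed

text \<open>The universal property of quantum matrices. With rescaled generators for
  \<open>x\<close> it produces the torus action.\<close>

lemma A_lift:
  assumes C: "kalg C" and x: "qmat_relations n q C x"
  obtains \<phi> where "alg_hom A C \<phi>" "\<And>i j. {i, j} \<subseteq> {1..n} \<Longrightarrow> \<phi> (X i j) = x i j"
proof -
  interpret C: kalg C by fact
  note xD = qmat_relationsD[OF x C]
  obtain \<zeta> where \<zeta>: "alg_hom FX C \<zeta>" "\<And>p. p \<in> mat_idx n \<Longrightarrow> \<zeta> (free_gen p) = case_prod x p"
    by (rule free_alg_lift[OF C, of "mat_idx n" "case_prod x"]) (auto simp: mat_idx_def intro!: xD(1))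
  interpret z: kalg_hom FX C \<zeta> by unfold_locales (rule \<zeta>(1))
  have v: "\<zeta> (free_gen (i, j)) = x i j" if "{i, j} \<subseteq> {1..n}" for i j
    using \<zeta>(2)[of "(i, j)"] that by (simp add: mat_idx_def)
  note hom = z.hom_minus z.hom_mult z.hom_smult v xD(1) C.minus_eq_iff
  have z: "\<zeta> y = \<zero>\<^bsub>C\<^esub>" if y: "y \<in> qmat_rels n q" for y
    using y
  proof (cases rule: qmat_rels_cases)
    case (col i j l)
    then show ?thesis using xD(2)[of i j l] by (simp add: hom x_closed)
  next
    case (row i j m)
    then show ?thesis using xD(3)[of i j m] by (simp add: hom x_closed)
  next
    case (anti i j l m)
    then show ?thesis using xD(4)[of i j l m] by (simp add: hom x_closed)
  next
    case (diag i j l m)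
    then show ?thesis using xD(5)[of i j l m] by (simp add: hom x_closed)
  qed
  obtain \<phi> where \<phi>: "alg_hom A C \<phi>" "\<And>a. a \<in> carrier FX \<Longrightarrow> \<phi> (qmat_ideal n q +>\<^bsub>FX\<^esub> a) = \<zeta> a"
    using quot_lift_Idl[OF free_alg_kalg qmat_rels_sub C \<zeta>(1) z] unfolding qmat_def qmat_ideal_def
    by metis
  show ?thesis
    by (rule that[OF \<phi>(1)]) (simp add: qX_def \<phi>(2) x_closed v)
qed

end

section \<open>Localized quotients of quantum matrices\<close>

text \<open>\<open>inverse s \<odot> v'\<close> inverts \<open>s \<odot> u'\<close>, and inverses
  are unique. It yields the torus weights of adjoined inverses from those of the entries.\<close>

lemma alg_hom_inverse_scale:
  assumes "kalg A" "kalg C" "alg_hom A C \<phi>"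
    and "u \<in> carrier A" "v \<in> carrier A" "u \<otimes>\<^bsub>A\<^esub> v = \<one>\<^bsub>A\<^esub>" "v \<otimes>\<^bsub>A\<^esub> u = \<one>\<^bsub>A\<^esub>"
    and "u' \<in> carrier C" "v' \<in> carrier C" "u' \<otimes>\<^bsub>C\<^esub> v' = \<one>\<^bsub>C\<^esub>" "v' \<otimes>\<^bsub>C\<^esub> u' = \<one>\<^bsub>C\<^esub>"
    and "\<phi> u = s \<odot>\<^bsub>C\<^esub> u'" "s \<noteq> 0"
  shows "\<phi> v = inverse s \<odot>\<^bsub>C\<^esub> v'"
proof -
  interpret A: kalg A by fact
  interpret C: kalg C by fact
  note h = alg_homD[OF assms(3)]
  have "\<phi> v \<otimes>\<^bsub>C\<^esub> (s \<odot>\<^bsub>C\<^esub> u') = \<one>\<^bsub>C\<^esub>"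
    using h(3)[OF assms(5,4)] assms(7,12) h(5) by simp
  moreover have "(s \<odot>\<^bsub>C\<^esub> u') \<otimes>\<^bsub>C\<^esub> (inverse s \<odot>\<^bsub>C\<^esub> v') = \<one>\<^bsub>C\<^esub>"
    using assms by (simp add: C.smult_mult_left C.smult_mult_right C.smult_smult)
  ultimately show ?thesis
    using C.inv_unique[of "\<phi> v" "s \<odot>\<^bsub>C\<^esub> u'" "inverse s \<odot>\<^bsub>C\<^esub> v'"] h(1)[OF assms(5)] assms(8,9) by simp
qed

section \<open>The torus action on quantum matrices\<close>

context qmat_alg
begin

text \<open>Membership in H up to the values outside \<open>{1..n}\<close>. Leaving these free
  allows inverse elements to be formed pointwise.\<close>

definition torus_elem :: "'k hgrp \<Rightarrow> bool" where
  "torus_elem g \<longleftrightarrow> (\<forall>i\<in>{1..n}. fst g i \<noteq> 0 \<and> snd g i \<noteq> 0)"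

definition \<chi> :: "'k hgrp \<Rightarrow> nat \<Rightarrow> nat \<Rightarrow> 'k" where "\<chi> g i j = fst g i * snd g j"

lemma \<chi>_nonzero: "torus_elem g \<Longrightarrow> {i, j} \<subseteq> {1..n} \<Longrightarrow> \<chi> g i j \<noteq> 0"
  by (simp add: torus_elem_def \<chi>_def)

lemma scale_hom:
  obtains \<phi> where "alg_hom A A \<phi>" "\<And>i j. {i, j} \<subseteq> {1..n} \<Longrightarrow> \<phi> (X i j) = \<chi> g i j \<odot>\<^bsub>A\<^esub> X i j"
  using A_lift[OF A_kalg qmat_relations_scale[OF A_kalg X_relations, of "fst g" "snd g"]]
  unfolding \<chi>_def by metis

lemma gens_closed: "{X i j |i j. {i, j} \<subseteq> {1..n}} \<subseteq> carrier A"
  using qmat_relations_closed[OF X_relations] by auto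

text \<open>Existence comes from the universal property, with the pointwise inverse of
  \<open>g\<close> giving the inverse automorphism; uniqueness comes from agreement on the
  generators. Only then is the definite description known to have these values.\<close>

lemma act_A:
  assumes g: "torus_elem g"
  shows "act_A n q g \<in> alg_aut A"
    "{i, j} \<subseteq> {1..n} \<Longrightarrow> act_A n q g (X i j) = \<chi> g i j \<odot>\<^bsub>A\<^esub> X i j"
proof -
  interpret Ak: kalg A by (rule A_kalg)
  note Xc = qmat_relations_closed[OF X_relations]
  define g' where "g' = ((\<lambda>i. inverse (fst g i)), (\<lambda>i. inverse (snd g i)))"
  obtain \<phi> where \<phi>: "alg_hom A A \<phi>" "\<And>i j. {i, j} \<subseteq> {1..n} \<Longrightarrow> \<phi> (X i j) = \<chi> g i j \<odot>\<^bsub>A\<^esub> X i j"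
    using scale_hom[of g] by blast
  obtain \<psi> where \<psi>: "alg_hom A A \<psi>" "\<And>i j. {i, j} \<subseteq> {1..n} \<Longrightarrow> \<psi> (X i j) = \<chi> g' i j \<odot>\<^bsub>A\<^esub> X i j"
    using scale_hom[of g'] by blast
  have gg: "\<chi> g i j * \<chi> g' i j = 1" if "{i, j} \<subseteq> {1..n}" for i j
    using \<chi>_nonzero[OF g that] by (simp add: \<chi>_def g'_def field_simps)
  let ?\<phi> = "restrict \<phi> (carrier A)"
  have aut: "?\<phi> \<in> alg_aut A"
  proof (rule alg_autI[OF A_kalg \<phi>(1) \<psi>(1) gens_closed X_gen])
    fix s assume "s \<in> {X i j |i j. {i, j} \<subseteq> {1..n}}"
    then obtain i j where ij: "s = X i j" "{i, j} \<subseteq> {1..n}" by blast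
    show "\<psi> (\<phi> s) = s" "\<phi> (\<psi> s) = s"
      unfolding ij(1) using \<phi>(2)[OF ij(2)] \<psi>(2)[OF ij(2)] Xc[OF ij(2)] gg[OF ij(2)]
        alg_homD(4)[OF \<phi>(1)] alg_homD(4)[OF \<psi>(1)]
      by (simp_all add: Ak.smult_smult mult.commute)
  qed
  have val: "?\<phi> (X i j) = \<chi> g i j \<odot>\<^bsub>A\<^esub> X i j" if "{i, j} \<subseteq> {1..n}" for i j
    using \<phi>(2)[OF that] Xc[OF that] by simp
  have "act_A n q g = ?\<phi>"
    unfolding act_A_def case_prod_beta
  proof (rule the_equality)
    show "?\<phi> \<in> alg_aut A \<and> (\<forall>p\<in>mat_idx n. ?\<phi> (X (fst p) (snd p)) = (fst g (fst p) * snd g (snd p)) \<odot>\<^bsub>A\<^esub> X (fst p) (snd p))"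
      using aut val by (auto simp: mat_idx_def \<chi>_def simp del: restrict_apply)
    fix \<theta> assume th: "\<theta> \<in> alg_aut A \<and> (\<forall>p\<in>mat_idx n. \<theta> (X (fst p) (snd p)) = (fst g (fst p) * snd g (snd p)) \<odot>\<^bsub>A\<^esub> X (fst p) (snd p))"
    show "\<theta> = ?\<phi>"
    proof (rule alg_aut_eqI[OF A_kalg _ aut gens_closed X_gen])
      fix s assume "s \<in> {X i j |i j. {i, j} \<subseteq> {1..n}}"
      then obtain i j where ij: "s = X i j" "{i, j} \<subseteq> {1..n}" by blast
      have "\<theta> (X i j) = \<chi> g i j \<odot>\<^bsub>A\<^esub> X i j"
        using bspec[OF conjunct2[OF th], of "(i, j)"] ij(2) by (simp add: mat_idx_def \<chi>_def)
      then show "\<theta> s = ?\<phi> s" unfolding ij(1) val[OF ij(2)] .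
    qed (use th in simp)
  qed
  then show "act_A n q g \<in> alg_aut A"
    "{i, j} \<subseteq> {1..n} \<Longrightarrow> act_A n q g (X i j) = \<chi> g i j \<odot>\<^bsub>A\<^esub> X i j"
    using aut val by simp_all
qed

end

section \<open>Quantum matrices with the entries in \<open>Z\<close> killed and those in
  \<open>Dg\<close> inverted: the common form of \<open>Rplus\<close> and
  \<open>Rminus\<close>\<close>

locale qmat_loc = qmat_alg n q for n :: nat and q :: "'k::field" +
  fixes Z Dg :: "(nat \<times> nat) set"
  assumes Z_sub: "Z \<subseteq> mat_idx n" and Dg_sub: "Dg \<subseteq> mat_idx n"
begin

definition IZ where "IZ = Idl\<^bsub>A\<^esub> {X i j |i j. (i, j) \<in> Z}"
abbreviation R0 where "R0 \<equiv> quot_alg A IZ"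
definition S0 where "S0 = {IZ +>\<^bsub>A\<^esub> X i j |i j. (i, j) \<in> Dg}"
abbreviation L where "L \<equiv> loc_alg R0 S0"
definition \<pi> where "\<pi> a = loc_map R0 S0 (IZ +>\<^bsub>A\<^esub> a)"
abbreviation Xl where "Xl i j \<equiv> \<pi> (X i j)"
abbreviation Xi where "Xi i j \<equiv> inv\<^bsub>L\<^esub> (Xl i j)"

lemma X_closed: "{i, j} \<subseteq> {1..n} \<Longrightarrow> X i j \<in> carrier A"
  by (rule qmat_relations_closed[OF X_relations])

lemma IZ_gens: "{X i j |i j. (i, j) \<in> Z} \<subseteq> carrier A"
  using Z_sub X_closed by (auto simp: mat_idx_def)

sublocale QI: kalg_ideal A IZ
  unfolding IZ_def by (rule Idl_quot[OF A_kalg IZ_gens])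

lemma S0_sub: "S0 \<subseteq> carrier R0"
  using Dg_sub by (auto simp: S0_def mat_idx_def intro!: QI.quot_closed X_closed)

sublocale Lo: loc_setup R0 S0
proof -
  interpret kalg R0 by (rule QI.quot_kalg)
  show "loc_setup R0 S0" by unfold_locales (rule S0_sub)
qed

lemma L_kalg: "kalg L" by (rule Lo.loc_kalg)

lemma \<pi>_hom: "alg_hom A L \<pi>"
  using alg_hom_comp[OF QI.quot_hom Lo.loc_map_hom] unfolding \<pi>_def[abs_def] .

lemma Xl_relations: "qmat_relations n q L Xl"
  by (rule qmat_relations_hom[OF A_kalg X_relations \<pi>_hom])

lemma Xl_closed: "{i, j} \<subseteq> {1..n} \<Longrightarrow> Xl i j \<in> carrier L"
  by (rule qmat_relations_closed[OF Xl_relations])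

lemma Xl_zero:
  assumes "(i, j) \<in> Z" shows "Xl i j = \<zero>\<^bsub>L\<^esub>"
proof -
  interpret L: kalg L by (rule L_kalg)
  interpret m: kalg_hom R0 L "loc_map R0 S0" by unfold_locales (rule Lo.loc_map_hom)
  have "X i j \<in> IZ" unfolding IZ_def using assms by (intro subsetD[OF QI.genideal_self[OF IZ_gens]]) blast
  then have "IZ +>\<^bsub>A\<^esub> X i j = \<zero>\<^bsub>R0\<^esub>"
    unfolding QI.quot_zero using QI.Icarr by (subst QI.quot_eq_iff) (simp_all add: QI.minus_eq)
  then show ?thesis by (simp add: \<pi>_def)
qed

text \<open>The generators of B are written with the inverse operation of the ring, whereas the
  presentation adjoins a formal inverse. Both invert \<open>Xl i j\<close> on two sides, so they are
  equal.\<close>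

lemma Xi_inv:
  assumes "(i, j) \<in> Dg"
  shows "Xi i j \<in> carrier L" "Xl i j \<otimes>\<^bsub>L\<^esub> Xi i j = \<one>\<^bsub>L\<^esub>" "Xi i j \<otimes>\<^bsub>L\<^esub> Xl i j = \<one>\<^bsub>L\<^esub>"
    "Xi i j = Lo.loc_inv (IZ +>\<^bsub>A\<^esub> X i j)"
proof -
  interpret L: kalg L by (rule L_kalg)
  have s: "IZ +>\<^bsub>A\<^esub> X i j \<in> S0" using assms by (auto simp: S0_def)
  have c: "Xl i j \<in> carrier L" using assms Dg_sub by (auto simp: mat_idx_def intro!: Xl_closed)
  note i = Lo.loc_inv[OF s] Lo.loc_inv_closed[OF s]
  show e: "Xi i j = Lo.loc_inv (IZ +>\<^bsub>A\<^esub> X i j)"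
    using c i by (intro L.inv_unique_mult) (simp_all add: \<pi>_def)
  show "Xi i j \<in> carrier L" "Xl i j \<otimes>\<^bsub>L\<^esub> Xi i j = \<one>\<^bsub>L\<^esub>" "Xi i j \<otimes>\<^bsub>L\<^esub> Xl i j = \<one>\<^bsub>L\<^esub>"
    unfolding e using i by (simp_all add: \<pi>_def)
qed

definition Lgens where
  "Lgens = {Xl i j |i j. (i, j) \<in> mat_idx n - Z} \<union> {Xi i j |i j. (i, j) \<in> Dg}"

lemma Lgens_sub: "Lgens \<subseteq> carrier L"
  using Xl_closed Xi_inv(1) by (auto simp: Lgens_def mat_idx_def)

text \<open>The entries in \<open>Z\<close> become zero and can be left out. This matters because
  the commutation factors are known only for the surviving entries.\<close>

lemma L_gen: "subalg_gen L Lgens = carrier L"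
proof -
  interpret L: kalg L by (rule L_kalg)
  note sD = subalgD[OF L.subalg_gen_subalg[OF Lgens_sub]]
  let ?T = "(\<lambda>a. IZ +>\<^bsub>A\<^esub> a) ` {X i j |i j. {i, j} \<subseteq> {1..n}}"
  have T: "?T \<subseteq> carrier R0" using gens_closed QI.quot_closed by blast
  have g: "subalg_gen L (loc_map R0 S0 ` ?T \<union> Lo.loc_inv ` S0) = carrier L"
    by (rule Lo.loc_gen[OF T QI.quot_gen[OF gens_closed X_gen]])
  have "loc_map R0 S0 ` ?T \<union> Lo.loc_inv ` S0 \<subseteq> subalg_gen L Lgens"
  proof
    fix y assume "y \<in> loc_map R0 S0 ` ?T \<union> Lo.loc_inv ` S0"
    then consider i j where "y = Xl i j" "(i, j) \<in> mat_idx n" | i j where "y = Lo.loc_inv (IZ +>\<^bsub>A\<^esub> X i j)" "(i, j) \<in> Dg"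
      unfolding \<pi>_def S0_def mat_idx_iff by blast
    then show "y \<in> subalg_gen L Lgens"
    proof cases
      case 1
      show ?thesis
      proof (cases "(i, j) \<in> Z")
        case True
        then show ?thesis using 1(1) Xl_zero sD(3) by simp
      next
        case False
        then show ?thesis using 1 by (intro subsetD[OF subalg_gen_incl]) (auto simp: Lgens_def)
      qed
    next
      case 2
      then have "y = Xi i j" using Xi_inv(4) by simp
      then show ?thesis using 2(2) by (intro subsetD[OF subalg_gen_incl]) (auto simp: Lgens_def)
    qed
  qed
  from L.subalg_gen_mono[OF this Lgens_sub] show ?thesis using g sD(1) by simp
qed

text \<open>The scaling descends to the quotient because it sends a killed entry to a multiple of
  itself, and it extends to the localization because it sends an inverted entry to a nonzero
  multiple of a unit.\<close>

lemma scale_hom_L: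
  assumes g: "torus_elem g"
  obtains \<phi> where "alg_hom L L \<phi>" "\<And>a. a \<in> carrier A \<Longrightarrow> \<phi> (\<pi> a) = \<pi> (act_A n q g a)"
proof -
  interpret L: kalg L by (rule L_kalg)
  interpret p: kalg_hom A L \<pi> by unfold_locales (rule \<pi>_hom)
  have aA: "alg_hom A A (act_A n q g)" using act_A(1)[OF g] by (rule alg_aut_alg_hom)
  have h: "alg_hom A L (\<lambda>a. \<pi> (act_A n q g a))" by (rule alg_hom_comp[OF aA \<pi>_hom])
  have v: "\<pi> (act_A n q g (X i j)) = \<chi> g i j \<odot>\<^bsub>L\<^esub> Xl i j" if "{i, j} \<subseteq> {1..n}" for i j
    using act_A(2)[OF g that] X_closed[OF that] by (simp add: p.hom_smult)
  have z: "\<pi> (act_A n q g x) = \<zero>\<^bsub>L\<^esub>" if "x \<in> {X i j |i j. (i, j) \<in> Z}" for x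
  proof -
    obtain i j where ij: "x = X i j" "(i, j) \<in> Z" using \<open>x \<in> _\<close> by blast
    then have "{i, j} \<subseteq> {1..n}" using Z_sub mat_idx_iff by blast
    then show ?thesis using v Xl_zero ij by simp
  qed
  obtain \<phi>1 where \<phi>1: "alg_hom R0 L \<phi>1" "\<And>a. a \<in> carrier A \<Longrightarrow> \<phi>1 (IZ +>\<^bsub>A\<^esub> a) = \<pi> (act_A n q g a)"
    by (rule quot_lift_Idl[OF A_kalg IZ_gens L_kalg h z, folded IZ_def]) simp_all
  have u: "\<exists>w\<in>carrier L. \<phi>1 s \<otimes>\<^bsub>L\<^esub> w = \<one>\<^bsub>L\<^esub> \<and> w \<otimes>\<^bsub>L\<^esub> \<phi>1 s = \<one>\<^bsub>L\<^esub>" if s: "s \<in> S0" for s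
  proof -
    obtain i j where ij: "s = IZ +>\<^bsub>A\<^esub> X i j" "(i, j) \<in> Dg" using s by (auto simp: S0_def)
    have n: "{i, j} \<subseteq> {1..n}" using ij(2) Dg_sub mat_idx_iff by blast
    have e: "\<phi>1 s = \<chi> g i j \<odot>\<^bsub>L\<^esub> Xl i j" using \<phi>1(2)[OF X_closed[OF n]] v[OF n] ij(1) by simp
    show ?thesis
      using Xi_inv[OF ij(2)] Xl_closed[OF n] \<chi>_nonzero[OF g n] unfolding e
      by (intro bexI[of _ "inverse (\<chi> g i j) \<odot>\<^bsub>L\<^esub> Xi i j"])
        (simp_all add: L.smult_mult_left L.smult_mult_right L.smult_smult)
  qed
  \<comment> \<open>An element of \<open>S0\<close> may a priori be the class of more than one
    entry, so its inverse is chosen for the class and not by the indices.\<close>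
  define \<psi> where "\<psi> s = (SOME w. w \<in> carrier L \<and> \<phi>1 s \<otimes>\<^bsub>L\<^esub> w = \<one>\<^bsub>L\<^esub> \<and> w \<otimes>\<^bsub>L\<^esub> \<phi>1 s = \<one>\<^bsub>L\<^esub>)" for s
  have \<psi>: "\<psi> s \<in> carrier L \<and> \<phi>1 s \<otimes>\<^bsub>L\<^esub> \<psi> s = \<one>\<^bsub>L\<^esub> \<and> \<psi> s \<otimes>\<^bsub>L\<^esub> \<phi>1 s = \<one>\<^bsub>L\<^esub>" if "s \<in> S0" for s
    unfolding \<psi>_def using u[OF that, unfolded Bex_def] by (rule someI_ex)
  obtain \<phi> where \<phi>: "alg_hom L L \<phi>" "\<And>a. a \<in> carrier R0 \<Longrightarrow> \<phi> (loc_map R0 S0 a) = \<phi>1 a"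
    by (rule Lo.loc_lift[OF L_kalg \<phi>1(1), of \<psi>]) (simp_all add: \<psi>)
  show ?thesis
    by (rule that[OF \<phi>(1)]) (subst \<pi>_def, simp add: \<phi>(2) \<phi>1(2) QI.quot_closed)
qed

lemma hom_eq_on_L:
  assumes "alg_hom L L \<phi>" "alg_hom L L \<psi>" "\<And>i j. {i, j} \<subseteq> {1..n} \<Longrightarrow> \<phi> (Xl i j) = \<psi> (Xl i j)"
    and "y \<in> Lgens"
  shows "\<phi> y = \<psi> y"
proof -
  from assms(4) consider i j where "y = Xl i j" "(i, j) \<in> mat_idx n" | i j where "y = Xi i j" "(i, j) \<in> Dg"
    unfolding Lgens_def by blast
  then show ?thesis
  proof cases
    case 1
    then show ?thesis using assms(3) by (simp add: mat_idx_def)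
  next
    case 2
    have n: "{i, j} \<subseteq> {1..n}" using 2 Dg_sub mat_idx_iff by blast
    show ?thesis unfolding 2(1)
      by (rule alg_hom_inverse_unique[OF L_kalg L_kalg assms(1,2) Xl_closed[OF n] Xi_inv(1-3)[OF 2(2)] assms(3)[OF n]])
  qed
qed

text \<open>\<open>induced_aut\<close> prescribes values only on the image of \<open>A\<close>.
  Uniqueness still holds, since the adjoined inverses follow by \<open>hom_eq_on_L\<close>, and
  their weights by \<open>alg_hom_inverse_scale\<close>.\<close>

lemma act_L:
  assumes g: "torus_elem g"
  shows "induced_aut A L \<pi> (act_A n q g) \<in> alg_aut L"
    "{i, j} \<subseteq> {1..n} \<Longrightarrow> induced_aut A L \<pi> (act_A n q g) (Xl i j) = \<chi> g i j \<odot>\<^bsub>L\<^esub> Xl i j"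
    "(i, j) \<in> Dg \<Longrightarrow> induced_aut A L \<pi> (act_A n q g) (Xi i j) = inverse (\<chi> g i j) \<odot>\<^bsub>L\<^esub> Xi i j"
proof -
  interpret L: kalg L by (rule L_kalg)
  interpret p: kalg_hom A L \<pi> by unfold_locales (rule \<pi>_hom)
  define g' where "g' = ((\<lambda>i. inverse (fst g i)), (\<lambda>i. inverse (snd g i)))"
  have g': "torus_elem g'" using g by (simp add: torus_elem_def g'_def)
  have gg: "\<chi> g i j * \<chi> g' i j = 1" if "{i, j} \<subseteq> {1..n}" for i j
    using \<chi>_nonzero[OF g that] by (simp add: \<chi>_def g'_def field_simps)
  obtain \<phi> where \<phi>: "alg_hom L L \<phi>" "\<And>a. a \<in> carrier A \<Longrightarrow> \<phi> (\<pi> a) = \<pi> (act_A n q g a)"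
    using scale_hom_L[OF g] by blast
  obtain \<psi> where \<psi>: "alg_hom L L \<psi>" "\<And>a. a \<in> carrier A \<Longrightarrow> \<psi> (\<pi> a) = \<pi> (act_A n q g' a)"
    using scale_hom_L[OF g'] by blast
  have v: "\<phi> (Xl i j) = \<chi> g i j \<odot>\<^bsub>L\<^esub> Xl i j" "\<psi> (Xl i j) = \<chi> g' i j \<odot>\<^bsub>L\<^esub> Xl i j" if "{i, j} \<subseteq> {1..n}" for i j
    using act_A(2)[OF g that] act_A(2)[OF g' that] X_closed[OF that] \<phi>(2) \<psi>(2) by (simp_all add: p.hom_smult)
  let ?\<phi> = "restrict \<phi> (carrier L)"
  have aut: "?\<phi> \<in> alg_aut L"
  proof (rule alg_autI[OF L_kalg \<phi>(1) \<psi>(1) Lgens_sub L_gen])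
    fix s assume s: "s \<in> Lgens"
    show "\<psi> (\<phi> s) = s"
      using alg_hom_comp[OF \<phi>(1) \<psi>(1)] alg_hom_id _ s
    proof (rule hom_eq_on_L)
      show "\<psi> (\<phi> (Xl i j)) = Xl i j" if "{i, j} \<subseteq> {1..n}" for i j
        using v[OF that] gg[OF that] Xl_closed[OF that] alg_homD(4)[OF \<psi>(1)]
        by (simp add: L.smult_smult mult.commute)
    qed
    show "\<phi> (\<psi> s) = s"
      using alg_hom_comp[OF \<psi>(1) \<phi>(1)] alg_hom_id _ s
    proof (rule hom_eq_on_L)
      show "\<phi> (\<psi> (Xl i j)) = Xl i j" if "{i, j} \<subseteq> {1..n}" for i j
        using v[OF that] gg[OF that] Xl_closed[OF that] alg_homD(4)[OF \<phi>(1)]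
        by (simp add: L.smult_smult mult.commute)
    qed
  qed
  have eq: "induced_aut A L \<pi> (act_A n q g) = ?\<phi>"
    unfolding induced_aut_def
  proof (rule the_equality)
    show w: "?\<phi> \<in> alg_aut L \<and> (\<forall>a\<in>carrier A. ?\<phi> (\<pi> a) = \<pi> (act_A n q g a))"
      using aut \<phi>(2) p.hom_closed by simp
    fix \<theta> assume th: "\<theta> \<in> alg_aut L \<and> (\<forall>a\<in>carrier A. \<theta> (\<pi> a) = \<pi> (act_A n q g a))"
    show "\<theta> = ?\<phi>"
    proof (rule alg_aut_eqI[OF L_kalg _ aut Lgens_sub L_gen])
      fix s assume s: "s \<in> Lgens"
      show "\<theta> s = ?\<phi> s"
      proof (rule hom_eq_on_L[OF _ _ _ s])
        show "alg_hom L L \<theta>" "alg_hom L L ?\<phi>" using th aut by (auto intro: alg_aut_alg_hom)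
        show "\<theta> (Xl i j) = ?\<phi> (Xl i j)" if "{i, j} \<subseteq> {1..n}" for i j
          using bspec[OF conjunct2[OF th] X_closed[OF that]] bspec[OF conjunct2[OF w] X_closed[OF that]] by simp
      qed
    qed (use th in simp)
  qed
  show "induced_aut A L \<pi> (act_A n q g) \<in> alg_aut L" unfolding eq by (rule aut)
  show val: "induced_aut A L \<pi> (act_A n q g) (Xl i j) = \<chi> g i j \<odot>\<^bsub>L\<^esub> Xl i j" if "{i, j} \<subseteq> {1..n}" for i j
    unfolding eq using v(1)[OF that] Xl_closed[OF that] by simp
  show "induced_aut A L \<pi> (act_A n q g) (Xi i j) = inverse (\<chi> g i j) \<odot>\<^bsub>L\<^esub> Xi i j" if "(i, j) \<in> Dg"
  proof -
    have n: "{i, j} \<subseteq> {1..n}" using that Dg_sub mat_idx_iff by blast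
    note u = Xl_closed[OF n] Xi_inv(1-3)[OF that]
    have h: "alg_hom L L (induced_aut A L \<pi> (act_A n q g))"
      unfolding eq using aut by (rule alg_aut_alg_hom)
    show ?thesis
      by (rule alg_hom_inverse_scale[OF L_kalg L_kalg h u u val[OF n] \<chi>_nonzero[OF g n]])
  qed
qed

end

section \<open>Automorphisms of tensor products\<close>

lemma (in kalg) commute_inverse:
  assumes "u \<in> carrier A" "v \<in> carrier A" "v' \<in> carrier A" "v \<otimes> v' = \<one>" "v' \<otimes> v = \<one>" "u \<otimes> v = v \<otimes> u"
  shows "u \<otimes> v' = v' \<otimes> u"
proof -
  have "u \<otimes> v' = v' \<otimes> (v \<otimes> u) \<otimes> v'" using assms by (simp add: m_assoc[symmetric])
  also have "\<dots> = v' \<otimes> u \<otimes> (v \<otimes> v')" unfolding assms(6)[symmetric] using assms(1-3) by (simp add: m_assoc)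
  finally show ?thesis using assms by simp
qed

lemma alg_aut_inverse:
  assumes "kalg A" "\<phi> \<in> alg_aut A"
  obtains \<psi> where "alg_hom A A \<psi>" "\<And>x. x \<in> carrier A \<Longrightarrow> \<psi> (\<phi> x) = x" "\<And>x. x \<in> carrier A \<Longrightarrow> \<phi> (\<psi> x) = x"
proof -
  interpret kalg A by fact
  note h = alg_homD[OF alg_aut_alg_hom[OF assms(2)]]
  have bij: "bij_betw \<phi> (carrier A) (carrier A)" using assms(2) by (simp add: alg_aut_def)
  define \<psi> where "\<psi> = inv_into (carrier A) \<phi>"
  have l: "\<psi> (\<phi> x) = x" if "x \<in> carrier A" for x
    unfolding \<psi>_def using bij that by (rule bij_betw_inv_into_left)
  have r: "\<phi> (\<psi> x) = x" if "x \<in> carrier A" for x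
    unfolding \<psi>_def using bij that by (rule bij_betw_inv_into_right)
  have c: "\<psi> x \<in> carrier A" if "x \<in> carrier A" for x
    unfolding \<psi>_def using bij that by (metis bij_betw_def inv_into_into)
  have eq: "\<psi> y = x" if "x \<in> carrier A" "y = \<phi> x" for x y using l that by simp
  have "alg_hom A A \<psi>"
    by (rule alg_homI) (auto intro!: eq simp: c h r)
  then show ?thesis using l r by (rule that)
qed

text \<open>The inverse is induced by the inverses of the two factors, and a homomorphism on the
  tensor product is determined by its values on pure tensors.\<close>

lemma (in tensor_setup) tensor_aut:
  assumes f: "f \<in> alg_aut R" and g: "g \<in> alg_aut S"
  shows "tensor_aut R S f g \<in> alg_aut T"
    "a \<in> carrier R \<Longrightarrow> b \<in> carrier S \<Longrightarrow> tensor_aut R S f g (pt a b) = pt (f a) (g b)"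
proof -
  note fh = alg_aut_alg_hom[OF f] note gh = alg_aut_alg_hom[OF g]
  let ?P = "{pt a b |a b. a \<in> carrier R \<and> b \<in> carrier S}"
  have P: "?P \<subseteq> carrier T" using pt_closed by auto
  obtain f' where f': "alg_hom R R f'" "\<And>x. x \<in> carrier R \<Longrightarrow> f' (f x) = x" "\<And>x. x \<in> carrier R \<Longrightarrow> f (f' x) = x"
    by (rule alg_aut_inverse[OF R.kalg_axioms f]) blast
  obtain g' where g': "alg_hom S S g'" "\<And>x. x \<in> carrier S \<Longrightarrow> g' (g x) = x" "\<And>x. x \<in> carrier S \<Longrightarrow> g (g' x) = x"
    by (rule alg_aut_inverse[OF S.kalg_axioms g]) blast
  obtain \<phi> where \<phi>: "alg_hom T T \<phi>" "\<And>a b. a \<in> carrier R \<Longrightarrow> b \<in> carrier S \<Longrightarrow> \<phi> (pt a b) = pt (f a) (g b)"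
    by (rule tensor_hom[OF fh gh]) blast
  obtain \<psi> where \<psi>: "alg_hom T T \<psi>" "\<And>a b. a \<in> carrier R \<Longrightarrow> b \<in> carrier S \<Longrightarrow> \<psi> (pt a b) = pt (f' a) (g' b)"
    by (rule tensor_hom[OF f'(1) g'(1)]) blast
  note cl = alg_homD(1)[OF fh] alg_homD(1)[OF gh] alg_homD(1)[OF f'(1)] alg_homD(1)[OF g'(1)]
  let ?\<phi> = "restrict \<phi> (carrier T)"
  have aut: "?\<phi> \<in> alg_aut T"
  proof (rule alg_autI[OF tensor_kalg \<phi>(1) \<psi>(1) P tensor_gen_pure])
    fix s assume "s \<in> ?P"
    then obtain a b where s: "s = pt a b" "a \<in> carrier R" "b \<in> carrier S" by blast
    show "\<psi> (\<phi> s) = s" "\<phi> (\<psi> s) = s" using s(2,3) unfolding s(1) by (simp_all add: \<phi>(2) \<psi>(2) cl f'(2,3) g'(2,3))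
  qed
  have val: "?\<phi> (pt a b) = pt (f a) (g b)" if "a \<in> carrier R" "b \<in> carrier S" for a b
    using \<phi>(2)[OF that] pt_closed[OF that] by simp
  have eq: "tensor_aut R S f g = ?\<phi>"
    unfolding tensor_aut_def
  proof (rule the_equality)
    show "?\<phi> \<in> alg_aut T \<and> (\<forall>a\<in>carrier R. \<forall>b\<in>carrier S. ?\<phi> (pt a b) = pt (f a) (g b))"
      using aut val by blast
    fix \<theta> assume th: "\<theta> \<in> alg_aut T \<and> (\<forall>a\<in>carrier R. \<forall>b\<in>carrier S. \<theta> (pt a b) = pt (f a) (g b))"
    show "\<theta> = ?\<phi>"
    proof (rule alg_aut_eqI[OF tensor_kalg _ aut P tensor_gen_pure])
      fix s assume "s \<in> ?P"
      then obtain a b where s: "s = pt a b" "a \<in> carrier R" "b \<in> carrier S" by blast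
      show "\<theta> s = ?\<phi> s" unfolding s(1) val[OF s(2,3)] using th s(2,3) by simp
    qed (use th in simp)
  qed
  show "tensor_aut R S f g \<in> alg_aut T" unfolding eq by (rule aut)
  show "tensor_aut R S f g (pt a b) = pt (f a) (g b)" if "a \<in> carrier R" "b \<in> carrier S"
    unfolding eq using that by (rule val)
qed

section \<open>Localization at entries that commute with the others up to scalars\<close>

locale qmat_diag = qmat_loc n q Z Dg for n :: nat and q :: "'k::field" and Z Dg +
  fixes t :: nat and dg :: "nat \<Rightarrow> nat \<times> nat" and \<kappa> :: "nat \<Rightarrow> nat \<times> nat \<Rightarrow> 'k"
  assumes Dg_eq: "Dg = dg ` {1..t}"
    and normal: "l \<in> {1..t} \<Longrightarrow> p \<in> mat_idx n - Z \<Longrightarrow> case_prod Xl (dg l) \<otimes>\<^bsub>L\<^esub> case_prod Xl p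
      = \<kappa> l p \<odot>\<^bsub>L\<^esub> (case_prod Xl p \<otimes>\<^bsub>L\<^esub> case_prod Xl (dg l))"
    and \<kappa>_nonzero: "\<kappa> l p \<noteq> 0"
    and \<kappa>_dg: "l \<in> {1..t} \<Longrightarrow> m \<in> {1..t} \<Longrightarrow> \<kappa> l (dg m) = 1"
    and dg_nonzero: "l \<in> {1..t} \<Longrightarrow> dg l \<notin> Z"
begin

text \<open>The Boolean selects the entry or its inverse, so \<open>U l (\<not> e)\<close> is always
  the inverse of \<open>U l e\<close> and one statement covers both signs.\<close>

definition U :: "nat \<Rightarrow> bool \<Rightarrow> 'k qm_loc" where
  "U l e = (if e then case_prod Xl (dg l) else inv\<^bsub>L\<^esub> (case_prod Xl (dg l)))"

definition \<kappa>' :: "nat \<Rightarrow> bool \<Rightarrow> nat \<times> nat \<Rightarrow> 'k" where "\<kappa>' l e p = (if e then \<kappa> l p else inverse (\<kappa> l p))"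

lemma dg_idx: "l \<in> {1..t} \<Longrightarrow> dg l \<in> mat_idx n - Z"
  using Dg_sub dg_nonzero Dg_eq by auto

lemma X_at_closed: "p \<in> mat_idx n \<Longrightarrow> case_prod Xl p \<in> carrier L"
  using Xl_closed by (cases p) (simp add: mat_idx_def)

lemma U_closed: "l \<in> {1..t} \<Longrightarrow> U l e \<in> carrier L"
  and U_inv: "l \<in> {1..t} \<Longrightarrow> U l e \<otimes>\<^bsub>L\<^esub> U l (\<not> e) = \<one>\<^bsub>L\<^esub>"
proof -
  assume l: "l \<in> {1..t}"
  obtain i j where ij: "dg l = (i, j)" by (cases "dg l")
  have "(i, j) \<in> Dg" unfolding Dg_eq using l ij by (metis imageI)
  note inv = Xi_inv[OF this]
  have "Xl i j \<in> carrier L" using X_at_closed[of "dg l"] dg_idx[OF l] ij by simp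
  then show "U l e \<in> carrier L" "U l e \<otimes>\<^bsub>L\<^esub> U l (\<not> e) = \<one>\<^bsub>L\<^esub>"
    using inv ij by (simp_all add: U_def)
qed

lemma U_conj:
  assumes l: "l \<in> {1..t}" and p: "p \<in> mat_idx n - Z"
  shows "U l e \<otimes>\<^bsub>L\<^esub> case_prod Xl p \<otimes>\<^bsub>L\<^esub> U l (\<not> e) = \<kappa>' l e p \<odot>\<^bsub>L\<^esub> case_prod Xl p"
proof -
  interpret L: kalg L by (rule L_kalg)
  define x u v where "x = case_prod Xl p" "u = U l True" "v = U l False"
  have c: "x \<in> carrier L" "u \<in> carrier L" "v \<in> carrier L"
    using X_at_closed[of p] p U_closed[OF l] by (simp_all add: x_u_v_def)
  have uv: "u \<otimes>\<^bsub>L\<^esub> v = \<one>\<^bsub>L\<^esub>" "v \<otimes>\<^bsub>L\<^esub> u = \<one>\<^bsub>L\<^esub>" using U_inv[OF l, of True] U_inv[OF l, of False] by (simp_all add: x_u_v_def)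
  have n: "u \<otimes>\<^bsub>L\<^esub> x = \<kappa> l p \<odot>\<^bsub>L\<^esub> (x \<otimes>\<^bsub>L\<^esub> u)" using normal[OF l p] by (simp add: x_u_v_def U_def)
  have 1: "u \<otimes>\<^bsub>L\<^esub> x \<otimes>\<^bsub>L\<^esub> v = \<kappa> l p \<odot>\<^bsub>L\<^esub> x"
    unfolding n using c uv by (simp add: L.smult_mult_left L.m_assoc)
  \<comment> \<open>Conjugation by the inverse is obtained by solving
    \<open>u x = \<kappa> l p x u\<close> for \<open>v x u\<close>, which requires dividing by
    \<open>\<kappa> l p\<close>.\<close>
  have "v \<otimes>\<^bsub>L\<^esub> (u \<otimes>\<^bsub>L\<^esub> x) = x" using c uv by (simp flip: L.m_assoc)
  then have "\<kappa> l p \<odot>\<^bsub>L\<^esub> (v \<otimes>\<^bsub>L\<^esub> x \<otimes>\<^bsub>L\<^esub> u) = x"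
    unfolding n using c by (simp add: L.smult_mult_right L.m_assoc)
  then have "inverse (\<kappa> l p) \<odot>\<^bsub>L\<^esub> x = inverse (\<kappa> l p) \<odot>\<^bsub>L\<^esub> (\<kappa> l p \<odot>\<^bsub>L\<^esub> (v \<otimes>\<^bsub>L\<^esub> x \<otimes>\<^bsub>L\<^esub> u))" by simp
  also have "\<dots> = v \<otimes>\<^bsub>L\<^esub> x \<otimes>\<^bsub>L\<^esub> u" using c \<kappa>_nonzero[of l p] by (simp add: L.smult_smult)
  finally show ?thesis using 1 by (cases e) (simp_all add: x_u_v_def \<kappa>'_def)
qed

text \<open>\<open>\<kappa>_dg\<close> makes the entries themselves commute, and commutation passes
  to inverses one side at a time.\<close>

lemma U_comm:
  assumes l: "l \<in> {1..t}" and m: "m \<in> {1..t}"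
  shows "U l e \<otimes>\<^bsub>L\<^esub> U m e' = U m e' \<otimes>\<^bsub>L\<^esub> U l e"
proof -
  interpret L: kalg L by (rule L_kalg)
  note c = U_closed[OF l] U_closed[OF m]
  note il = U_inv[OF l, of True] U_inv[OF l, of False]
  note im = U_inv[OF m, of True] U_inv[OF m, of False]
  have 1: "U l True \<otimes>\<^bsub>L\<^esub> U m True = U m True \<otimes>\<^bsub>L\<^esub> U l True"
    using normal[OF l dg_idx[OF m]] \<kappa>_dg[OF l m] c[of True] by (simp add: U_def)
  have 2: "U l True \<otimes>\<^bsub>L\<^esub> U m e' = U m e' \<otimes>\<^bsub>L\<^esub> U l True" for e'
    using 1 L.commute_inverse[of "U l True" "U m True" "U m False"] c im by (cases e') simp_all
  have "U m e' \<otimes>\<^bsub>L\<^esub> U l False = U l False \<otimes>\<^bsub>L\<^esub> U m e'"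
    using L.commute_inverse[of "U m e'" "U l True" "U l False"] c il 2[of e'] by simp
  then show ?thesis using 2[of e'] by (cases e) simp_all
qed

lemma act_U:
  assumes g: "torus_elem g" and l: "l \<in> {1..t}"
  shows "induced_aut A L \<pi> (act_A n q g) (U l e)
    = (if e then case_prod (\<chi> g) (dg l) else inverse (case_prod (\<chi> g) (dg l))) \<odot>\<^bsub>L\<^esub> U l e"
proof -
  obtain i j where ij: "dg l = (i, j)" by (cases "dg l")
  have d: "(i, j) \<in> Dg" unfolding Dg_eq using l ij by (metis imageI)
  have "{i, j} \<subseteq> {1..n}" using dg_idx[OF l] ij by (simp add: mat_idx_def)
  then show ?thesis using act_L(2,3)[OF g] d ij by (simp add: U_def)
qed

end

section \<open>The algebras of the theorem\<close>

locale rc_data =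
  fixes n :: nat and q :: "'k::field" and r c :: "nat list"
  assumes q_nonzero: "q \<noteq> 0" and RC: "(r, c) \<in> RC n"
begin

abbreviation t where "t \<equiv> length r"

lemma length_c: "length c = t"
  using RC by (simp add: RC_def)

lemma entry_strict_mono:
  assumes "l \<in> {1..t}" "m \<in> {1..t}" "l < m"
  shows "entry r l < entry r m" "entry c l < entry c m"
proof -
  have "sorted_wrt (<) r" "sorted_wrt (<) c" using RC by (simp_all add: RC_def)
  moreover have "l - 1 < m - 1" "m - 1 < length r" "m - 1 < length c" using assms length_c by auto
  ultimately show "entry r l < entry r m" "entry c l < entry c m"
    unfolding entry_def by (simp_all add: sorted_wrt_nth_less)
qed

lemma entry_range:
  assumes "l \<in> {1..t}" shows "entry r l \<in> {1..n}" "entry c l \<in> {1..n}"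
proof -
  have "r ! (l - 1) \<in> set r" "c ! (l - 1) \<in> set c" using assms length_c by auto
  moreover have "set r \<subseteq> {1..n}" "set c \<subseteq> {1..n}" using RC by (simp_all add: RC_def)
  ultimately show "entry r l \<in> {1..n}" "entry c l \<in> {1..n}" unfolding entry_def by blast+
qed

text \<open>The number l is also a column index of Y and a row index of Z, so it has to lie within
  the matrix.\<close>

lemma t_le_n: "t \<le> n"
proof -
  have "distinct r" "set r \<subseteq> {1..n}" using RC by (auto simp: RC_def strict_sorted_iff)
  then show ?thesis using card_mono[of "{1..n}" "set r"] distinct_card[of r] by simp
qed

lemma l_range: "l \<in> {1..t} \<Longrightarrow> l \<in> {1..n}"
  using t_le_n by auto

lemma entry_inj:
  assumes "l \<in> {1..t}" "m \<in> {1..t}"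
  shows "entry r l = entry r m \<longleftrightarrow> l = m" "entry c l = entry c m \<longleftrightarrow> l = m"
  using entry_strict_mono[OF assms] entry_strict_mono[OF assms(2,1)]
  by (cases l m rule: linorder_cases, simp, simp, simp)+

lemma entry_le:
  assumes "l \<in> {1..t}" "m \<in> {1..t}"
  shows "entry r l \<le> entry r m \<longleftrightarrow> l \<le> m" "entry c l \<le> entry c m \<longleftrightarrow> l \<le> m"
  using entry_strict_mono[OF assms] entry_strict_mono[OF assms(2,1)]
  by (cases l m rule: linorder_cases, simp, simp, simp)+

section \<open>Surviving positions and conjugation factors\<close>

definition Zp where "Zp = {(i, j). (i, j) \<in> mat_idx n \<and> (j > length r \<or> i < entry r j)}"
definition Zm where "Zm = {(i, j). (i, j) \<in> mat_idx n \<and> (i > length c \<or> j < entry c i)}"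

definition dp where "dp l = (entry r l, l)"
definition dm where "dm l = (l, entry c l)"
definition Dp where "Dp = dp ` {1..t}"
definition Dm where "Dm = dm ` {1..t}"

text \<open>Conjugation by \<open>Y\<^bsub>r_l l\<^esub>\<close> is the torus element scaling column \<open>l\<close> by \<open>q\<close> and row \<open>r_l\<close> by
  \<open>inverse q\<close>; dually for \<open>Z\<^bsub>l c_l\<^esub>\<close>.\<close>

definition \<kappa>p :: "nat \<Rightarrow> nat \<times> nat \<Rightarrow> 'k" where
  "\<kappa>p l p = (if snd p = l then q else 1) * (if fst p = entry r l then inverse q else 1)"
definition \<kappa>m :: "nat \<Rightarrow> nat \<times> nat \<Rightarrow> 'k" where
  "\<kappa>m l p = (if fst p = l then q else 1) * (if snd p = entry c l then inverse q else 1)"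

text \<open>The surviving entries of Y fill the columns up to \<open>t\<close>, with column l
  starting at row r_l. This is the range of \<open>(i, l)\<close> in \<open>B_gens\<close>.\<close>

lemma idx_p: "(i, l) \<in> mat_idx n - Zp \<longleftrightarrow> l \<in> {1..t} \<and> i \<in> {entry r l..n}"
proof
  assume "(i, l) \<in> mat_idx n - Zp"
  then show "l \<in> {1..t} \<and> i \<in> {entry r l..n}" by (auto simp: mat_idx_def Zp_def)
next
  assume a: "l \<in> {1..t} \<and> i \<in> {entry r l..n}"
  then have "l \<in> {1..n}" "entry r l \<in> {1..n}" using l_range entry_range(1) by blast+
  then show "(i, l) \<in> mat_idx n - Zp" using a by (simp add: mat_idx_def Zp_def)
qed

lemma idx_m: "(l, j) \<in> mat_idx n - Zm \<longleftrightarrow> l \<in> {1..t} \<and> j \<in> {entry c l..n}"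
proof
  assume "(l, j) \<in> mat_idx n - Zm"
  then show "l \<in> {1..t} \<and> j \<in> {entry c l..n}" by (auto simp: mat_idx_def Zm_def length_c)
next
  assume a: "l \<in> {1..t} \<and> j \<in> {entry c l..n}"
  then have "l \<in> {1..n}" "entry c l \<in> {1..n}" using l_range entry_range(2) by blast+
  then show "(l, j) \<in> mat_idx n - Zm" using a by (simp add: mat_idx_def Zm_def length_c)
qed

lemma dp_idx: "l \<in> {1..t} \<Longrightarrow> dp l \<in> mat_idx n - Zp"
  using entry_range(1)[of l] unfolding dp_def idx_p by simp

lemma dm_idx: "l \<in> {1..t} \<Longrightarrow> dm l \<in> mat_idx n - Zm"
  using entry_range(2)[of l] unfolding dm_def idx_m by simp

lemma Dp_mem: "(i, j) \<in> Dp \<longleftrightarrow> (\<exists>s. i = entry r s \<and> j = s \<and> s \<in> {1..t})"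
  unfolding Dp_def dp_def by blast

lemma Dm_mem: "(i, j) \<in> Dm \<longleftrightarrow> (\<exists>s. i = s \<and> j = entry c s \<and> s \<in> {1..t})"
  unfolding Dm_def dm_def by blast

lemma loc_p: "qmat_loc n Zp Dp"
proof (rule qmat_loc.intro)
  show "Zp \<subseteq> mat_idx n" by (auto simp: Zp_def)
  show "Dp \<subseteq> mat_idx n" unfolding Dp_def using dp_idx by blast
qed

lemma loc_m: "qmat_loc n Zm Dm"
proof (rule qmat_loc.intro)
  show "Zm \<subseteq> mat_idx n" by (auto simp: Zm_def)
  show "Dm \<subseteq> mat_idx n" unfolding Dm_def using dm_idx by blast
qed

sublocale P: qmat_diag n q Zp Dp t dp \<kappa>p
proof (rule qmat_diag.intro[OF loc_p], rule qmat_diag_axioms.intro)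
  interpret L: qmat_loc n q Zp Dp by (rule loc_p)
  interpret K: kalg L.L by (rule L.L_kalg)
  fix l p assume l: "l \<in> {1..t}" and p: "p \<in> mat_idx n - Zp"
  obtain i m where im: "p = (i, m)" by (cases p)
  note pm = p[unfolded im idx_p]
  let ?a = "entry r l"
  have idx: "{?a, l, i, m} \<subseteq> {1..n}" using entry_range[OF l] l_range[OF l] p[unfolded im] by (simp add: mat_idx_def)
  have "L.Xl ?a l \<otimes>\<^bsub>L.L\<^esub> L.Xl i m = (q powi ((if i = ?a then sgn (int m - int l) else 0) +
     (if m = l then sgn (int i - int ?a) else 0))) \<odot>\<^bsub>L.L\<^esub> (L.Xl i m \<otimes>\<^bsub>L.L\<^esub> L.Xl ?a l)"
  proof (rule qmat_relations_normal[OF L.L_kalg L.Xl_relations q_nonzero idx])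
    \<comment> \<open>One factor of each correction term is killed: above and to the left of the
      pivot \<open>(?a, l)\<close> it is \<open>(i, l)\<close>, which lies above r_l; below and to
      the right it is \<open>(?a, m)\<close>, which lies above r_m because r is increasing.\<close>
    show "L.Xl i l \<otimes>\<^bsub>L.L\<^esub> L.Xl ?a m = \<zero>\<^bsub>L.L\<^esub>" if "i < ?a" "m < l"
    proof -
      have "(i, l) \<in> Zp" using that idx by (auto simp: Zp_def mat_idx_def)
      then show ?thesis using L.Xl_zero L.Xl_closed[of ?a m] idx by simp
    qed
    show "L.Xl ?a m \<otimes>\<^bsub>L.L\<^esub> L.Xl i l = \<zero>\<^bsub>L.L\<^esub>" if "?a < i" "l < m"
    proof -
      have "(?a, m) \<in> Zp" using entry_strict_mono(1)[OF l _ that(2)] pm idx by (auto simp: Zp_def mat_idx_def)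
      then show ?thesis using L.Xl_zero L.Xl_closed[of i l] idx by simp
    qed
  qed
  \<comment> \<open>The signs are forced by the staircase shape: an entry surviving in row r_l has
    column at most l, and one surviving in column l has row at least r_l.\<close>
  moreover have "q powi ((if i = ?a then sgn (int m - int l) else 0) +
     (if m = l then sgn (int i - int ?a) else 0)) = \<kappa>p l p"
  proof -
    consider "i = ?a" "m = l" | "i = ?a" "m \<noteq> l" | "i \<noteq> ?a" "m = l" | "i \<noteq> ?a" "m \<noteq> l" by blast
    then show ?thesis
    proof cases
      case 1
      then show ?thesis using q_nonzero by (simp add: \<kappa>p_def im)
    next
      case 2
      then have "m < l" using pm entry_le(1)[of m l] l by auto
      then show ?thesis using 2 by (simp add: \<kappa>p_def im sgn_if power_int_minus)
    next
      case 3
      then have "?a < i" using pm by auto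
      then show ?thesis using 3 by (simp add: \<kappa>p_def im sgn_if)
    next
      case 4
      then show ?thesis by (simp add: \<kappa>p_def im)
    qed
  qed
  ultimately show "case_prod L.Xl (dp l) \<otimes>\<^bsub>L.L\<^esub> case_prod L.Xl p
      = \<kappa>p l p \<odot>\<^bsub>L.L\<^esub> (case_prod L.Xl p \<otimes>\<^bsub>L.L\<^esub> case_prod L.Xl (dp l))"
    by (simp add: dp_def im)
next
  show "Dp = dp ` {1..t}" by (rule Dp_def)
  show "\<kappa>p l p \<noteq> 0" for l p using q_nonzero by (simp add: \<kappa>p_def)
  show "\<kappa>p l (dp m) = 1" if "l \<in> {1..t}" "m \<in> {1..t}" for l m
    using entry_inj(1)[OF that] q_nonzero by (auto simp: \<kappa>p_def dp_def)
  show "dp l \<notin> Zp" if "l \<in> {1..t}" for l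
    using dp_idx[OF that] by simp
qed

text \<open>The transposed argument: rows and columns exchange roles, as do \<open>r\<close> and
  \<open>c\<close>.\<close>

sublocale M: qmat_diag n q Zm Dm t dm \<kappa>m
proof (rule qmat_diag.intro[OF loc_m], rule qmat_diag_axioms.intro)
  interpret L: qmat_loc n q Zm Dm by (rule loc_m)
  interpret K: kalg L.L by (rule L.L_kalg)
  fix l p assume l: "l \<in> {1..t}" and p: "p \<in> mat_idx n - Zm"
  obtain m j where im: "p = (m, j)" by (cases p)
  note pm = p[unfolded im idx_m]
  let ?a = "entry c l"
  have idx: "{l, ?a, m, j} \<subseteq> {1..n}" using entry_range[OF l] l_range[OF l] p[unfolded im] by (simp add: mat_idx_def)
  have "L.Xl l ?a \<otimes>\<^bsub>L.L\<^esub> L.Xl m j = (q powi ((if m = l then sgn (int j - int ?a) else 0) +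
     (if j = ?a then sgn (int m - int l) else 0))) \<odot>\<^bsub>L.L\<^esub> (L.Xl m j \<otimes>\<^bsub>L.L\<^esub> L.Xl l ?a)"
  proof (rule qmat_relations_normal[OF L.L_kalg L.Xl_relations q_nonzero idx])
    show "L.Xl m ?a \<otimes>\<^bsub>L.L\<^esub> L.Xl l j = \<zero>\<^bsub>L.L\<^esub>" if "m < l" "j < ?a"
    proof -
      have "(l, j) \<in> Zm" using that idx by (auto simp: Zm_def mat_idx_def)
      then show ?thesis using L.Xl_zero L.Xl_closed[of m ?a] idx by simp
    qed
    show "L.Xl l j \<otimes>\<^bsub>L.L\<^esub> L.Xl m ?a = \<zero>\<^bsub>L.L\<^esub>" if "l < m" "?a < j"
    proof -
      have "(m, ?a) \<in> Zm" using entry_strict_mono(2)[OF l _ that(1)] pm idx by (auto simp: Zm_def mat_idx_def)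
      then show ?thesis using L.Xl_zero L.Xl_closed[of l j] idx by simp
    qed
  qed
  moreover have "q powi ((if m = l then sgn (int j - int ?a) else 0) +
     (if j = ?a then sgn (int m - int l) else 0)) = \<kappa>m l p"
  proof -
    consider "j = ?a" "m = l" | "j = ?a" "m \<noteq> l" | "j \<noteq> ?a" "m = l" | "j \<noteq> ?a" "m \<noteq> l" by blast
    then show ?thesis
    proof cases
      case 1
      then show ?thesis using q_nonzero by (simp add: \<kappa>m_def im)
    next
      case 2
      then have "m < l" using pm entry_le(2)[of m l] l by auto
      then show ?thesis using 2 by (simp add: \<kappa>m_def im sgn_if power_int_minus)
    next
      case 3
      then have "?a < j" using pm by auto
      then show ?thesis using 3 by (simp add: \<kappa>m_def im sgn_if)
    next
      case 4
      then show ?thesis by (simp add: \<kappa>m_def im)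
    qed
  qed
  ultimately show "case_prod L.Xl (dm l) \<otimes>\<^bsub>L.L\<^esub> case_prod L.Xl p
      = \<kappa>m l p \<odot>\<^bsub>L.L\<^esub> (case_prod L.Xl p \<otimes>\<^bsub>L.L\<^esub> case_prod L.Xl (dm l))"
    by (simp add: dm_def im)
next
  show "Dm = dm ` {1..t}" by (rule Dm_def)
  show "\<kappa>m l p \<noteq> 0" for l p using q_nonzero by (simp add: \<kappa>m_def)
  show "\<kappa>m l (dm m) = 1" if "l \<in> {1..t}" "m \<in> {1..t}" for l m
    using entry_inj(2)[OF that] q_nonzero by (auto simp: \<kappa>m_def dm_def)
  show "dm l \<notin> Zm" if "l \<in> {1..t}" for l
    using dm_idx[OF that] by simp
qed

text \<open>Identifies the general construction with the algebra and the map of the theorem, so that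
  facts about the former can be restated for the latter.\<close>

lemma Rplus_eq: "P.L = Rplus n q r" "P.\<pi> = to_Rplus n q r"
proof -
  have I: "P.IZ = Rplus0_ideal n q r"
    unfolding P.IZ_def Rplus0_ideal_def by (simp add: Zp_def)
  have S: "P.S0 = Ydiag n q r"
    unfolding P.S0_def Ydiag_def Y0_def I Dp_mem by blast
  show "P.L = Rplus n q r" by (simp add: Rplus_def Rplus0_def I S)
  show "P.\<pi> = to_Rplus n q r"
    by (simp add: fun_eq_iff P.\<pi>_def to_Rplus_def Rplus0_def I S)
qed

lemma Rminus_eq: "M.L = Rminus n q c" "M.\<pi> = to_Rminus n q c"
proof -
  have I: "M.IZ = Rminus0_ideal n q c"
    unfolding M.IZ_def Rminus0_ideal_def by (simp add: Zm_def)
  have S: "M.S0 = Zdiag n q c"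
    unfolding M.S0_def Zdiag_def Z0_def I length_c Dm_mem by blast
  show "M.L = Rminus n q c" by (simp add: Rminus_def Rminus0_def I S)
  show "M.\<pi> = to_Rminus n q c"
    by (simp add: fun_eq_iff M.\<pi>_def to_Rminus_def Rminus0_def I S)
qed


section \<open>Generators and torus action on R+ and R- and on their tensor product\<close>

abbreviation Rp where "Rp \<equiv> Rplus n q r"
abbreviation Rm where "Rm \<equiv> Rminus n q c"
abbreviation RT where "RT \<equiv> RR n q r c"
abbreviation pt where "pt \<equiv> pure_tensor Rp Rm"
abbreviation act where "act \<equiv> act_RR n q r c"

definition Ye :: "nat \<times> nat \<Rightarrow> 'k qm_loc" where "Ye p = (case p of (i, j) \<Rightarrow> Yel n q r i j)"
definition Ze :: "nat \<times> nat \<Rightarrow> 'k qm_loc" where "Ze p = (case p of (i, j) \<Rightarrow> Zel n q c i j)"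
abbreviation YU where "YU \<equiv> P.U"
abbreviation ZU where "ZU \<equiv> M.U"

lemma YU_eq: "YU l e = (if e then Ye (dp l) else inv\<^bsub>Rp\<^esub> (Ye (dp l)))"
  unfolding P.U_def Ye_def Rplus_eq by (simp add: case_prod_beta)

lemma ZU_eq: "ZU l e = (if e then Ze (dm l) else inv\<^bsub>Rm\<^esub> (Ze (dm l)))"
  unfolding M.U_def Ze_def Rminus_eq by (simp add: case_prod_beta)

lemmas Rp_kalg = P.L_kalg[unfolded Rplus_eq]
lemmas Rm_kalg = M.L_kalg[unfolded Rminus_eq]

lemma Ye_closed: "p \<in> mat_idx n \<Longrightarrow> Ye p \<in> carrier Rp"
  using P.X_at_closed[unfolded Rplus_eq] by (simp add: Ye_def)

lemma Ze_closed: "p \<in> mat_idx n \<Longrightarrow> Ze p \<in> carrier Rm"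
  using M.X_at_closed[unfolded Rminus_eq] by (simp add: Ze_def)

lemmas YU_closed = P.U_closed[unfolded Rplus_eq]
lemmas ZU_closed = M.U_closed[unfolded Rminus_eq]
lemmas YU_inv = P.U_inv[unfolded Rplus_eq]
lemmas ZU_inv = M.U_inv[unfolded Rminus_eq]
lemmas YU_comm = P.U_comm[unfolded Rplus_eq]
lemmas ZU_comm = M.U_comm[unfolded Rminus_eq]

lemma YU_conj: "l \<in> {1..t} \<Longrightarrow> p \<in> mat_idx n - Zp \<Longrightarrow>
    YU l e \<otimes>\<^bsub>Rp\<^esub> Ye p \<otimes>\<^bsub>Rp\<^esub> YU l (\<not> e) = P.\<kappa>' l e p \<odot>\<^bsub>Rp\<^esub> Ye p"
  using P.U_conj[unfolded Rplus_eq, of l p e] by (simp add: Ye_def)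

lemma ZU_conj: "l \<in> {1..t} \<Longrightarrow> p \<in> mat_idx n - Zm \<Longrightarrow>
    ZU l e \<otimes>\<^bsub>Rm\<^esub> Ze p \<otimes>\<^bsub>Rm\<^esub> ZU l (\<not> e) = M.\<kappa>' l e p \<odot>\<^bsub>Rm\<^esub> Ze p"
  using M.U_conj[unfolded Rminus_eq, of l p e] by (simp add: Ze_def)

lemma act_plus_aut: "P.torus_elem g \<Longrightarrow> act_plus n q r g \<in> alg_aut Rp"
  unfolding act_plus_def using P.act_L(1)[unfolded Rplus_eq] .

lemma act_minus_aut: "P.torus_elem g \<Longrightarrow> act_minus n q c g \<in> alg_aut Rm"
  unfolding act_minus_def using M.act_L(1)[unfolded Rminus_eq] .

lemma act_plus_Ye: "P.torus_elem g \<Longrightarrow> p \<in> mat_idx n \<Longrightarrow>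
    act_plus n q r g (Ye p) = case_prod (P.\<chi> g) p \<odot>\<^bsub>Rp\<^esub> Ye p"
  using P.act_L(2)[unfolded Rplus_eq, of g "fst p" "snd p"]
  unfolding act_plus_def Ye_def by (cases p) (simp add: mat_idx_def)

lemma act_minus_Ze: "P.torus_elem g \<Longrightarrow> p \<in> mat_idx n \<Longrightarrow>
    act_minus n q c g (Ze p) = case_prod (P.\<chi> g) p \<odot>\<^bsub>Rm\<^esub> Ze p"
  using M.act_L(2)[unfolded Rminus_eq, of g "fst p" "snd p"]
  unfolding act_minus_def Ze_def by (cases p) (simp add: mat_idx_def)

lemma act_plus_YU: "P.torus_elem g \<Longrightarrow> l \<in> {1..t} \<Longrightarrow> act_plus n q r g (YU l e) =
    (if e then case_prod (P.\<chi> g) (dp l) else inverse (case_prod (P.\<chi> g) (dp l))) \<odot>\<^bsub>Rp\<^esub> YU l e"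
  using P.act_U[unfolded Rplus_eq] unfolding act_plus_def .

lemma act_minus_ZU: "P.torus_elem g \<Longrightarrow> l \<in> {1..t} \<Longrightarrow> act_minus n q c g (ZU l e) =
    (if e then case_prod (P.\<chi> g) (dm l) else inverse (case_prod (P.\<chi> g) (dm l))) \<odot>\<^bsub>Rm\<^esub> ZU l e"
  using M.act_U[unfolded Rminus_eq] unfolding act_minus_def .

lemma Rp_gen: "{Ye p |p. p \<in> mat_idx n - Zp} \<union> {YU l False |l. l \<in> {1..t}} \<subseteq> carrier Rp"
  "subalg_gen Rp ({Ye p |p. p \<in> mat_idx n - Zp} \<union> {YU l False |l. l \<in> {1..t}}) = carrier Rp"
proof -
  have "P.Lgens = {Ye p |p. p \<in> mat_idx n - Zp} \<union> {YU l False |l. l \<in> {1..t}}"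
  proof -
    have 1: "{Ye p |p. p \<in> V} = {Yel n q r i j |i j. (i, j) \<in> V}" for V
      unfolding Ye_def by auto
    have 2: "{YU l False |l. l \<in> {1..t}} = {inv\<^bsub>Rp\<^esub> (Yel n q r i j) |i j. (i, j) \<in> Dp}"
      unfolding YU_eq Ye_def Dp_mem dp_def if_False prod.case by blast
    show ?thesis unfolding P.Lgens_def Rplus_eq 1 2 ..
  qed
  then show "{Ye p |p. p \<in> mat_idx n - Zp} \<union> {YU l False |l. l \<in> {1..t}} \<subseteq> carrier Rp"
    "subalg_gen Rp ({Ye p |p. p \<in> mat_idx n - Zp} \<union> {YU l False |l. l \<in> {1..t}}) = carrier Rp"
    using P.Lgens_sub P.L_gen unfolding Rplus_eq by simp_all
qed

lemma Rm_gen: "{Ze p |p. p \<in> mat_idx n - Zm} \<union> {ZU l False |l. l \<in> {1..t}} \<subseteq> carrier Rm"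
  "subalg_gen Rm ({Ze p |p. p \<in> mat_idx n - Zm} \<union> {ZU l False |l. l \<in> {1..t}}) = carrier Rm"
proof -
  have "M.Lgens = {Ze p |p. p \<in> mat_idx n - Zm} \<union> {ZU l False |l. l \<in> {1..t}}"
  proof -
    have 1: "{Ze p |p. p \<in> V} = {Zel n q c i j |i j. (i, j) \<in> V}" for V
      unfolding Ze_def by auto
    have 2: "{ZU l False |l. l \<in> {1..t}} = {inv\<^bsub>Rm\<^esub> (Zel n q c i j) |i j. (i, j) \<in> Dm}"
      unfolding ZU_eq Ze_def Dm_mem dm_def if_False prod.case by blast
    show ?thesis unfolding M.Lgens_def Rminus_eq 1 2 ..
  qed
  then show "{Ze p |p. p \<in> mat_idx n - Zm} \<union> {ZU l False |l. l \<in> {1..t}} \<subseteq> carrier Rm"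
    "subalg_gen Rm ({Ze p |p. p \<in> mat_idx n - Zm} \<union> {ZU l False |l. l \<in> {1..t}}) = carrier Rm"
    using M.Lgens_sub M.L_gen unfolding Rminus_eq by simp_all
qed

sublocale T: tensor_setup Rp Rm
  rewrites "tensor_alg Rp Rm = RT"
  using Rp_kalg Rm_kalg by (simp_all add: tensor_setup_def RR_def)

lemma RT_kalg: "kalg RT" by (rule T.tensor_kalg)

text \<open>\<open>a\<close>, \<open>b\<close> scale rows and columns of Y, and \<open>a'\<close>,
  \<open>b'\<close> those of Z. Restriction supplies the extensional representative that
  \<open>torus\<close> asks for, so arbitrary functions may be given.\<close>

definition el :: "(nat \<Rightarrow> 'k) \<Rightarrow> (nat \<Rightarrow> 'k) \<Rightarrow> (nat \<Rightarrow> 'k) \<Rightarrow> (nat \<Rightarrow> 'k) \<Rightarrow> 'k hgrp \<times> 'k hgrp" where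
  "el a b a' b' = ((restrict a {1..n}, restrict b {1..n}), (restrict a' {1..n}, restrict b' {1..n}))"

definition nz :: "(nat \<Rightarrow> 'k) \<Rightarrow> bool" where "nz a \<longleftrightarrow> (\<forall>i\<in>{1..n}. a i \<noteq> 0)"

abbreviation G where "G \<equiv> carrier (H n \<times>\<times> H n :: ('k hgrp \<times> 'k hgrp) monoid)"
abbreviation Gt where "Gt \<equiv> carrier (Htilde n :: ('k hgrp \<times> 'k hgrp) monoid)"

lemma nz_one [simp]: "nz (\<lambda>_. 1)" by (simp add: nz_def)

lemma restrict_torus: "restrict a {1..n} \<in> carrier (torus n) \<longleftrightarrow> nz a"
  by (auto simp: torus_def nz_def PiE_iff)

lemma el_G: "nz a \<Longrightarrow> nz b \<Longrightarrow> nz a' \<Longrightarrow> nz b' \<Longrightarrow> el a b a' b' \<in> G"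
  unfolding el_def H_def by (simp del: One_nat_def add: restrict_torus)

lemma torusE:
  assumes "a \<in> carrier (torus n :: (nat \<Rightarrow> 'k) monoid)"
  shows "nz a" "restrict a {1..n} = a"
  using assms by (auto simp: torus_def nz_def PiE_iff extensional_restrict)

lemma G_elim:
  assumes "g \<in> G"
  obtains a b a' b' where "g = el a b a' b'" "nz a" "nz b" "nz a'" "nz b'"
proof -
  obtain a b a' b' where g: "g = ((a, b), (a', b'))" by (metis surj_pair)
  then have "a \<in> carrier (torus n)" "b \<in> carrier (torus n)" "a' \<in> carrier (torus n)" "b' \<in> carrier (torus n)"
    using assms by (auto simp: H_def)
  from this[THEN torusE(1)] this[THEN torusE(2)] show ?thesis
    using g by (intro that[of a b a' b']) (simp_all add: el_def)
qed

lemma el_Gt: "nz a \<Longrightarrow> nz b' \<Longrightarrow> el a (\<lambda>_. 1) (\<lambda>_. 1) b' \<in> Gt"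
  unfolding Htilde_def el_def
  by (simp del: One_nat_def add: restrict_torus) (simp add: torus_def)

lemma Gt_sub_G: "Gt \<subseteq> G"
proof -
  have "\<one>\<^bsub>torus n\<^esub> \<in> carrier (torus n :: (nat \<Rightarrow> 'k) monoid)" by (simp add: torus_def)
  then show ?thesis unfolding Htilde_def H_def by auto
qed

text \<open>Each tensor factor is an eigenvector, and the two scalars combine. The cases cover the
  generators of B and the units \<open>pt \<one> (ZU l e)\<close>.\<close>

lemma act_el:
  assumes "nz a" "nz b" "nz a'" "nz b'"
  shows "act (el a b a' b') \<in> alg_aut RT"
    "p \<in> mat_idx n \<Longrightarrow> p' \<in> mat_idx n \<Longrightarrow> act (el a b a' b') (pt (Ye p) (Ze p'))
      = (a (fst p) * b (snd p) * (a' (fst p') * b' (snd p'))) \<odot>\<^bsub>RT\<^esub> pt (Ye p) (Ze p')"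
    "l \<in> {1..t} \<Longrightarrow> act (el a b a' b') (pt (YU l False) (ZU l False))
      = inverse (a (entry r l) * b l * (a' l * b' (entry c l))) \<odot>\<^bsub>RT\<^esub> pt (YU l False) (ZU l False)"
    "l \<in> {1..t} \<Longrightarrow> act (el a b a' b') (pt \<one>\<^bsub>Rp\<^esub> (ZU l e))
      = (if e then a' l * b' (entry c l) else inverse (a' l * b' (entry c l))) \<odot>\<^bsub>RT\<^esub> pt \<one>\<^bsub>Rp\<^esub> (ZU l e)"
proof -
  interpret RT: kalg RT by (rule RT_kalg)
  define g h where "g = (restrict a {1..n}, restrict b {1..n})" and "h = (restrict a' {1..n}, restrict b' {1..n})"
  have gh: "P.torus_elem g" "P.torus_elem h" using assms by (simp_all add: g_def h_def P.torus_elem_def nz_def)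
  have \<chi>g: "P.\<chi> g i j = a i * b j" "P.\<chi> h i j = a' i * b' j" if "i \<in> {1..n}" "j \<in> {1..n}" for i j
    using that by (simp_all add: P.\<chi>_def g_def h_def)
  have \<chi>p: "case_prod (P.\<chi> g) p = a (fst p) * b (snd p)" "case_prod (P.\<chi> h) p = a' (fst p) * b' (snd p)"
    if "p \<in> mat_idx n" for p using that \<chi>g by (auto simp: mat_idx_def)
  note au = act_plus_aut[OF gh(1)] act_minus_aut[OF gh(2)]
  note aD = alg_homD[OF alg_aut_alg_hom[OF au(1)]]
  have e: "act (el a b a' b') = tensor_aut Rp Rm (act_plus n q r g) (act_minus n q c h)"
    by (simp add: act_RR_def el_def g_def h_def)
  show "act (el a b a' b') \<in> alg_aut RT" unfolding e using T.tensor_aut(1)[OF au] .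
  note ta = T.tensor_aut(2)[OF au]
  have sc: "pt (s \<odot>\<^bsub>Rp\<^esub> u) (s' \<odot>\<^bsub>Rm\<^esub> v) = (s * s') \<odot>\<^bsub>RT\<^esub> pt u v" if "u \<in> carrier Rp" "v \<in> carrier Rm" for u v s s'
    using that T.R.smult_closed T.S.smult_closed by (simp add: T.pt_smult_left T.pt_smult_right T.pt_closed RT.smult_smult mult.commute)
  show "act (el a b a' b') (pt (Ye p) (Ze p')) = (a (fst p) * b (snd p) * (a' (fst p') * b' (snd p'))) \<odot>\<^bsub>RT\<^esub> pt (Ye p) (Ze p')"
    if "p \<in> mat_idx n" "p' \<in> mat_idx n"
    unfolding e ta[OF Ye_closed[OF that(1)] Ze_closed[OF that(2)]] act_plus_Ye[OF gh(1) that(1)] act_minus_Ze[OF gh(2) that(2)]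
      sc[OF Ye_closed[OF that(1)] Ze_closed[OF that(2)]] \<chi>p(1)[OF that(1)] \<chi>p(2)[OF that(2)] ..
  show "act (el a b a' b') (pt (YU l False) (ZU l False))
      = inverse (a (entry r l) * b l * (a' l * b' (entry c l))) \<odot>\<^bsub>RT\<^esub> pt (YU l False) (ZU l False)" if l: "l \<in> {1..t}"
  proof -
    have d: "dp l \<in> mat_idx n" "dm l \<in> mat_idx n" using dp_idx[OF l] dm_idx[OF l] by simp_all
    show ?thesis
      unfolding e ta[OF YU_closed[OF l] ZU_closed[OF l]] act_plus_YU[OF gh(1) l] act_minus_ZU[OF gh(2) l] if_False
        sc[OF YU_closed[OF l] ZU_closed[OF l]] \<chi>p(1)[OF d(1)] \<chi>p(2)[OF d(2)]
      by (simp add: dp_def dm_def)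
  qed
  show "act (el a b a' b') (pt \<one>\<^bsub>Rp\<^esub> (ZU l e))
      = (if e then a' l * b' (entry c l) else inverse (a' l * b' (entry c l))) \<odot>\<^bsub>RT\<^esub> pt \<one>\<^bsub>Rp\<^esub> (ZU l e)" if l: "l \<in> {1..t}" for e
  proof -
    have d: "dm l \<in> mat_idx n" using dm_idx[OF l] by simp
    show ?thesis
      unfolding e ta[OF T.R.one_closed ZU_closed[OF l]] act_minus_ZU[OF gh(2) l] aD(5)
        T.pt_smult_right[OF T.R.one_closed ZU_closed[OF l]] \<chi>p(2)[OF d]
      by (simp add: dm_def)
  qed
qed

end

section \<open>Generators of B and verification of the axioms of
  \<open>torus_extension\<close>\<close>

locale rc_generic = rc_data +
  assumes nroot: "\<And>m::nat. m \<ge> 1 \<Longrightarrow> q ^ m \<noteq> 1"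
begin

abbreviation S where "S \<equiv> B_gens n q r c"

lemma S_elim:
  assumes "s \<in> S"
  obtains (pair) i l j where "l \<in> {1..t}" "(i, l) \<in> mat_idx n - Zp" "(l, j) \<in> mat_idx n - Zm"
      "s = pt (Ye (i, l)) (Ze (l, j))"
  | (inv) l where "l \<in> {1..t}" "s = pt (YU l False) (ZU l False)"
  using assms unfolding B_gens_def
proof (elim UnE CollectE exE conjE)
  fix i j l
  assume "s = pt (Yel n q r i l) (Zel n q c l j)" "l \<in> {1..t}" "i \<in> {entry r l..n}" "j \<in> {entry c l..n}"
  then show thesis using pair[of l i j] unfolding idx_p idx_m by (simp add: Ye_def Ze_def)
next
  fix l
  assume "s = pt (inv\<^bsub>Rp\<^esub> Yel n q r (entry r l) l) (inv\<^bsub>Rm\<^esub> Zel n q c l (entry c l))" "l \<in> {1..t}"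
  then show thesis using local.inv[of l] by (simp add: YU_eq ZU_eq Ye_def Ze_def dp_def dm_def)
qed

lemma S_pair:
  assumes "(i, l) \<in> mat_idx n - Zp" "(l, j) \<in> mat_idx n - Zm"
  shows "pt (Ye (i, l)) (Ze (l, j)) \<in> S"
  using assms unfolding idx_p idx_m B_gens_def by (intro UnI1) (auto simp: Ye_def Ze_def)

lemma S_inv:
  assumes "l \<in> {1..t}" shows "pt (YU l False) (ZU l False) \<in> S"
  unfolding B_gens_def by (intro UnI2 CollectI exI[of _ l]) (use assms in \<open>simp add: YU_eq ZU_eq Ye_def Ze_def dp_def dm_def\<close>)

lemma S_sub: "S \<subseteq> carrier RT"
proof
  fix s assume "s \<in> S"
  then show "s \<in> carrier RT"
    by (cases rule: S_elim) (auto intro!: T.pt_closed Ye_closed Ze_closed YU_closed ZU_closed)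
qed

definition zz where "zz l e = pt \<one>\<^bsub>Rp\<^esub> (ZU l e)"

text \<open>The value 1 beyond \<open>t\<close> keeps this an element of H x H whatever
  \<open>\<delta>\<close> does there. Scaling columns of Y is one choice; scaling rows of Z would
  act in the same way on B.\<close>

definition md where "md \<delta> = el (\<lambda>_. 1) (\<lambda>l. if l \<in> {1..t} then \<delta> l else 1) (\<lambda>_. 1) (\<lambda>_. 1)"

lemma md_nz: "(\<And>l. l \<in> {1..t} \<Longrightarrow> \<delta> l \<noteq> 0) \<Longrightarrow> nz (\<lambda>l. if l \<in> {1..t} then \<delta> l else 1)"
  by (simp add: nz_def)

lemma act_hom: "g \<in> G \<Longrightarrow> alg_hom RT RT (act g)"
  using act_el(1) alg_aut_alg_hom by (elim G_elim) blast

lemma idx: "p \<in> mat_idx n - V \<Longrightarrow> p \<in> mat_idx n" by simp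

lemma act_pair:
  assumes "nz a" "nz b" "nz a'" "nz b'" "(i, l) \<in> mat_idx n - Zp" "(l, j) \<in> mat_idx n - Zm"
  shows "act (el a b a' b') (pt (Ye (i, l)) (Ze (l, j)))
    = (a i * b l * (a' l * b' j)) \<odot>\<^bsub>RT\<^esub> pt (Ye (i, l)) (Ze (l, j))"
  using act_el(2)[OF assms(1-4) idx[OF assms(5)] idx[OF assms(6)]] by simp

lemma pair_closed:
  assumes "(i, l) \<in> mat_idx n - Zp" "(l, j) \<in> mat_idx n - Zm"
  shows "pt (Ye (i, l)) (Ze (l, j)) \<in> carrier RT"
  using S_pair[OF assms] S_sub by auto

lemma inv_closed: "l \<in> {1..t} \<Longrightarrow> pt (YU l False) (ZU l False) \<in> carrier RT"
  using S_inv S_sub by auto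

lemma act_md_pair:
  assumes "\<And>l. l \<in> {1..t} \<Longrightarrow> \<delta> l \<noteq> 0" "l \<in> {1..t}" "(i, l) \<in> mat_idx n - Zp" "(l, j) \<in> mat_idx n - Zm"
  shows "act (md \<delta>) (pt (Ye (i, l)) (Ze (l, j))) = \<delta> l \<odot>\<^bsub>RT\<^esub> pt (Ye (i, l)) (Ze (l, j))"
  unfolding md_def using act_pair[OF nz_one md_nz[OF assms(1)] nz_one nz_one assms(3,4)] assms(2) by simp

lemma act_md_inv:
  assumes "\<And>l. l \<in> {1..t} \<Longrightarrow> \<delta> l \<noteq> 0" "l \<in> {1..t}"
  shows "act (md \<delta>) (pt (YU l False) (ZU l False)) = inverse (\<delta> l) \<odot>\<^bsub>RT\<^esub> pt (YU l False) (ZU l False)"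
  unfolding md_def using act_el(3)[OF nz_one md_nz[OF assms(1)] nz_one nz_one assms(2)] assms(2) by simp

text \<open>The weight \<open>a i * \<delta> l * b' j\<close> shows the three independent scalings
  of a generator: outer row, inner index and outer column.\<close>

lemma act_two:
  assumes a: "nz a" "nz b'" and \<delta>: "\<And>l. l \<in> {1..t} \<Longrightarrow> \<delta> l \<noteq> 0"
  defines "h \<equiv> el a (\<lambda>_. 1) (\<lambda>_. 1) b'"
  shows "l \<in> {1..t} \<Longrightarrow> (i, l) \<in> mat_idx n - Zp \<Longrightarrow> (l, j) \<in> mat_idx n - Zm \<Longrightarrow>
      act h (act (md \<delta>) (pt (Ye (i, l)) (Ze (l, j)))) = (a i * \<delta> l * b' j) \<odot>\<^bsub>RT\<^esub> pt (Ye (i, l)) (Ze (l, j))"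
    and "l \<in> {1..t} \<Longrightarrow> act h (act (md \<delta>) (pt (YU l False) (ZU l False)))
      = inverse (a (entry r l) * \<delta> l * b' (entry c l)) \<odot>\<^bsub>RT\<^esub> pt (YU l False) (ZU l False)"
proof -
  interpret RT: kalg RT by (rule RT_kalg)
  have "h \<in> G" unfolding h_def by (intro el_G a nz_one)
  note hs = alg_homD(4)[OF act_hom[OF this]]
  show "act h (act (md \<delta>) (pt (Ye (i, l)) (Ze (l, j)))) = (a i * \<delta> l * b' j) \<odot>\<^bsub>RT\<^esub> pt (Ye (i, l)) (Ze (l, j))"
    if l: "l \<in> {1..t}" and ij: "(i, l) \<in> mat_idx n - Zp" "(l, j) \<in> mat_idx n - Zm"
  proof -
    have "act (md \<delta>) (pt (Ye (i, l)) (Ze (l, j))) = \<delta> l \<odot>\<^bsub>RT\<^esub> pt (Ye (i, l)) (Ze (l, j))"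
      using \<delta> l ij by (rule act_md_pair)
    then show ?thesis
      using hs[OF pair_closed[OF ij]] act_pair[OF a(1) nz_one nz_one a(2) ij] pair_closed[OF ij]
      by (simp add: h_def RT.smult_smult mult.commute mult.left_commute)
  qed
  show "act h (act (md \<delta>) (pt (YU l False) (ZU l False)))
      = inverse (a (entry r l) * \<delta> l * b' (entry c l)) \<odot>\<^bsub>RT\<^esub> pt (YU l False) (ZU l False)"
    if l: "l \<in> {1..t}"
  proof -
    have "act (md \<delta>) (pt (YU l False) (ZU l False)) = inverse (\<delta> l) \<odot>\<^bsub>RT\<^esub> pt (YU l False) (ZU l False)"
      using \<delta> l by (rule act_md_inv)
    then show ?thesis
      using hs[OF inv_closed[OF l]] act_el(3)[OF a(1) nz_one nz_one a(2) l] inv_closed[OF l]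
      by (simp add: h_def RT.smult_smult mult.commute mult.left_commute)
  qed
qed

lemma zz_closed: "l \<in> {1..t} \<Longrightarrow> zz l e \<in> carrier RT"
  unfolding zz_def by (intro T.pt_closed ZU_closed) simp_all

lemma S_eqI:
  assumes "\<And>i l j. l \<in> {1..t} \<Longrightarrow> (i, l) \<in> mat_idx n - Zp \<Longrightarrow> (l, j) \<in> mat_idx n - Zm \<Longrightarrow>
      f (pt (Ye (i, l)) (Ze (l, j))) = g (pt (Ye (i, l)) (Ze (l, j)))"
    and "\<And>l. l \<in> {1..t} \<Longrightarrow> f (pt (YU l False) (ZU l False)) = g (pt (YU l False) (ZU l False))"
  shows "\<forall>s\<in>S. f s = g s"
proof
  fix s assume "s \<in> S"
  then show "f s = g s" by (cases rule: S_elim) (simp_all add: assms)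
qed

lemma ZU_conj_inv:
  assumes l: "l \<in> {1..t}" and m: "m \<in> {1..t}"
  shows "ZU l e \<otimes>\<^bsub>Rm\<^esub> ZU m e' \<otimes>\<^bsub>Rm\<^esub> ZU l (\<not> e) = ZU m e'"
proof -
  have "ZU l e \<otimes>\<^bsub>Rm\<^esub> ZU m e' \<otimes>\<^bsub>Rm\<^esub> ZU l (\<not> e) = ZU m e' \<otimes>\<^bsub>Rm\<^esub> (ZU l e \<otimes>\<^bsub>Rm\<^esub> ZU l (\<not> e))"
    unfolding ZU_comm[OF l m, of e e'] using ZU_closed[OF l] ZU_closed[OF m] by (simp add: T.S.m_assoc)
  then show ?thesis using ZU_inv[OF l, of e] ZU_closed[OF m] by simp
qed

lemma YU_conj_inv:
  assumes l: "l \<in> {1..t}" and m: "m \<in> {1..t}"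
  shows "YU l e \<otimes>\<^bsub>Rp\<^esub> YU m e' \<otimes>\<^bsub>Rp\<^esub> YU l (\<not> e) = YU m e'"
proof -
  have "YU l e \<otimes>\<^bsub>Rp\<^esub> YU m e' \<otimes>\<^bsub>Rp\<^esub> YU l (\<not> e) = YU m e' \<otimes>\<^bsub>Rp\<^esub> (YU l e \<otimes>\<^bsub>Rp\<^esub> YU l (\<not> e))"
    unfolding YU_comm[OF l m, of e e'] using YU_closed[OF l] YU_closed[OF m] by (simp add: T.R.m_assoc)
  then show ?thesis using YU_inv[OF l, of e] YU_closed[OF m] by simp
qed

text \<open>Multiplying by a power of z_l strips off the second factor: Y_il (x) 1 comes from Y_il
  (x) Z_(l, c_l), and the inverse of y_l from the inverse of y_l z_l. To reach 1 (x) Z_lj, its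
  product with y_l is multiplied by the inverse of y_l z_l and then by z_l.\<close>

lemma gen_RT: "subalg_gen RT (S \<union> {zz l e |l e. l \<in> {1..t}}) = carrier RT"
proof -
  interpret RT: kalg RT by (rule RT_kalg)
  let ?W = "S \<union> {zz l e |l e. l \<in> {1..t}}"
  have W: "?W \<subseteq> carrier RT" using S_sub zz_closed by auto
  note sD = subalgD[OF RT.subalg_gen_subalg[OF W]]
  have Sin: "s \<in> subalg_gen RT ?W" if "s \<in> S" for s
    using that by (intro subsetD[OF subalg_gen_incl] UnI1)
  have zin: "zz l e \<in> subalg_gen RT ?W" if "l \<in> {1..t}" for l e
    using that by (intro subsetD[OF subalg_gen_incl] UnI2) blast
  let ?A = "{Ye p |p. p \<in> mat_idx n - Zp} \<union> {YU l False |l. l \<in> {1..t}}"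
  let ?B = "{Ze p |p. p \<in> mat_idx n - Zm} \<union> {ZU l False |l. l \<in> {1..t}}"
  have g: "subalg_gen RT ((\<lambda>a. pt a \<one>\<^bsub>Rm\<^esub>) ` ?A \<union> (\<lambda>b. pt \<one>\<^bsub>Rp\<^esub> b) ` ?B) = carrier RT"
    by (rule T.tensor_gen[OF Rp_gen Rm_gen])
  have "(\<lambda>a. pt a \<one>\<^bsub>Rm\<^esub>) ` ?A \<union> (\<lambda>b. pt \<one>\<^bsub>Rp\<^esub> b) ` ?B \<subseteq> subalg_gen RT ?W"
  proof
    fix y assume "y \<in> (\<lambda>a. pt a \<one>\<^bsub>Rm\<^esub>) ` ?A \<union> (\<lambda>b. pt \<one>\<^bsub>Rp\<^esub> b) ` ?B"
    then consider i l where "y = pt (Ye (i, l)) \<one>\<^bsub>Rm\<^esub>" "(i, l) \<in> mat_idx n - Zp"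
      | l where "y = pt (YU l False) \<one>\<^bsub>Rm\<^esub>" "l \<in> {1..t}"
      | l j where "y = pt \<one>\<^bsub>Rp\<^esub> (Ze (l, j))" "(l, j) \<in> mat_idx n - Zm"
      | l where "y = pt \<one>\<^bsub>Rp\<^esub> (ZU l False)" "l \<in> {1..t}"
      by (elim UnE imageE CollectE exE conjE) (metis surj_pair)+
    then show "y \<in> subalg_gen RT ?W"
    proof cases
      case 1
      have l: "l \<in> {1..t}" using 1(2) unfolding idx_p by simp
      have d: "(l, entry c l) \<in> mat_idx n - Zm" using dm_idx[OF l] by (simp add: dm_def)
      have e: "Ze (l, entry c l) = ZU l True" by (simp add: ZU_eq dm_def)
      have "y = pt (Ye (i, l)) (Ze (l, entry c l)) \<otimes>\<^bsub>RT\<^esub> zz l False"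
        unfolding 1(1) e zz_def using ZU_inv[OF l, of True] Ye_closed[OF idx[OF 1(2)]] ZU_closed[OF l]
        by (simp add: T.pt_mult)
      then show ?thesis using sD(5)[OF Sin[OF S_pair[OF 1(2) d]] zin[OF l]] by simp
    next
      case 2
      have "y = pt (YU l False) (ZU l False) \<otimes>\<^bsub>RT\<^esub> zz l True"
        unfolding 2(1) zz_def using ZU_inv[OF 2(2), of False] YU_closed[OF 2(2)] ZU_closed[OF 2(2)]
        by (simp add: T.pt_mult)
      then show ?thesis using sD(5)[OF Sin[OF S_inv[OF 2(2)]] zin[OF 2(2)]] by simp
    next
      case 3
      have l: "l \<in> {1..t}" using 3(2) unfolding idx_m by simp
      have d: "(entry r l, l) \<in> mat_idx n - Zp" using dp_idx[OF l] by (simp add: dp_def)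
      have e: "Ye (entry r l, l) = YU l True" by (simp add: YU_eq dp_def)
      have Zc: "Ze (l, j) \<in> carrier Rm" using Ze_closed[OF idx[OF 3(2)]] .
      have "y = (pt (Ye (entry r l, l)) (Ze (l, j)) \<otimes>\<^bsub>RT\<^esub> pt (YU l False) (ZU l False)) \<otimes>\<^bsub>RT\<^esub> zz l True"
        unfolding 3(1) e zz_def
        using ZU_inv[OF l, of False] YU_inv[OF l, of True] YU_closed[OF l] ZU_closed[OF l] Zc
        by (simp add: T.pt_mult T.S.m_assoc)
      then show ?thesis using sD(5)[OF sD(5)[OF Sin[OF S_pair[OF d 3(2)]] Sin[OF S_inv[OF l]]] zin[OF l]] by simp
    next
      case 4
      then show ?thesis using zin[OF 4(2), of False] by (simp add: zz_def)
    qed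
  qed
  from RT.subalg_gen_mono[OF this W] show ?thesis unfolding g using sD(1) by simp
qed

lemma extension: "torus_extension RT q t S act G Gt zz md"
proof (intro torus_extension.intro torus_extension_axioms.intro RT_kalg q_nonzero nroot S_sub act_hom Gt_sub_G zz_closed gen_RT)
  interpret RT: kalg RT by (rule RT_kalg)
  note Zc = ZU_closed
  show "zz l e \<otimes>\<^bsub>RT\<^esub> zz l (\<not> e) = \<one>\<^bsub>RT\<^esub>" if l: "l \<in> {1..t}" for l e
    using ZU_inv[OF l, of e] Zc[OF l] by (simp add: zz_def T.pt_mult T.pt_one)
  show "zz l e \<otimes>\<^bsub>RT\<^esub> zz m e' = zz m e' \<otimes>\<^bsub>RT\<^esub> zz l e" if l: "l \<in> {1..t}" "m \<in> {1..t}" for l m e e'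
    using ZU_comm[OF l, of e e'] Zc[OF l(1)] Zc[OF l(2)] by (simp add: zz_def T.pt_mult)
  show "\<exists>\<kappa>. act g s = \<kappa> \<odot>\<^bsub>RT\<^esub> s" if g: "g \<in> G" and s: "s \<in> S" for g s
  proof -
    obtain a b a' b' where g: "g = el a b a' b'" "nz a" "nz b" "nz a'" "nz b'" using g by (rule G_elim)
    from s show ?thesis
    proof (cases rule: S_elim)
      case (pair i l j)
      show ?thesis unfolding pair(4) g(1) act_pair[OF g(2-5) pair(2,3)] by (rule exI) (rule refl)
    next
      case (inv l)
      show ?thesis unfolding inv(2) g(1) act_el(3)[OF g(2-5) inv(1)] by (rule exI) (rule refl)
    qed
  qed
  show "\<exists>\<kappa>. act g (zz l e) = \<kappa> \<odot>\<^bsub>RT\<^esub> zz l e" if g: "g \<in> G" and l: "l \<in> {1..t}" for g l e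
  proof -
    obtain a b a' b' where g: "g = el a b a' b'" "nz a" "nz b" "nz a'" "nz b'" using g by (rule G_elim)
    show ?thesis unfolding zz_def g(1) act_el(4)[OF g(2-5) l] by (rule exI) (rule refl)
  qed
  show "md \<delta> \<in> G" if "\<And>l. l \<in> {1..t} \<Longrightarrow> \<delta> l \<noteq> 0" for \<delta>
    unfolding md_def by (intro el_G nz_one md_nz that)
  show "\<exists>d. (\<forall>l. l \<notin> {1..t} \<longrightarrow> d l = 0) \<and> (\<forall>\<delta>. (\<forall>l\<in>{1..t}. \<delta> l \<noteq> 0) \<longrightarrow>
        act (md \<delta>) s = (\<Prod>l\<in>{1..t}. \<delta> l powi d l) \<odot>\<^bsub>RT\<^esub> s)" if s: "s \<in> S" for s
    using s
  proof (cases rule: S_elim)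
    case (pair i l j)
    \<comment> \<open>The inner degree of this generator is the unit vector at l; that of the
      inverse generator is its negative.\<close>
    have "(\<Prod>m\<in>{1..t}. \<delta> m powi (if m = l then 1 else 0)) = \<delta> l" for \<delta> :: "nat \<Rightarrow> 'a"
    proof -
      have "(\<Prod>m\<in>{1..t}. \<delta> m powi (if m = l then 1 else 0)) = (\<Prod>m\<in>{1..t}. if m = l then \<delta> m else 1)"
        by (intro prod.cong) auto
      then show ?thesis using pair(1) by simp
    qed
    then show ?thesis using pair(1) act_md_pair[OF _ pair(1-3)]
      unfolding pair(4) by (intro exI[of _ "\<lambda>m. if m = l then 1 else 0"]) auto
  next
    case (inv l)
    have "(\<Prod>m\<in>{1..t}. \<delta> m powi (if m = l then -1 else 0)) = inverse (\<delta> l)" for \<delta> :: "nat \<Rightarrow> 'a"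
    proof -
      have "(\<Prod>m\<in>{1..t}. \<delta> m powi (if m = l then -1 else 0)) = (\<Prod>m\<in>{1..t}. if m = l then inverse (\<delta> m) else 1)"
        by (intro prod.cong) (auto simp: power_int_minus)
      then show ?thesis using inv(1) by simp
    qed
    then show ?thesis using inv(1) act_md_inv[OF _ inv(1)]
      unfolding inv(2) by (intro exI[of _ "\<lambda>m. if m = l then -1 else 0"]) auto
  qed
  show "\<exists>h\<in>Gt. \<exists>\<delta>. (\<forall>l\<in>{1..t}. \<delta> l \<noteq> 0) \<and> (\<forall>s\<in>S. act g s = act h (act (md \<delta>) s))" if g: "g \<in> G" for g
  proof -
    obtain a b a' b' where g: "g = el a b a' b'" "nz a" "nz b" "nz a'" "nz b'" using g by (rule G_elim)
    \<comment> \<open>The inner index occurs as a column of Y and as a row of Z, so both scalars are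
      collected; what remains, \<open>a\<close> and \<open>b'\<close>, is an element of
      \<open>Gt\<close>.\<close>
    define \<delta> where "\<delta> = (\<lambda>l. b l * a' l)"
    have \<delta>: "\<delta> l \<noteq> 0" if "l \<in> {1..t}" for l using g(3,4) l_range[OF that] by (simp add: \<delta>_def nz_def)
    have "\<forall>s\<in>S. act g s = act (el a (\<lambda>_. 1) (\<lambda>_. 1) b') (act (md \<delta>) s)"
      unfolding g(1)
    proof (rule S_eqI)
      fix i l j assume l: "l \<in> {1..t}" and ij: "(i, l) \<in> mat_idx n - Zp" "(l, j) \<in> mat_idx n - Zm"
      show "act (el a b a' b') (pt (Ye (i, l)) (Ze (l, j)))
          = act (el a (\<lambda>_. 1) (\<lambda>_. 1) b') (act (md \<delta>) (pt (Ye (i, l)) (Ze (l, j))))"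
      proof -
        have "act (el a (\<lambda>_. 1) (\<lambda>_. 1) b') (act (md \<delta>) (pt (Ye (i, l)) (Ze (l, j))))
            = (a i * \<delta> l * b' j) \<odot>\<^bsub>RT\<^esub> pt (Ye (i, l)) (Ze (l, j))"
          using g(2,5) \<delta> l ij by (rule act_two(1))
        moreover have "a i * \<delta> l * b' j = a i * b l * (a' l * b' j)" by (simp add: \<delta>_def ac_simps)
        ultimately show ?thesis using act_pair[OF g(2-5) ij] by simp
      qed
    next
      fix l assume l: "l \<in> {1..t}"
      show "act (el a b a' b') (pt (YU l False) (ZU l False))
          = act (el a (\<lambda>_. 1) (\<lambda>_. 1) b') (act (md \<delta>) (pt (YU l False) (ZU l False)))"
      proof -
        have "act (el a (\<lambda>_. 1) (\<lambda>_. 1) b') (act (md \<delta>) (pt (YU l False) (ZU l False)))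
            = inverse (a (entry r l) * \<delta> l * b' (entry c l)) \<odot>\<^bsub>RT\<^esub> pt (YU l False) (ZU l False)"
          using g(2,5) \<delta> l by (rule act_two(2))
        moreover have "a (entry r l) * \<delta> l * b' (entry c l) = a (entry r l) * b l * (a' l * b' (entry c l))"
          by (simp add: \<delta>_def ac_simps)
        ultimately show ?thesis using act_el(3)[OF g(2-5) l] by simp
      qed
    qed
    then show ?thesis using el_Gt[OF g(2,5)] \<delta> by blast
  qed
  show "\<exists>h\<in>Gt. \<exists>\<delta>. (\<forall>l\<in>{1..t}. \<delta> l \<noteq> 0) \<and>
        (\<forall>s\<in>S. zz l e \<otimes>\<^bsub>RT\<^esub> s \<otimes>\<^bsub>RT\<^esub> zz l (\<not> e) = act h (act (md \<delta>) s))" if l: "l \<in> {1..t}" for l e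
  proof -
    \<comment> \<open>Conjugation by \<open>zz l e\<close> scales row l of Z by \<open>u\<close> and
      column c_l of Z by \<open>inverse u\<close>. The row is an inner index and goes into
      \<open>\<delta>\<close>; the column is an outer one and goes into \<open>b'\<close>.\<close>
    define u where "u = (if e then q else inverse q)"
    have u: "u \<noteq> 0" using q_nonzero by (simp add: u_def)
    define b' where "b' = (\<lambda>j. if j = entry c l then inverse u else 1)"
    define \<delta> where "\<delta> = (\<lambda>m. if m = l then u else 1)"
    have b': "nz b'" and \<delta>: "\<And>m. m \<in> {1..t} \<Longrightarrow> \<delta> m \<noteq> 0" using u by (simp_all add: b'_def nz_def \<delta>_def)
    have "\<forall>s\<in>S. zz l e \<otimes>\<^bsub>RT\<^esub> s \<otimes>\<^bsub>RT\<^esub> zz l (\<not> e) = act (el (\<lambda>_. 1) (\<lambda>_. 1) (\<lambda>_. 1) b') (act (md \<delta>) s)"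
    proof (rule S_eqI)
      fix i m j assume m: "m \<in> {1..t}" and ij: "(i, m) \<in> mat_idx n - Zp" "(m, j) \<in> mat_idx n - Zm"
      note Yc = Ye_closed[OF idx[OF ij(1)]] Ze_closed[OF idx[OF ij(2)]]
      have "zz l e \<otimes>\<^bsub>RT\<^esub> pt (Ye (i, m)) (Ze (m, j)) \<otimes>\<^bsub>RT\<^esub> zz l (\<not> e)
          = pt (Ye (i, m)) (ZU l e \<otimes>\<^bsub>Rm\<^esub> Ze (m, j) \<otimes>\<^bsub>Rm\<^esub> ZU l (\<not> e))"
        unfolding zz_def using Yc Zc[OF l] by (simp add: T.pt_mult)
      also have "\<dots> = M.\<kappa>' l e (m, j) \<odot>\<^bsub>RT\<^esub> pt (Ye (i, m)) (Ze (m, j))"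
        unfolding ZU_conj[OF l ij(2)] using Yc by (simp add: T.pt_smult_right)
      also have "M.\<kappa>' l e (m, j) = 1 * \<delta> m * b' j"
        using q_nonzero by (auto simp: M.\<kappa>'_def \<kappa>m_def \<delta>_def b'_def u_def)
      finally show "zz l e \<otimes>\<^bsub>RT\<^esub> pt (Ye (i, m)) (Ze (m, j)) \<otimes>\<^bsub>RT\<^esub> zz l (\<not> e)
          = act (el (\<lambda>_. 1) (\<lambda>_. 1) (\<lambda>_. 1) b') (act (md \<delta>) (pt (Ye (i, m)) (Ze (m, j))))"
        using act_two(1)[of "\<lambda>_. 1" b' \<delta>, OF nz_one b' \<delta> m ij] by simp
    next
      fix m assume m: "m \<in> {1..t}"
      have "zz l e \<otimes>\<^bsub>RT\<^esub> pt (YU m False) (ZU m False) \<otimes>\<^bsub>RT\<^esub> zz l (\<not> e)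
          = pt (YU m False) (ZU l e \<otimes>\<^bsub>Rm\<^esub> ZU m False \<otimes>\<^bsub>Rm\<^esub> ZU l (\<not> e))"
        unfolding zz_def using YU_closed[OF m] Zc[OF m] Zc[OF l] by (simp add: T.pt_mult)
      also have "\<dots> = inverse (1 * \<delta> m * b' (entry c m)) \<odot>\<^bsub>RT\<^esub> pt (YU m False) (ZU m False)"
        unfolding ZU_conj_inv[OF l m] using entry_inj(2)[OF m l] u inv_closed[OF m]
        by (auto simp: \<delta>_def b'_def)
      finally show "zz l e \<otimes>\<^bsub>RT\<^esub> pt (YU m False) (ZU m False) \<otimes>\<^bsub>RT\<^esub> zz l (\<not> e)
          = act (el (\<lambda>_. 1) (\<lambda>_. 1) (\<lambda>_. 1) b') (act (md \<delta>) (pt (YU m False) (ZU m False)))"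
        using act_two(2)[of "\<lambda>_. 1" b' \<delta>, OF nz_one b' \<delta> m] by simp
    qed
    then show ?thesis using el_Gt[OF nz_one b'] \<delta> by blast
  qed
  show "\<exists>w\<in>subalg_gen RT S. \<exists>w'\<in>subalg_gen RT S. \<exists>h\<in>Gt. w \<otimes>\<^bsub>RT\<^esub> w' = \<one>\<^bsub>RT\<^esub> \<and> w' \<otimes>\<^bsub>RT\<^esub> w = \<one>\<^bsub>RT\<^esub> \<and>
        (\<forall>s\<in>S. act (md (\<lambda>m. if m = l then q\<^sup>2 else 1)) s = act h (w \<otimes>\<^bsub>RT\<^esub> s \<otimes>\<^bsub>RT\<^esub> w'))" if l: "l \<in> {1..t}" for l
  proof -
    \<comment> \<open>Conjugation by \<open>w\<close> scales column l of Y and row l of Z by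
      \<open>q\<close> each, hence the inner index l by \<open>q\<^sup>2\<close>. It also scales row
      r_l of Y and column c_l of Z by \<open>inverse q\<close>; \<open>a\<close> and
      \<open>b'\<close> undo this from within \<open>Gt\<close>.\<close>
    define w w' where "w = pt (YU l True) (ZU l True)" and "w' = pt (YU l False) (ZU l False)"
    define a where "a = (\<lambda>i. if i = entry r l then q else 1)"
    define b' where "b' = (\<lambda>j. if j = entry c l then q else 1)"
    define \<mu> where "\<mu> = (\<lambda>m. if m = l then q\<^sup>2 else 1)"
    have nz: "nz a" "nz b'" and \<mu>: "\<And>m. m \<in> {1..t} \<Longrightarrow> \<mu> m \<noteq> 0"
      using q_nonzero by (simp_all add: a_def b'_def nz_def \<mu>_def)
    define h where "h = el a (\<lambda>_. 1) (\<lambda>_. 1) b'"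
    have hG: "h \<in> G" unfolding h_def by (intro el_G nz nz_one)
    note hs = alg_homD(4)[OF act_hom[OF hG]]
    note c = YU_closed[OF l] Zc[OF l]
    have wS: "w \<in> S" "w' \<in> S"
      using S_pair[of "entry r l" l "entry c l"] dp_idx[OF l] dm_idx[OF l] S_inv[OF l]
      by (simp_all add: w_def w'_def YU_eq ZU_eq dp_def dm_def)
    have ww: "w \<otimes>\<^bsub>RT\<^esub> w' = \<one>\<^bsub>RT\<^esub>" "w' \<otimes>\<^bsub>RT\<^esub> w = \<one>\<^bsub>RT\<^esub>"
      using YU_inv[OF l, of True] YU_inv[OF l, of False] ZU_inv[OF l, of True] ZU_inv[OF l, of False] c
      by (simp_all add: w_def w'_def T.pt_mult T.pt_one)
    have "\<forall>s\<in>S. act (md \<mu>) s = act h (w \<otimes>\<^bsub>RT\<^esub> s \<otimes>\<^bsub>RT\<^esub> w')"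
    proof (rule S_eqI)
      fix i m j assume m: "m \<in> {1..t}" and ij: "(i, m) \<in> mat_idx n - Zp" "(m, j) \<in> mat_idx n - Zm"
      note Yc = Ye_closed[OF idx[OF ij(1)]] Ze_closed[OF idx[OF ij(2)]]
      have "w \<otimes>\<^bsub>RT\<^esub> pt (Ye (i, m)) (Ze (m, j)) \<otimes>\<^bsub>RT\<^esub> w'
          = pt (YU l True \<otimes>\<^bsub>Rp\<^esub> Ye (i, m) \<otimes>\<^bsub>Rp\<^esub> YU l False) (ZU l True \<otimes>\<^bsub>Rm\<^esub> Ze (m, j) \<otimes>\<^bsub>Rm\<^esub> ZU l False)"
        unfolding w_def w'_def using Yc c by (simp add: T.pt_mult)
      also have "\<dots> = pt (\<kappa>p l (i, m) \<odot>\<^bsub>Rp\<^esub> Ye (i, m)) (\<kappa>m l (m, j) \<odot>\<^bsub>Rm\<^esub> Ze (m, j))"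
        using YU_conj[OF l ij(1), of True] ZU_conj[OF l ij(2), of True] by (simp add: P.\<kappa>'_def M.\<kappa>'_def)
      also have "\<dots> = (\<kappa>p l (i, m) * \<kappa>m l (m, j)) \<odot>\<^bsub>RT\<^esub> pt (Ye (i, m)) (Ze (m, j))"
        using Yc by (simp add: T.pt_smult_left T.pt_smult_right T.pt_closed RT.smult_smult mult.commute)
      finally have "act h (w \<otimes>\<^bsub>RT\<^esub> pt (Ye (i, m)) (Ze (m, j)) \<otimes>\<^bsub>RT\<^esub> w')
          = ((\<kappa>p l (i, m) * \<kappa>m l (m, j)) * (a i * 1 * (1 * b' j))) \<odot>\<^bsub>RT\<^esub> pt (Ye (i, m)) (Ze (m, j))"
        using hs[OF pair_closed[OF ij]] act_pair[OF nz(1) nz_one nz_one nz(2) ij] pair_closed[OF ij]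
        by (simp add: h_def RT.smult_smult)
      also have "(\<kappa>p l (i, m) * \<kappa>m l (m, j)) * (a i * 1 * (1 * b' j)) = \<mu> m"
        using q_nonzero by (simp add: \<kappa>p_def \<kappa>m_def a_def b'_def \<mu>_def power2_eq_square field_simps)
      finally show "act (md \<mu>) (pt (Ye (i, m)) (Ze (m, j))) = act h (w \<otimes>\<^bsub>RT\<^esub> pt (Ye (i, m)) (Ze (m, j)) \<otimes>\<^bsub>RT\<^esub> w')"
        using act_md_pair[OF \<mu> m ij] by simp
    next
      fix m assume m: "m \<in> {1..t}"
      have "w \<otimes>\<^bsub>RT\<^esub> pt (YU m False) (ZU m False) \<otimes>\<^bsub>RT\<^esub> w'
          = pt (YU l True \<otimes>\<^bsub>Rp\<^esub> YU m False \<otimes>\<^bsub>Rp\<^esub> YU l False) (ZU l True \<otimes>\<^bsub>Rm\<^esub> ZU m False \<otimes>\<^bsub>Rm\<^esub> ZU l False)"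
        unfolding w_def w'_def using YU_closed[OF m] Zc[OF m] c by (simp add: T.pt_mult)
      also have "\<dots> = pt (YU m False) (ZU m False)"
        using YU_conj_inv[OF l m, of True False] ZU_conj_inv[OF l m, of True False] by simp
      finally have "act h (w \<otimes>\<^bsub>RT\<^esub> pt (YU m False) (ZU m False) \<otimes>\<^bsub>RT\<^esub> w')
          = inverse (a (entry r m) * 1 * (1 * b' (entry c m))) \<odot>\<^bsub>RT\<^esub> pt (YU m False) (ZU m False)"
        using act_el(3)[OF nz(1) nz_one nz_one nz(2) m] by (simp add: h_def)
      also have "a (entry r m) * 1 * (1 * b' (entry c m)) = \<mu> m"
        using entry_inj[OF m l] by (simp add: a_def b'_def \<mu>_def power2_eq_square)
      finally show "act (md \<mu>) (pt (YU m False) (ZU m False)) = act h (w \<otimes>\<^bsub>RT\<^esub> pt (YU m False) (ZU m False) \<otimes>\<^bsub>RT\<^esub> w')"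
        using act_md_inv[OF \<mu> m] by simp
    qed
    then show ?thesis
      using wS[THEN subsetD[OF subalg_gen_incl]] ww el_Gt[OF nz] unfolding h_def[symmetric] \<mu>_def by blast
  qed
  show "\<exists>g\<in>G. (\<forall>s\<in>S. act g s = s) \<and>
        (\<forall>m\<in>{1..t}. act g (zz m True) = (if m = l then q else 1) \<odot>\<^bsub>RT\<^esub> zz m True \<and>
                     act g (zz m False) = (if m = l then inverse q else 1) \<odot>\<^bsub>RT\<^esub> zz m False)" if l: "l \<in> {1..t}" for l
  proof -
    \<comment> \<open>Column l of Y and row l of Z are scaled inversely to each other: on B the two
      scalars cancel, while \<open>zz l e\<close> only feels \<open>a'\<close>.\<close>
    define b where "b = (\<lambda>m. if m = l then inverse q else 1)"
    define a' where "a' = (\<lambda>m. if m = l then q else 1)"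
    have nz: "nz b" "nz a'" using q_nonzero by (simp_all add: b_def a'_def nz_def)
    define g where "g = el (\<lambda>_. 1) b a' (\<lambda>_. 1)"
    have ba: "b m * a' m = 1" for m using q_nonzero by (simp add: b_def a'_def)
    have "\<forall>s\<in>S. act g s = id s"
      unfolding g_def
      by (rule S_eqI) (simp_all add: act_pair[OF nz_one nz nz_one] act_el(3)[OF nz_one nz nz_one] ba pair_closed inv_closed)
    then show ?thesis
      using el_G[OF nz_one nz nz_one] act_el(4)[OF nz_one nz nz_one]
      by (intro bexI[of _ g]) (simp_all add: g_def zz_def a'_def)
  qed
qed

theorem unique_prime:
  assumes "G_prime (Htilde n) act (B_alg n q r c) P"
  shows "\<exists>!Q. G_prime (H n \<times>\<times> H n) act RT Q \<and> Q \<inter> carrier (B_alg n q r c) = P"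
proof -
  interpret E: torus_extension RT q t S act G Gt zz md by (rule extension)
  have "B_alg n q r c = E.RB" "carrier (B_alg n q r c) = E.B" by (simp_all add: B_alg_def)
  then show ?thesis using E.unique_G_prime_over[OF refl refl] assms by simp
qed

end

theorem lemma3p4:
  fixes q :: "'k::field" and n :: nat and r c :: "nat list" and P :: "'k qm_tensor set"
  assumes "n \<ge> 1" and "q \<noteq> 0" and "\<And>m::nat. m \<ge> 1 \<Longrightarrow> q ^ m \<noteq> 1"
    and "(r, c) \<in> RC n"
    and "G_prime (Htilde n) (act_RR n q r c) (B_alg n q r c) P"
  shows "\<exists>!Q. G_prime (H n \<times>\<times> H n) (act_RR n q r c) (RR n q r c) Q \<and>
              Q \<inter> carrier (B_alg n q r c) = P"
proof -
  interpret rc_generic n q r c using assms(2,3,4) by unfold_locales auto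
  show ?thesis using assms(5) by (rule unique_prime)
qed

end
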